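(* Let $\phi\in C^\infty_{per}([0,L])$ be an $L$-periodic solution of $\mathcal{M}\phi+\omega\phi-f(\phi)+A=0$ with $\omega,A\in\mathbb{R}$, let $\mathcal{L}=\mathcal{M}+\omega-f'(\phi)$, and let $(\mu,\nu)\in\mathbb{R}^2\setminus\{(0,0)\}$, $Q'(\phi)=\mu+\nu\phi$. Assume that the Cauchy problem for $u_t+(f(u))_x-(\mathcal{M}u)_x=0$ is globally well-posed in $H^s_{per}([0,L])$ for some $s\ge \frac m2$, and that: $(H_0)$ $\mathcal{L}$ has only one negative eigenvalue, which is simple, and zero is a simple eigenvalue of $\mathcal{L}$ with eigenfunction $\phi'$; $(H_1)$ there are constants $c_1,c_2>0$ such that $(\mathcal{L}v,v)\ge c_1\|v\|_{\frac m2}^2-c_2\|v\|^2$ for all $v\in C^\infty_{per}([0,L])$; $(H_2)$ there is $c_3>0$ such that $(\mathcal{L}v,v)\ge c_3\|v\|^2$ for all $v\in H^m_{per}([0,L])$ satisfying $(v,\phi')=(v,Q'(\phi))=0$. Then the periodic traveling wave $\phi$ is orbitally stable in $H^{\frac m2}_{per}([0,L])$.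
   Context: All functions are real-valued and $L$-periodic, $L>0$. $H^s_{per}([0,L])$ is the usual periodic Sobolev space with norm $\|\cdot\|_s$ and inner product $(\cdot,\cdot)_s$; $\|\cdot\|=\|\cdot\|_0$ and $(\cdot,\cdot)=(\cdot,\cdot)_0$ are those of $L^2_{per}([0,L])$. $f:\mathbb{R}\to\mathbb{R}$ is smooth. $\mathcal{M}$ is the Fourier multiplier $\widehat{\mathcal{M}g}(\kappa)=\theta(\kappa)\widehat g(\kappa)$, $\kappa\in\mathbb{Z}$, where $\theta:\mathbb{R}\to\mathbb{R}$ is even and continuous and there are $m>0$, $\upsilon_1,\upsilon_2>0$ and $\kappa_0$ with $\upsilon_1|\kappa|^m\le\theta(\kappa)\le\upsilon_2|\kappa|^m$ for $|\kappa|\ge\kappa_0$. $\mathcal{L}$ is regarded as a self-adjoint operator on $L^2_{per}([0,L])$ with domain $H^m_{per}([0,L])$. Traveling waves are solutions $u(x,t)=\phi(x-\omega t)$. Standing assumption: the functionals $P(u)=\frac12\int_0^L u\mathcal{M}u\,dx-\int_0^L W(u)\,dx$ (with $W'=f$), $F(u)=\frac12\int_0^L u^2dx$ and $M(u)=\int_0^L u\,dx$ are well defined and smooth on $H^{\frac m2}_{per}([0,L])$ and are conserved by the solutions of the equation. Here $Q(u)=\mu M(u)+\nu F(u)$, so $Q'(\phi)=\mu+\nu\phi$. Global well-posedness in $H^s_{per}$ means in particular that each initial datum $u_0\in H^s_{per}([0,L])$ yields a unique solution $u(t)$ defined for all $t\ge0$ and continuous in time with values in $H^s_{per}([0,L])$.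 Orbital stability. Let $\Omega_\phi=\{\phi(\cdot+r): r\in\mathbb{R}\}$ and $d(v,\Omega_\phi)=\inf_{r\in\mathbb{R}}\|v-\phi(\cdot+r)\|_{\frac m2}$. The wave $\phi$ is orbitally stable in $H^{\frac m2}_{per}([0,L])$ if for every $\varepsilon>0$ there is $\delta>0$ such that whenever $u_0\in H^s_{per}([0,L])$ (with $s\ge\frac m2$ the index for which global well-posedness is assumed) satisfies $\|u_0-\phi\|_{\frac m2}<\delta$, the solution $u(t)$ with initial condition $u_0$ exists for all $t\ge0$ and satisfies $d(u(t),\Omega_\phi)<\varepsilon$ for all $t\ge0$. *)

theory Defs
  imports "HOL-Analysis.Analysis"
begin

text \<open>
  Elements of the periodic spaces are represented by everywhere defined periodic functions;
  functions that agree almost everywhere are never identified on the type level, so equalities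
  between elements of these spaces are stated almost everywhere.
\<close>

definition smooth :: "(real \<Rightarrow> real) \<Rightarrow> bool" where
  "smooth g \<longleftrightarrow> (\<forall>n x. (deriv ^^ n) g field_differentiable (at x))"

definition periodic :: "real \<Rightarrow> (real \<Rightarrow> real) \<Rightarrow> bool" where
  "periodic L g \<longleftrightarrow> (\<forall>x. g (x + L) = g x)"

definition Cinf_per :: "real \<Rightarrow> (real \<Rightarrow> real) set" where
  "Cinf_per L = {g. periodic L g \<and> smooth g}"

definition L2_per :: "real \<Rightarrow> (real \<Rightarrow> real) set" where
  "L2_per L = {g. periodic L g \<and> g \<in> borel_measurable borel \<and>
                  set_integrable lborel {0..L} (\<lambda>x. (g x)\<^sup>2)}"

definition l2_inner :: "real \<Rightarrow> (real \<Rightarrow> real) \<Rightarrow> (real \<Rightarrow> real) \<Rightarrow> real" where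
  "l2_inner L g h = (LINT x:{0..L}|lborel. g x * h x)"

definition l2_norm :: "real \<Rightarrow> (real \<Rightarrow> real) \<Rightarrow> real" where
  "l2_norm L g = sqrt (l2_inner L g g)"

definition fourier_coeff :: "real \<Rightarrow> (real \<Rightarrow> real) \<Rightarrow> int \<Rightarrow> complex" where
  "fourier_coeff L g k =
     (LINT x:{0..L}|lborel. cis (- 2 * pi * of_int k * x / L) * complex_of_real (g x)) / of_real L"

text \<open>
  Only orders \<open>s \<ge> 0\<close> are used, so these spaces consist of square integrable functions.  The
  factor \<open>L\<close> in the norm makes the norm of order \<open>0\<close> the norm of $L^2_{per}([0,L])$.
\<close>

definition H_per :: "real \<Rightarrow> real \<Rightarrow> (real \<Rightarrow> real) set" where
  "H_per L s = {g \<in> L2_per L.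
     (\<lambda>k::int. (1 + (of_int k)\<^sup>2) powr s * (cmod (fourier_coeff L g k))\<^sup>2) summable_on UNIV}"

definition H_norm :: "real \<Rightarrow> real \<Rightarrow> (real \<Rightarrow> real) \<Rightarrow> real" where
  "H_norm L s g =
     sqrt (L * (\<Sum>\<^sub>\<infinity>k::int. (1 + (of_int k)\<^sup>2) powr s * (cmod (fourier_coeff L g k))\<^sup>2))"

definition admissible_symbol :: "(real \<Rightarrow> real) \<Rightarrow> real \<Rightarrow> bool" where
  "admissible_symbol \<theta> m \<longleftrightarrow>
     continuous_on UNIV \<theta> \<and> (\<forall>\<kappa>. \<theta> (- \<kappa>) = \<theta> \<kappa>) \<and> m > 0 \<and>
     (\<exists>\<upsilon>1>0. \<exists>\<upsilon>2>0. \<exists>\<kappa>0. \<forall>\<kappa>. \<bar>\<kappa>\<bar> \<ge> \<kappa>0 \<longrightarrow>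
        \<upsilon>1 * \<bar>\<kappa>\<bar> powr m \<le> \<theta> \<kappa> \<and> \<theta> \<kappa> \<le> \<upsilon>2 * \<bar>\<kappa>\<bar> powr m)"

text \<open>
  The choice is among functions that agree almost everywhere.  For a symbol of order \<open>m\<close> a
  suitable function exists whenever \<open>g\<close> lies in the space of order \<open>m\<close>.
\<close>

definition multiplier :: "(real \<Rightarrow> real) \<Rightarrow> real \<Rightarrow> (real \<Rightarrow> real) \<Rightarrow> real \<Rightarrow> real" where
  "multiplier \<theta> L g = (SOME h. h \<in> L2_per L \<and>
     (\<forall>k. fourier_coeff L h k = of_real (\<theta> (of_int k)) * fourier_coeff L g k))"

definition linearized_op ::
  "(real \<Rightarrow> real) \<Rightarrow> (real \<Rightarrow> real) \<Rightarrow> real \<Rightarrow> real \<Rightarrow> (real \<Rightarrow> real) \<Rightarrow> (real \<Rightarrow> real) \<Rightarrow> real \<Rightarrow> real" where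
  "linearized_op \<theta> f \<omega> L \<phi> v =
     (\<lambda>x. multiplier \<theta> L v x + \<omega> * v x - deriv f (\<phi> x) * v x)"

definition traveling_wave ::
  "(real \<Rightarrow> real) \<Rightarrow> (real \<Rightarrow> real) \<Rightarrow> real \<Rightarrow> real \<Rightarrow> real \<Rightarrow> (real \<Rightarrow> real) \<Rightarrow> bool" where
  "traveling_wave \<theta> f \<omega> A L \<phi> \<longleftrightarrow> \<phi> \<in> Cinf_per L \<and>
     (AE x in lborel. multiplier \<theta> L \<phi> x + \<omega> * \<phi> x - f (\<phi> x) + A = 0)"

text \<open>
  Eigenvalues of an operator \<open>T\<close> with domain \<open>D\<close> (a set of functions).  The operator of interest
  is self-adjoint, so real eigenvalues suffice and a simple eigenvalue is one whose eigenspace is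
  one-dimensional.
\<close>

definition eigenfunction ::
  "(real \<Rightarrow> real) set \<Rightarrow> ((real \<Rightarrow> real) \<Rightarrow> real \<Rightarrow> real) \<Rightarrow> real \<Rightarrow> (real \<Rightarrow> real) \<Rightarrow> bool" where
  "eigenfunction D T \<sigma> v \<longleftrightarrow> v \<in> D \<and> \<not> (AE x in lborel. v x = 0) \<and>
     (AE x in lborel. T v x = \<sigma> * v x)"

definition eigenvalue ::
  "(real \<Rightarrow> real) set \<Rightarrow> ((real \<Rightarrow> real) \<Rightarrow> real \<Rightarrow> real) \<Rightarrow> real \<Rightarrow> bool" where
  "eigenvalue D T \<sigma> \<longleftrightarrow> (\<exists>v. eigenfunction D T \<sigma> v)"

definition simple_eigenvalue ::
  "(real \<Rightarrow> real) set \<Rightarrow> ((real \<Rightarrow> real) \<Rightarrow> real \<Rightarrow> real) \<Rightarrow> real \<Rightarrow> bool" where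
  "simple_eigenvalue D T \<sigma> \<longleftrightarrow> eigenvalue D T \<sigma> \<and>
     (\<forall>v w. eigenfunction D T \<sigma> v \<longrightarrow> eigenfunction D T \<sigma> w \<longrightarrow>
        (\<exists>c. AE x in lborel. w x = c * v x))"

text \<open>
  Solutions of $u_t + (f(u))_x - (\mathcal{M}u)_x = 0$ on $[0,\infty)$, continuous with values in
  the space of order \<open>s\<close>.  The equation holds in the sense of periodic distributions: it is tested
  against smooth periodic functions, all space derivatives and the (symmetric) multiplier
  being moved to the test function.
\<close>

definition solution ::
  "(real \<Rightarrow> real) \<Rightarrow> (real \<Rightarrow> real) \<Rightarrow> real \<Rightarrow> real \<Rightarrow> (real \<Rightarrow> real) \<Rightarrow> (real \<Rightarrow> real \<Rightarrow> real) \<Rightarrow> bool" where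
  "solution \<theta> f L s u0 u \<longleftrightarrow>
     (\<forall>t\<ge>0. u t \<in> H_per L s) \<and>
     (\<forall>t\<ge>0. ((\<lambda>t'. H_norm L s (\<lambda>x. u t' x - u t x)) \<longlongrightarrow> 0) (at t within {0..})) \<and>
     (AE x in lborel. u 0 x = u0 x) \<and>
     (\<forall>t\<ge>0. set_integrable lborel {0..L} (\<lambda>x. f (u t x))) \<and>
     (\<forall>t\<ge>0. \<forall>\<psi>\<in>Cinf_per L.
        ((\<lambda>\<tau>. l2_inner L (u \<tau>) \<psi>) has_real_derivative
           l2_inner L (\<lambda>x. f (u t x)) (deriv \<psi>) - l2_inner L (u t) (multiplier \<theta> L (deriv \<psi>)))
        (at t within {0..}))"

definition globally_well_posed ::
  "(real \<Rightarrow> real) \<Rightarrow> (real \<Rightarrow> real) \<Rightarrow> real \<Rightarrow> real \<Rightarrow> bool" where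
  "globally_well_posed \<theta> f L s \<longleftrightarrow>
     (\<forall>u0\<in>H_per L s. (\<exists>u. solution \<theta> f L s u0 u) \<and>
        (\<forall>u v. solution \<theta> f L s u0 u \<longrightarrow> solution \<theta> f L s u0 v \<longrightarrow>
           (\<forall>t\<ge>0. AE x in lborel. u t x = v t x)))"

text \<open>
  The term $\int u\,\mathcal{M}u\,dx$ of \<open>P_fun\<close> is needed for \<open>u\<close> of order \<open>m/2\<close> only, where
  $\mathcal{M}u$ is in general not a function; it denotes the duality pairing.
\<close>

definition mult_form :: "(real \<Rightarrow> real) \<Rightarrow> real \<Rightarrow> (real \<Rightarrow> real) \<Rightarrow> real" where
  "mult_form \<theta> L u = L * (\<Sum>\<^sub>\<infinity>k::int. \<theta> (of_int k) * (cmod (fourier_coeff L u k))\<^sup>2)"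

definition P_fun :: "(real \<Rightarrow> real) \<Rightarrow> (real \<Rightarrow> real) \<Rightarrow> real \<Rightarrow> (real \<Rightarrow> real) \<Rightarrow> real" where
  "P_fun \<theta> W L u = mult_form \<theta> L u / 2 - (LINT x:{0..L}|lborel. W (u x))"

definition F_fun :: "real \<Rightarrow> (real \<Rightarrow> real) \<Rightarrow> real" where
  "F_fun L u = (LINT x:{0..L}|lborel. (u x)\<^sup>2) / 2"

definition M_fun :: "real \<Rightarrow> (real \<Rightarrow> real) \<Rightarrow> real" where
  "M_fun L u = (LINT x:{0..L}|lborel. u x)"

definition multilinear_on :: "(real \<Rightarrow> real) set \<Rightarrow> nat \<Rightarrow> ((real \<Rightarrow> real) list \<Rightarrow> real) \<Rightarrow> bool" where
  "multilinear_on X n T \<longleftrightarrow>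
     (\<forall>gs hs. \<forall>g\<in>X. \<forall>h\<in>X. \<forall>a b. set gs \<subseteq> X \<longrightarrow> set hs \<subseteq> X \<longrightarrow> Suc (length gs + length hs) = n \<longrightarrow>
        T (gs @ (\<lambda>x. a * g x + b * h x) # hs) = a * T (gs @ g # hs) + b * T (gs @ h # hs))"

text \<open>
  \<open>G\<close> is infinitely often Frechet differentiable on the (semi)normed space \<open>X\<close> with norm \<open>N\<close>:
  \<open>D n u\<close> is the derivative of order \<open>n\<close> at \<open>u\<close>, a bounded \<open>n\<close>-linear form whose arguments are
  given as a list of length \<open>n\<close>, and convergence of the difference quotients is in the norm of
  bounded \<open>n\<close>-linear forms.
\<close>

definition smooth_functional ::
  "(real \<Rightarrow> real) set \<Rightarrow> ((real \<Rightarrow> real) \<Rightarrow> real) \<Rightarrow> ((real \<Rightarrow> real) \<Rightarrow> real) \<Rightarrow> bool" where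
  "smooth_functional X N G \<longleftrightarrow>
     (\<exists>D :: nat \<Rightarrow> (real \<Rightarrow> real) \<Rightarrow> (real \<Rightarrow> real) list \<Rightarrow> real.
        (\<forall>u\<in>X. D 0 u [] = G u) \<and>
        (\<forall>n. \<forall>u\<in>X. multilinear_on X n (D n u) \<and>
           (\<exists>C. \<forall>hs. set hs \<subseteq> X \<longrightarrow> length hs = n \<longrightarrow>
              \<bar>D n u hs\<bar> \<le> C * prod_list (map N hs)) \<and>
           (\<forall>\<epsilon>>0. \<exists>\<delta>>0. \<forall>h\<in>X. N h < \<delta> \<longrightarrow>
              (\<forall>hs. set hs \<subseteq> X \<longrightarrow> length hs = n \<longrightarrow>
                 \<bar>D n (\<lambda>x. u x + h x) hs - D n u hs - D (Suc n) u (h # hs)\<bar>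
                   \<le> \<epsilon> * N h * prod_list (map N hs)))))"

text \<open>
  On the space of order \<open>m/2\<close> the functionals \<open>F_fun\<close> and \<open>M_fun\<close> are always well defined, so
  only the two parts of \<open>P_fun\<close> need a condition.
\<close>

definition functionals_smooth ::
  "(real \<Rightarrow> real) \<Rightarrow> (real \<Rightarrow> real) \<Rightarrow> real \<Rightarrow> real \<Rightarrow> bool" where
  "functionals_smooth \<theta> W L m \<longleftrightarrow>
     (\<forall>u\<in>H_per L (m / 2).
        (\<lambda>k::int. \<theta> (of_int k) * (cmod (fourier_coeff L u k))\<^sup>2) summable_on UNIV \<and>
        set_integrable lborel {0..L} (\<lambda>x. W (u x))) \<and>
     smooth_functional (H_per L (m / 2)) (H_norm L (m / 2)) (P_fun \<theta> W L) \<and>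
     smooth_functional (H_per L (m / 2)) (H_norm L (m / 2)) (F_fun L) \<and>
     smooth_functional (H_per L (m / 2)) (H_norm L (m / 2)) (M_fun L)"

definition functionals_conserved ::
  "(real \<Rightarrow> real) \<Rightarrow> (real \<Rightarrow> real) \<Rightarrow> (real \<Rightarrow> real) \<Rightarrow> real \<Rightarrow> real \<Rightarrow> bool" where
  "functionals_conserved \<theta> f W L s \<longleftrightarrow>
     (\<forall>u0\<in>H_per L s. \<forall>u. solution \<theta> f L s u0 u \<longrightarrow>
        (\<forall>t\<ge>0. P_fun \<theta> W L (u t) = P_fun \<theta> W L u0 \<and>
                 F_fun L (u t) = F_fun L u0 \<and> M_fun L (u t) = M_fun L u0))"

definition orbit_dist :: "real \<Rightarrow> real \<Rightarrow> (real \<Rightarrow> real) \<Rightarrow> (real \<Rightarrow> real) \<Rightarrow> real" where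
  "orbit_dist L m v \<phi> = (INF r::real. H_norm L (m / 2) (\<lambda>x. v x - \<phi> (x + r)))"

text \<open>
  Here \<open>s\<close> is the order of the space in which the Cauchy problem is well posed.  Quantifying over
  all solutions with datum \<open>u0\<close>, besides asking for one, amounts to speaking of the solution.
\<close>

definition orbitally_stable ::
  "(real \<Rightarrow> real) \<Rightarrow> (real \<Rightarrow> real) \<Rightarrow> real \<Rightarrow> real \<Rightarrow> real \<Rightarrow> (real \<Rightarrow> real) \<Rightarrow> bool" where
  "orbitally_stable \<theta> f L m s \<phi> \<longleftrightarrow>
     (\<forall>\<epsilon>>0. \<exists>\<delta>>0. \<forall>u0\<in>H_per L s. H_norm L (m / 2) (\<lambda>x. u0 x - \<phi> x) < \<delta> \<longrightarrow>
        (\<exists>u. solution \<theta> f L s u0 u) \<and>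
        (\<forall>u. solution \<theta> f L s u0 u \<longrightarrow> (\<forall>t\<ge>0. orbit_dist L m (u t) \<phi> < \<epsilon>)))"

end

theory Submission
  imports Defs
begin

text \<open>
  The energy \<open>E = P + \<omega> F + A M\<close> has \<open>\<phi>\<close> as a critical point with Hessian \<open>\<L>\<close>, and all three
  functionals are conserved.  Adding a large multiple of \<open>(Q - Q(\<phi>))\<^sup>2\<close> makes the Hessian positive on
  the orthogonal complement of \<open>\<phi>'\<close>: $(H_2)$ gives positivity on a subspace of codimension two, a
  penalty term for each of the two constraints removes them, and $(H_1)$ upgrades the $L^2$ bound to
  one in $H^{m/2}$.  Given \<open>u\<close> near the orbit, the translate of \<open>\<phi>\<close> closest to \<open>u\<close> in $L^2$
  leaves a remainder orthogonal to the derivative of that translate, so the modified energy controls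
  the distance to the orbit; being conserved, it keeps the solution close to the orbit for all times.

  Everything about the Hessian is computed on trigonometric polynomials, where the multiplier is
  explicit, and extended to $H^{m/2}$ by density of Fourier truncations.
\<close>

subsection \<open>Periodic square integrable functions\<close>

text \<open>The smoothness hypothesis gives the derivatives of \<open>P_fun\<close> only as abstract
  bounded forms on $H^{m/2}$, where $Mu$ need not be a function and, for m at most 1, elements may
  be unbounded, so that no pointwise Taylor formula for \<open>W\<close> applies. The forms are
  therefore identified along rays \<phi> + t p with p a trigonometric polynomial: the quadratic part
  changes by a finite sum and the potential has a uniform cubic remainder. The limit to the whole
  space is also what calls for penalties: truncation destroys the orthogonality conditions of
  $(H_2)$, whereas an inequality with squared constraints has no side condition and survives it. The
  penalty for \<open>Q'\<close> is the leading part of the squared deviation of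
  \<open>Q_fun\<close>, so data may have a value of Q other than that of \<phi>. The translate is
  chosen closest in $L^2$, which is a differentiable problem, yet must be close in $H^{m/2}$;
  interpolation on the orbit bridges the two norms. The resulting lower bound is only local, and
  escape is excluded by a gap in the values that the distance can take, together with continuity in
  time.\<close>

abbreviation period_measure :: "real \<Rightarrow> real measure" where
  "period_measure L \<equiv> restrict_space lborel {0..L}"

lemma set_integrable_period_iff:
  fixes g :: "real \<Rightarrow> 'a::{banach, second_countable_topology}"
  shows "set_integrable lborel {0..L} g \<longleftrightarrow> integrable (period_measure L) g"
  by (simp add: set_integrable_def integrable_restrict_space)

lemma set_integral_period_eq:
  fixes g :: "real \<Rightarrow> 'a::{banach, second_countable_topology}"
  shows "(LINT x:{0..L}|lborel. g x) = (LINT x|period_measure L. g x)"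
  by (simp add: set_lebesgue_integral_def integral_restrict_space)

lemma finite_measure_period: "finite_measure (period_measure L)"
  by (rule finite_measureI) (simp add: space_restrict_space emeasure_restrict_space emeasure_lborel_Icc_eq)

lemma measurable_period [measurable (raw)]:
  "g \<in> borel_measurable borel \<Longrightarrow> g \<in> borel_measurable (period_measure L)"
  by (rule measurable_restrict_space1) simp

lemma integrable_period_bounded:
  fixes g :: "real \<Rightarrow> 'a::{banach, second_countable_topology}"
  assumes "g \<in> borel_measurable borel" "\<And>x. x \<in> {0..L} \<Longrightarrow> norm (g x) \<le> B"
  shows "integrable (period_measure L) g"
proof -
  interpret finite_measure "period_measure L" by (rule finite_measure_period)
  show ?thesis
    by (rule integrable_const_bound[where B = B])
       (use assms in \<open>auto simp: AE_restrict_space_iff intro!: measurable_period\<close>)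
qed

lemma integrable_period_continuous:
  fixes g :: "real \<Rightarrow> 'a::{banach, second_countable_topology}"
  assumes "continuous_on UNIV g"
  shows "integrable (period_measure L) g"
proof -
  have "compact (g ` {0..L})"
    by (rule compact_continuous_image) (use assms continuous_on_subset in auto)
  then obtain B where "\<And>x. x \<in> {0..L} \<Longrightarrow> norm (g x) \<le> B"
    by (meson bounded_iff compact_imp_bounded imageI)
  thus ?thesis
    using assms by (intro integrable_period_bounded[where B = B]) (auto intro: borel_measurable_continuous_onI)
qed

lemma AE_period: "AE x in lborel. P x \<Longrightarrow> AE x in period_measure L. P x"
  by (auto simp: AE_restrict_space_iff elim: eventually_mono)

lemma integral_period_cong_AE:
  fixes g h :: "real \<Rightarrow> 'a::{banach, second_countable_topology}"
  assumes "AE x in lborel. g x = h x" "g \<in> borel_measurable borel" "h \<in> borel_measurable borel"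
  shows "(LINT x|period_measure L. g x) = (LINT x|period_measure L. h x)"
  by (rule integral_cong_AE) (use assms in \<open>auto intro: AE_period\<close>)

lemma periodic_add_int:
  assumes per: "\<And>x::real. g (x + L) = g x"
  shows "g (x + of_int n * L) = g x"
proof -
  have nat: "g (y + of_nat k * L) = g y" for y k
  proof (induction k)
    case (Suc k)
    have "g (y + of_nat (Suc k) * L) = g (y + of_nat k * L + L)" by (simp add: algebra_simps)
    thus ?case using Suc per by simp
  qed simp
  show ?thesis
  proof (cases "n \<ge> 0")
    case True
    thus ?thesis using nat[of x "nat n"] by simp
  next
    case False
    thus ?thesis using nat[of "x + of_int n * L" "nat (- n)"] by (simp add: algebra_simps)
  qed
qed

lemma periodic_bounded:
  fixes g :: "real \<Rightarrow> real"
  assumes "L > 0" "periodic L g" "continuous_on UNIV g"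
  obtains B where "B > 0" "\<And>x. \<bar>g x\<bar> \<le> B"
proof -
  have "compact (g ` {0..L})"
    by (rule compact_continuous_image) (use assms continuous_on_subset in auto)
  then obtain B where B: "\<And>x. x \<in> {0..L} \<Longrightarrow> norm (g x) \<le> B"
    by (meson bounded_iff compact_imp_bounded imageI)
  have "\<bar>g x\<bar> \<le> max B 1" for x
  proof -
    define y where "y = x + of_int (- \<lfloor>x / L\<rfloor>) * L"
    have "y = L * frac (x / L)" using assms(1) by (simp add: y_def frac_def field_simps)
    hence "y \<in> {0..L}"
      using assms(1) frac_ge_0[of "x / L"] frac_lt_1[of "x / L"]
      by (auto simp: mult_le_cancel_left1)
    moreover have "g y = g x" unfolding y_def by (rule periodic_add_int) (use assms(2) in \<open>simp add: periodic_def\<close>)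
    ultimately show ?thesis using B[of y] by auto
  qed
  thus ?thesis by (intro that[of "max B 1"]) auto
qed

text \<open>Periodicity reduces the shift to its remainder \<open>q\<close> in [0, L). The integral
  over [q, L+q) splits at L, and moving [L, L+q) back by one period supplies the missing piece [0,
  q) of [0, L].\<close>

lemma integral_period_shift:
  fixes g :: "real \<Rightarrow> 'a::{banach, second_countable_topology}"
  assumes L: "L > 0" and per: "\<And>x. g (x + L) = g x"
    and meas: "g \<in> borel_measurable borel" and int: "integrable (period_measure L) g"
  shows "integrable (period_measure L) (\<lambda>x. g (x + r))"
    and "(LINT x|period_measure L. g (x + r)) = (LINT x|period_measure L. g x)"
proof -
  define q where "q = L * frac (r / L)"
  have q: "0 \<le> q" "q < L"
    using L frac_ge_0[of "r / L"] frac_lt_1[of "r / L"] by (auto simp: q_def)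
  have r_eq: "r = q + of_int \<lfloor>r / L\<rfloor> * L" using L by (simp add: q_def frac_def field_simps)
  have shift: "g (x + r) = g (x + q)" for x
    using periodic_add_int[of g L "x + q" "\<lfloor>r / L\<rfloor>", OF per] r_eq by (simp add: add.assoc)
  have si: "set_integrable lborel {0..L} g" using int by (simp add: set_integrable_period_iff)
  have si1: "set_integrable lborel {0..<q} g" "set_integrable lborel {q..L} g"
    using q by (auto intro: set_integrable_subset[OF si])
  have tr: "has_bochner_integral lborel (\<lambda>x. indicator {L..<L+q} x *\<^sub>R g x)
              (LINT x:{0..<q}|lborel. g x)"
  proof -
    have "has_bochner_integral lborel (\<lambda>x. indicator {0..<q} x *\<^sub>R g x) (LINT x:{0..<q}|lborel. g x)"
      using si1(1) by (simp add: set_integrable_def set_lebesgue_integral_def has_bochner_integral_iff)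
    hence "has_bochner_integral lborel (\<lambda>x. indicator {0..<q} (- L + 1 * x) *\<^sub>R g (- L + 1 * x))
             ((LINT x:{0..<q}|lborel. g x) /\<^sub>R \<bar>1\<bar>)"
      by (intro lborel_has_bochner_integral_real_affine_iff[THEN iffD1, of 1]) auto
    moreover have "indicator {0..<q} (- L + 1 * x) *\<^sub>R g (- L + 1 * x)
                    = indicator {L..<L+q} x *\<^sub>R g x" for x
      using per[of "x - L"] by (auto simp: indicator_def)
    ultimately show ?thesis by simp
  qed
  have si2: "set_integrable lborel {L..<L+q} g"
    and i2: "(LINT x:{L..<L+q}|lborel. g x) = (LINT x:{0..<q}|lborel. g x)"
    using tr by (simp_all add: has_bochner_integral_iff set_integrable_def set_lebesgue_integral_def)
  have L_null: "(LINT x:{q..<L}|lborel. g x) = (LINT x:{q..L}|lborel. g x)"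
    unfolding set_lebesgue_integral_def
    by (rule integral_cong_AE)
       (use meas AE_lborel_singleton[of L] in \<open>auto simp: indicator_def\<close>)
  have si3: "set_integrable lborel {q..<L} g" by (rule set_integrable_subset[OF si]) (use q in auto)
  have U: "set_integrable lborel ({q..<L} \<union> {L..<L+q}) g"
    using si3 si2 by (rule set_integrable_Un) auto
  have Ueq: "{q..<L} \<union> {L..<L+q} = {q..<L+q}" using q by auto
  have I: "(LINT x:{q..<L+q}|lborel. g x) = (LINT x:{0..L}|lborel. g x)"
  proof -
    have "(LINT x:{q..<L+q}|lborel. g x) = (LINT x:{q..<L}|lborel. g x) + (LINT x:{L..<L+q}|lborel. g x)"
      unfolding Ueq[symmetric] by (rule set_integral_Un) (use si3 si2 in auto)
    also have "\<dots> = (LINT x:{0..<q}|lborel. g x) + (LINT x:{q..L}|lborel. g x)"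
      using L_null i2 by simp
    also have "\<dots> = (LINT x:{0..<q} \<union> {q..L}|lborel. g x)"
      by (rule set_integral_Un[symmetric]) (use si1 in auto)
    also have "{0..<q} \<union> {q..L} = {0..L}" using q by auto
    finally show ?thesis .
  qed
  have "has_bochner_integral lborel (\<lambda>x. indicator {q..<L+q} x *\<^sub>R g x) (LINT x:{0..L}|lborel. g x)"
    using U I unfolding Ueq by (simp add: set_integrable_def set_lebesgue_integral_def has_bochner_integral_iff)
  hence "has_bochner_integral lborel (\<lambda>x. indicator {q..<L+q} (q + 1 * x) *\<^sub>R g (q + 1 * x))
           ((LINT x:{0..L}|lborel. g x) /\<^sub>R \<bar>1\<bar>)"
    by (intro lborel_has_bochner_integral_real_affine_iff[THEN iffD1, of 1]) auto
  moreover have "indicator {q..<L+q} (q + 1 * x) *\<^sub>R g (q + 1 * x)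
                  = indicator {0..<L} x *\<^sub>R g (x + r)" for x
    by (auto simp: indicator_def shift add.commute[of q])
  ultimately have hb: "has_bochner_integral lborel (\<lambda>x. indicator {0..<L} x *\<^sub>R g (x + r))
                    (LINT x:{0..L}|lborel. g x)" by simp
  have "has_bochner_integral lborel (\<lambda>x. indicator {0..L} x *\<^sub>R g (x + r))
                    (LINT x:{0..L}|lborel. g x)"
    by (rule has_bochner_integralI_AE[OF hb])
       (use meas AE_lborel_singleton[of L] in \<open>auto simp: indicator_def\<close>)
  hence "set_integrable lborel {0..L} (\<lambda>x. g (x + r))"
    "(LINT x:{0..L}|lborel. g (x + r)) = (LINT x:{0..L}|lborel. g x)"
    by (simp_all add: has_bochner_integral_iff set_integrable_def set_lebesgue_integral_def)
  thus "integrable (period_measure L) (\<lambda>x. g (x + r))"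
    "(LINT x|period_measure L. g (x + r)) = (LINT x|period_measure L. g x)"
    by (simp_all add: set_integrable_period_iff set_integral_period_eq)
qed

section \<open>Inner product, Cauchy-Schwarz inequality and Fourier coefficients\<close>

lemma l2_inner_eq: "l2_inner L g h = (LINT x|period_measure L. g x * h x)"
  by (simp add: l2_inner_def set_integral_period_eq)

lemma fourier_coeff_eq:
  "fourier_coeff L g k =
     (LINT x|period_measure L. cis (- 2 * pi * of_int k * x / L) * complex_of_real (g x)) / of_real L"
  by (simp add: fourier_coeff_def set_integral_period_eq)

lemma L2_perD:
  assumes "g \<in> L2_per L"
  shows "periodic L g" "g \<in> borel_measurable borel" "integrable (period_measure L) (\<lambda>x. (g x)\<^sup>2)"
  using assms by (auto simp: L2_per_def set_integrable_period_iff)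

lemma integrable_L2_mult:
  assumes "g \<in> L2_per L" "h \<in> L2_per L"
  shows "integrable (period_measure L) (\<lambda>x. g x * h x)"
proof (rule Bochner_Integration.integrable_bound)
  show "integrable (period_measure L) (\<lambda>x. (g x)\<^sup>2 + (h x)\<^sup>2)"
    using L2_perD(3)[OF assms(1)] L2_perD(3)[OF assms(2)] by (rule Bochner_Integration.integrable_add)
  have "\<bar>a * b\<bar> \<le> a\<^sup>2 + b\<^sup>2" for a b :: real
    using sum_squares_bound[of "\<bar>a\<bar>" "\<bar>b\<bar>"] mult_nonneg_nonneg[of "\<bar>a\<bar>" "\<bar>b\<bar>"]
    by (simp add: abs_mult del: mult_nonneg_nonneg)
  thus "AE x in period_measure L. norm (g x * h x) \<le> norm ((g x)\<^sup>2 + (h x)\<^sup>2)" by auto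
qed (use L2_perD(2)[OF assms(1)] L2_perD(2)[OF assms(2)] in \<open>auto intro!: measurable_period\<close>)

lemma const_in_L2_per: "(\<lambda>x. c) \<in> L2_per L"
  by (auto simp: L2_per_def periodic_def set_integrable_period_iff intro!: integrable_period_continuous)

lemma integrable_L2:
  assumes "g \<in> L2_per L"
  shows "integrable (period_measure L) g"
  using integrable_L2_mult[OF assms const_in_L2_per[of 1]] by simp

lemma L2_per_lincomb:
  assumes "g \<in> L2_per L" "h \<in> L2_per L"
  shows "(\<lambda>x. a * g x + b * h x) \<in> L2_per L"
proof -
  have "(\<lambda>x. (a * g x + b * h x)\<^sup>2) = (\<lambda>x. a\<^sup>2 * (g x)\<^sup>2 + b\<^sup>2 * (h x)\<^sup>2 + 2 * a * b * (g x * h x))"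
    by (auto simp: power2_eq_square algebra_simps)
  moreover have "integrable (period_measure L) \<dots>"
    using L2_perD(3)[OF assms(1)] L2_perD(3)[OF assms(2)] integrable_L2_mult[OF assms]
    by (intro Bochner_Integration.integrable_add integrable_mult_right)
  ultimately show ?thesis
    using L2_perD(1,2)[OF assms(1)] L2_perD(1,2)[OF assms(2)]
    by (auto simp: L2_per_def periodic_def set_integrable_period_iff)
qed

lemma continuous_in_L2_per:
  assumes "periodic L g" "continuous_on UNIV g"
  shows "g \<in> L2_per L"
  using assms
  by (auto simp: L2_per_def set_integrable_period_iff
      intro!: integrable_period_continuous continuous_intros borel_measurable_continuous_onI)

lemma l2_inner_commute: "l2_inner L g h = l2_inner L h g"
  by (simp add: l2_inner_eq mult.commute)

lemma l2_inner_lincomb_left: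
  assumes "g \<in> L2_per L" "h \<in> L2_per L" "k \<in> L2_per L"
  shows "l2_inner L (\<lambda>x. a * g x + b * h x) k = a * l2_inner L g k + b * l2_inner L h k"
proof -
  have "l2_inner L (\<lambda>x. a * g x + b * h x) k
        = (LINT x|period_measure L. a * (g x * k x) + b * (h x * k x))"
    unfolding l2_inner_eq by (rule Bochner_Integration.integral_cong) (auto simp: algebra_simps)
  also have "\<dots> = a * l2_inner L g k + b * l2_inner L h k"
    unfolding l2_inner_eq using integrable_L2_mult[OF assms(1,3)] integrable_L2_mult[OF assms(2,3)]
    by simp
  finally show ?thesis .
qed

lemma l2_inner_lincomb_right:
  assumes "g \<in> L2_per L" "h \<in> L2_per L" "k \<in> L2_per L"
  shows "l2_inner L k (\<lambda>x. a * g x + b * h x) = a * l2_inner L k g + b * l2_inner L k h"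
  using l2_inner_lincomb_left[OF assms] by (simp add: l2_inner_commute)

lemma l2_inner_self_nonneg: "l2_inner L g g \<ge> 0"
  unfolding l2_inner_eq by (rule integral_nonneg_AE) auto

lemma l2_norm_nonneg: "l2_norm L g \<ge> 0"
  by (simp add: l2_norm_def l2_inner_self_nonneg)

lemma l2_norm_sq: "(l2_norm L g)\<^sup>2 = l2_inner L g g"
  by (simp add: l2_norm_def l2_inner_self_nonneg)

lemma l2_inner_lincomb_self:
  assumes "g \<in> L2_per L" "h \<in> L2_per L"
  shows "l2_inner L (\<lambda>x. a * g x + b * h x) (\<lambda>x. a * g x + b * h x)
         = a\<^sup>2 * l2_inner L g g + 2 * a * b * l2_inner L g h + b\<^sup>2 * l2_inner L h h"
  using assms L2_per_lincomb[OF assms, of a b]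
  by (simp add: l2_inner_lincomb_left l2_inner_lincomb_right l2_inner_commute[of L h g]
      power2_eq_square algebra_simps)

lemma l2_Cauchy_Schwarz:
  assumes "g \<in> L2_per L" "h \<in> L2_per L"
  shows "\<bar>l2_inner L g h\<bar> \<le> l2_norm L g * l2_norm L h"
proof -
  let ?A = "l2_inner L g g" and ?B = "l2_inner L g h" and ?C = "l2_inner L h h"
  have q: "0 \<le> a\<^sup>2 * ?A + 2 * a * b * ?B + b\<^sup>2 * ?C" for a b
    using l2_inner_self_nonneg[of L "\<lambda>x. a * g x + b * h x"]
    by (simp add: l2_inner_lincomb_self[OF assms])
  have "?B\<^sup>2 \<le> ?A * ?C"
  proof (cases "?C = 0")
    case True
    have "?B = 0"
    proof (rule ccontr)
      assume "?B \<noteq> 0"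
      \<comment> \<open>With \<open>?C = 0\<close> the form is affine in \<open>b\<close>, and this
        choice gives it the value -1.\<close>
      thus False using q[of 1 "- (?A + 1) / (2 * ?B)"] True by (simp add: field_simps)
    qed
    thus ?thesis using True by simp
  next
    case False
    hence C: "?C > 0" using l2_inner_self_nonneg[of L h] by simp
    \<comment> \<open>The form evaluated at its minimizing direction, scaled by \<open>?C\<close> to
      avoid a division.\<close>
    have "0 \<le> ?C * (?A * ?C - ?B\<^sup>2)"
      using q[of ?C "- ?B"] by (simp add: power2_eq_square algebra_simps)
    thus ?thesis using C by (simp add: zero_le_mult_iff)
  qed
  hence "\<bar>?B\<bar>\<^sup>2 \<le> (l2_norm L g * l2_norm L h)\<^sup>2"
    by (simp add: power_mult_distrib l2_norm_sq)
  thus ?thesis by (rule power2_le_imp_le) (simp add: l2_norm_nonneg)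
qed

lemma l2_norm_lincomb_le:
  assumes "g \<in> L2_per L" "h \<in> L2_per L"
  shows "l2_norm L (\<lambda>x. a * g x + b * h x) \<le> \<bar>a\<bar> * l2_norm L g + \<bar>b\<bar> * l2_norm L h"
proof (rule power2_le_imp_le)
  have "a * b * l2_inner L g h \<le> \<bar>a * b\<bar> * \<bar>l2_inner L g h\<bar>"
    by (metis abs_ge_self abs_mult)
  also have "\<dots> \<le> \<bar>a * b\<bar> * (l2_norm L g * l2_norm L h)"
    by (rule mult_left_mono[OF l2_Cauchy_Schwarz[OF assms]]) simp
  finally have "a * b * l2_inner L g h \<le> \<bar>a * b\<bar> * (l2_norm L g * l2_norm L h)" .
  thus "(l2_norm L (\<lambda>x. a * g x + b * h x))\<^sup>2 \<le> (\<bar>a\<bar> * l2_norm L g + \<bar>b\<bar> * l2_norm L h)\<^sup>2"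
    by (simp add: l2_norm_sq l2_inner_lincomb_self[OF assms] power2_sum power_mult_distrib abs_mult mult_ac)
qed (simp add: l2_norm_nonneg)

lemma measurable_cis_div [measurable]: "(\<lambda>x. cis (a * x / L)) \<in> borel_measurable borel"
proof -
  have "(\<lambda>x. cis (a * x / L)) = (\<lambda>x. cis (a / L * x))" by simp
  moreover have "\<dots> \<in> borel_measurable borel"
    by (intro borel_measurable_continuous_onI continuous_intros)
  ultimately show ?thesis by metis
qed

lemma integrable_cis_mult:
  assumes "g \<in> L2_per L"
  shows "integrable (period_measure L) (\<lambda>x. cis (a * x / L) * complex_of_real (g x))"
proof (rule Bochner_Integration.integrable_bound)
  show "integrable (period_measure L) (\<lambda>x. complex_of_real (g x))"
    using integrable_L2[OF assms] by simp
  have [measurable]: "g \<in> borel_measurable borel" using L2_perD[OF assms] by simp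
  show "(\<lambda>x. cis (a * x / L) * complex_of_real (g x)) \<in> borel_measurable (period_measure L)"
    by (rule measurable_period) measurable
qed (auto simp: norm_mult)

lemma fourier_coeff_lincomb:
  assumes "g \<in> L2_per L" "h \<in> L2_per L"
  shows "fourier_coeff L (\<lambda>x. a * g x + b * h x) k
         = of_real a * fourier_coeff L g k + of_real b * fourier_coeff L h k"
proof -
  let ?e = "\<lambda>x. cis (- 2 * pi * of_int k * x / L)"
  have "(LINT x|period_measure L. ?e x * complex_of_real (a * g x + b * h x))
      = (LINT x|period_measure L. of_real a * (?e x * complex_of_real (g x))
            + of_real b * (?e x * complex_of_real (h x)))"
    by (rule Bochner_Integration.integral_cong) (auto simp: algebra_simps)
  also have "\<dots> = of_real a * (LINT x|period_measure L. ?e x * complex_of_real (g x))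
            + of_real b * (LINT x|period_measure L. ?e x * complex_of_real (h x))"
    using integrable_cis_mult[OF assms(1), of "- 2 * pi * of_int k"]
      integrable_cis_mult[OF assms(2), of "- 2 * pi * of_int k"] by simp
  finally show ?thesis by (simp add: fourier_coeff_eq add_divide_distrib)
qed

lemma fourier_coeff_neg: "fourier_coeff L g (- k) = cnj (fourier_coeff L g k)"
proof -
  have "cnj (LINT x|period_measure L. cis (- 2 * pi * of_int k * x / L) * complex_of_real (g x))
      = (LINT x|period_measure L. cnj (cis (- 2 * pi * of_int k * x / L) * complex_of_real (g x)))"
    by (rule Bochner_Integration.integral_cnj[symmetric])
  thus ?thesis by (simp add: fourier_coeff_eq cis_cnj)
qed

lemma fourier_coeff_cong_AE:
  assumes "AE x in lborel. g x = h x" "g \<in> borel_measurable borel" "h \<in> borel_measurable borel"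
  shows "fourier_coeff L g k = fourier_coeff L h k"
proof -
  note [measurable] = assms(2,3)
  show ?thesis
    unfolding fourier_coeff_eq using assms(1)
    by (intro arg_cong2[of _ _ _ _ "(/)"] integral_period_cong_AE borel_measurable_times
        measurable_cis_div measurable_compose[OF _ borel_measurable_of_real]) auto
qed

lemma l2_inner_cong_AE:
  assumes "AE x in lborel. g x = h x" "g \<in> borel_measurable borel" "h \<in> borel_measurable borel"
    "k \<in> borel_measurable borel"
  shows "l2_inner L g k = l2_inner L h k"
  unfolding l2_inner_eq using assms by (intro integral_period_cong_AE) auto

lemma L2_per_shift:
  assumes "L > 0" "g \<in> L2_per L"
  shows "(\<lambda>x. g (x + r)) \<in> L2_per L"
  using integral_period_shift(1)[of L "\<lambda>x. (g x)\<^sup>2" r] assms L2_perD[OF assms(2)]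
  by (auto simp: L2_per_def periodic_def set_integrable_period_iff) (metis add.assoc add.commute)

lemma l2_inner_shift:
  assumes "L > 0" "g \<in> L2_per L" "h \<in> L2_per L"
  shows "l2_inner L (\<lambda>x. g (x + r)) (\<lambda>x. h (x + r)) = l2_inner L g h"
  unfolding l2_inner_eq
  by (rule integral_period_shift(2)[of L "\<lambda>x. g x * h x" r])
     (use assms L2_perD[OF assms(2)] L2_perD[OF assms(3)] integrable_L2_mult[OF assms(2,3)]
       in \<open>auto simp: periodic_def\<close>)

lemma fourier_coeff_shift:
  assumes "L > 0" "g \<in> L2_per L"
  shows "fourier_coeff L (\<lambda>x. g (x + r)) k = cis (2 * pi * of_int k * r / L) * fourier_coeff L g k"
proof -
  let ?e = "\<lambda>x. cis (- 2 * pi * of_int k * x / L)"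
  note [measurable] = L2_perD(2)[OF assms(2)]
  have m: "(\<lambda>x. ?e x * complex_of_real (g x)) \<in> borel_measurable borel"
    by (intro borel_measurable_times measurable_cis_div measurable_compose[OF _ borel_measurable_of_real]) simp
  have per: "?e (x + L) = ?e x" for x
  proof -
    have "?e (x + L) = ?e x * cis (2 * pi * of_int (- k))"
      using assms by (simp add: cis_mult field_simps)
    thus ?thesis by (subst (asm) cis_multiple_2pi) auto
  qed
  have e: "?e x = cis (2 * pi * of_int k * r / L) * ?e (x + r)" for x
  proof -
    have "- 2 * pi * of_int k * x / L = 2 * pi * of_int k * r / L + - 2 * pi * of_int k * (x + r) / L"
      using assms(1) by (simp add: field_simps)
    thus ?thesis by (simp only: cis_mult)
  qed
  have "(LINT x|period_measure L. ?e x * complex_of_real (g (x + r)))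
     = (LINT x|period_measure L. cis (2 * pi * of_int k * r / L) * (?e (x + r) * complex_of_real (g (x + r))))"
    by (rule Bochner_Integration.integral_cong[OF refl]) (metis e mult.assoc)
  also have "\<dots> = cis (2 * pi * of_int k * r / L) * (LINT x|period_measure L. ?e (x + r) * complex_of_real (g (x + r)))"
    by (rule integral_mult_right_zero)
  also have "(LINT x|period_measure L. ?e (x + r) * complex_of_real (g (x + r)))
      = (LINT x|period_measure L. ?e x * complex_of_real (g x))"
  proof (rule integral_period_shift(2)[of L "\<lambda>x. ?e x * complex_of_real (g x)" r])
    show "?e (x + L) * complex_of_real (g (x + L)) = ?e x * complex_of_real (g x)" for x
      using L2_perD(1)[OF assms(2)] by (simp only: per periodic_def)
  qed (use assms m integrable_cis_mult[OF assms(2)] in blast)+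
  finally show ?thesis by (simp add: fourier_coeff_eq)
qed

lemma fourier_coeff_norm_le:
  assumes "L > 0" "\<And>x. \<bar>g x\<bar> \<le> B" "g \<in> borel_measurable borel"
  shows "cmod (fourier_coeff L g k) \<le> B"
proof -
  interpret finite_measure "period_measure L" by (rule finite_measure_period)
  have "cmod (LINT x|period_measure L. cis (- 2 * pi * of_int k * x / L) * complex_of_real (g x))
      \<le> (LINT x|period_measure L. B)"
    by (rule order_trans[OF integral_norm_bound integral_mono_AE'])
       (use assms order_trans[OF abs_ge_zero assms(2)] in \<open>auto simp: norm_mult\<close>)
  also have "\<dots> = L * B"
    using assms(1) by (simp add: measure_restrict_space space_restrict_space)
  finally show ?thesis using assms(1) by (simp add: fourier_coeff_eq norm_divide field_simps)
qed

subsection \<open>Trigonometric polynomials\<close>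

text \<open>Used twice: with an exponential it yields the orthogonality relations, with an
  exponential times a smooth function it is integration by parts.\<close>

lemma integral_deriv_periodic:
  fixes G :: "real \<Rightarrow> complex"
  assumes "L > 0" "\<And>x. (G has_vector_derivative G' x) (at x)" "continuous_on UNIV G'" "G L = G 0"
  shows "(LINT x|period_measure L. G' x) = 0"
proof -
  have "(LINT x|period_measure L. G' x) = integral\<^sup>L lborel (\<lambda>x. indicator {0..L} x *\<^sub>R G' x)"
    by (simp add: integral_restrict_space)
  also have "\<dots> = G L - G 0"
    using assms by (intro integral_FTC_atLeastAtMost)
      (auto intro: has_vector_derivative_at_within continuous_on_subset)
  finally show ?thesis using assms by simp
qed

definition fexp :: "real \<Rightarrow> int \<Rightarrow> real \<Rightarrow> complex" where
  "fexp L k x = cis (2 * pi * of_int k * x / L)"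

lemma fexp_has_vector_derivative [derivative_intros]:
  "(fexp L k has_vector_derivative (\<i> * of_real (2 * pi * of_int k / L) * fexp L k x)) (at x within S)"
proof -
  define a where "a = \<i> * of_real (2 * pi * of_int k / L)"
  have "((\<lambda>x. exp (a * of_real x)) has_vector_derivative exp (a * of_real x) * a) (at x within S)"
    by (rule has_vector_derivative_real_field) (auto intro!: derivative_eq_intros)
  moreover have "fexp L k = (\<lambda>x. exp (a * of_real x))"
    by (rule ext) (simp add: fexp_def cis_conv_exp a_def mult_ac)
  ultimately show ?thesis by (simp add: mult.commute a_def)
qed

lemma continuous_on_fexp [continuous_intros]: "continuous_on S (fexp L k)"
  unfolding continuous_on_eq_continuous_within
  using fexp_has_vector_derivative has_vector_derivative_continuous by blast

lemma fexp_mult: "fexp L j x * fexp L k x = fexp L (j + k) x"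
  by (simp add: fexp_def cis_mult add_divide_distrib[symmetric] distrib_left distrib_right)

lemma norm_fexp [simp]: "norm (fexp L k x) = 1" by (simp add: fexp_def)

lemma cnj_fexp: "cnj (fexp L k x) = fexp L (- k) x" by (simp add: fexp_def cis_cnj)

lemma fexp_period: "L \<noteq> 0 \<Longrightarrow> fexp L k (x + L) = fexp L k x"
proof -
  assume "L \<noteq> 0"
  hence "fexp L k (x + L) = fexp L k x * cis (2 * pi * of_int k)"
    unfolding fexp_def cis_mult by (simp add: field_simps)
  thus ?thesis by (subst (asm) cis_multiple_2pi) auto
qed

lemma fexp_0 [simp]: "fexp L 0 x = 1" by (simp add: fexp_def)

lemma fourier_coeff_fexp:
  "fourier_coeff L g k = (LINT x|period_measure L. fexp L (- k) x * complex_of_real (g x)) / of_real L"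
  by (simp add: fourier_coeff_eq fexp_def)

lemma integral_fexp:
  assumes "L > 0"
  shows "(LINT x|period_measure L. fexp L k x) = (if k = 0 then of_real L else 0)"
proof (cases "k = 0")
  case True
  thus ?thesis using assms by (simp add: measure_restrict_space space_restrict_space scaleR_conv_of_real)
next
  case False
  let ?a = "\<i> * of_real (2 * pi * of_int k / L) :: complex"
  have "(LINT x|period_measure L. ?a * fexp L k x) = 0"
    by (rule integral_deriv_periodic[of L "fexp L k"])
       (use assms fexp_has_vector_derivative fexp_period[of L k 0] in \<open>auto intro!: continuous_intros\<close>)
  hence "?a * (LINT x|period_measure L. fexp L k x) = 0"
    by (simp only: integral_mult_right_zero)
  thus ?thesis using False assms by auto
qed

lemma integrable_fexp: "integrable (period_measure L) (fexp L k)"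
  by (intro integrable_period_continuous continuous_intros)

text \<open>Taking real parts makes every family \<open>c\<close> admissible, without a Hermitian
  condition. In exchange \<open>c\<close> is not unique: the true Fourier coefficient at
  \<open>k\<close> is the symmetrization \<open>(c k + cnj (c (- k))) / 2\<close>.\<close>

definition trig :: "real \<Rightarrow> nat \<Rightarrow> (int \<Rightarrow> complex) \<Rightarrow> real \<Rightarrow> real" where
  "trig L N c x = (\<Sum>k\<in>{- int N..int N}. Re (c k * fexp L k x))"

definition trig_polys :: "real \<Rightarrow> (real \<Rightarrow> real) set" where
  "trig_polys L = {trig L N c | N c. True}"

lemma continuous_on_trig [continuous_intros]: "continuous_on S (trig L N c)"
  unfolding trig_def[abs_def] by (intro continuous_intros)

lemma periodic_trig: "L > 0 \<Longrightarrow> periodic L (trig L N c)"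
  by (simp add: periodic_def trig_def fexp_period)

lemma trig_in_L2_per: "L > 0 \<Longrightarrow> trig L N c \<in> L2_per L"
  by (intro continuous_in_L2_per periodic_trig continuous_intros)

lemma trig_has_real_derivative:
  "(trig L N c has_real_derivative trig L N (\<lambda>k. \<i> * of_real (2 * pi * of_int k / L) * c k) x) (at x)"
proof -
  have "((\<lambda>x. Re (c k * fexp L k x)) has_real_derivative
         Re (\<i> * of_real (2 * pi * of_int k / L) * c k * fexp L k x)) (at x)" for k
  proof -
    have "((\<lambda>x. c k * fexp L k x) has_vector_derivative c k * (\<i> * of_real (2 * pi * of_int k / L) * fexp L k x)) (at x)"
      by (intro derivative_intros)
    hence "((\<lambda>x. Re (c k * fexp L k x)) has_vector_derivative
        Re (c k * (\<i> * of_real (2 * pi * of_int k / L) * fexp L k x))) (at x)"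
      by (rule bounded_linear.has_vector_derivative[OF bounded_linear_Re])
    thus ?thesis by (simp add: has_real_derivative_iff_has_vector_derivative mult_ac)
  qed
  thus ?thesis unfolding trig_def[abs_def] by (intro DERIV_sum)
qed

lemma trig_in_Cinf_per:
  assumes "L > 0"
  shows "trig L N c \<in> Cinf_per L"
proof -
  have "\<exists>d. (deriv ^^ n) (trig L N c) = trig L N d" for n
  proof (induction n)
    case (Suc n)
    then obtain d where "(deriv ^^ n) (trig L N c) = trig L N d" by blast
    hence "(deriv ^^ Suc n) (trig L N c) = trig L N (\<lambda>k. \<i> * of_real (2 * pi * of_int k / L) * d k)"
      using DERIV_imp_deriv[OF trig_has_real_derivative] by (intro ext) simp
    thus ?case by blast
  qed auto
  hence "smooth (trig L N c)"
    unfolding smooth_def by (metis trig_has_real_derivative field_differentiable_def)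
  thus ?thesis using assms by (simp add: Cinf_per_def periodic_trig)
qed

lemma trig_extend:
  assumes "N \<le> M"
  shows "trig L N c = trig L M (\<lambda>k. if \<bar>k\<bar> \<le> int N then c k else 0)"
  unfolding trig_def[abs_def] using assms
  by (intro ext sum.mono_neutral_cong_left) (auto simp: abs_le_iff)

lemma trig_polys_lincomb:
  assumes "p \<in> trig_polys L" "q \<in> trig_polys L"
  shows "(\<lambda>x. a * p x + b * q x) \<in> trig_polys L"
proof -
  from assms obtain N c M d where "p = trig L N c" "q = trig L M d"
    by (auto simp: trig_polys_def)
  then obtain c' d' where p: "p = trig L (max N M) c'" and q: "q = trig L (max N M) d'"
    using trig_extend[of N "max N M"] trig_extend[of M "max N M"] by (metis max.cobounded1 max.cobounded2)
  have "(\<lambda>x. a * p x + b * q x) = trig L (max N M) (\<lambda>k. of_real a * c' k + of_real b * d' k)"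
    by (auto simp: p q trig_def sum_distrib_left sum.distrib[symmetric] algebra_simps intro!: ext sum.cong)
  thus ?thesis unfolding trig_polys_def by blast
qed

lemma l2_inner_trig:
  assumes "L > 0" "g \<in> L2_per L"
  shows "l2_inner L g (trig L N c) = L * (\<Sum>k\<in>{- int N..int N}. Re (c k * cnj (fourier_coeff L g k)))"
proof -
  have int: "integrable (period_measure L) (\<lambda>x. fexp L k x * complex_of_real (g x))" for k
    using integrable_cis_mult[OF assms(2), of "2 * pi * of_int k"] by (simp add: fexp_def)
  have "l2_inner L g (trig L N c)
      = (LINT x|period_measure L. (\<Sum>k\<in>{- int N..int N}. Re (c k * (fexp L k x * complex_of_real (g x)))))"
    unfolding l2_inner_eq by (simp add: trig_def sum_distrib_left algebra_simps)
  also have "\<dots> = (\<Sum>k\<in>{- int N..int N}. (LINT x|period_measure L. Re (c k * (fexp L k x * complex_of_real (g x)))))"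
    by (rule Bochner_Integration.integral_sum) (intro integrable_Re integrable_mult_right int)
  also have "\<dots> = (\<Sum>k\<in>{- int N..int N}. L * Re (c k * cnj (fourier_coeff L g k)))"
  proof (rule sum.cong[OF refl])
    fix k
    have "(LINT x|period_measure L. Re (c k * (fexp L k x * complex_of_real (g x))))
        = Re (c k * (LINT x|period_measure L. fexp L k x * complex_of_real (g x)))"
      by (subst integral_Re[OF integrable_mult_right[OF int]]) (simp only: integral_mult_right_zero)
    also have "(LINT x|period_measure L. fexp L k x * complex_of_real (g x)) = of_real L * fourier_coeff L g (- k)"
      using assms(1) by (simp add: fourier_coeff_fexp)
    finally show "(LINT x|period_measure L. Re (c k * (fexp L k x * complex_of_real (g x))))
        = L * Re (c k * cnj (fourier_coeff L g k))"
      by (simp add: fourier_coeff_neg algebra_simps)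
  qed
  finally show ?thesis by (simp add: sum_distrib_left)
qed

text \<open>Writing Re z as half the sum of z and its conjugate splits summand \<open>j\<close> into
  exponentials of frequency \<open>j\<close> and \<open>- j\<close>; orthogonality selects
  \<open>j = k\<close> from the former and \<open>j = - k\<close> from the latter.\<close>

lemma fourier_coeff_trig:
  assumes "L > 0"
  shows "fourier_coeff L (trig L N c) k = (if \<bar>k\<bar> \<le> int N then (c k + cnj (c (- k))) / 2 else 0)"
proof -
  let ?I = "{- int N..int N}"
  have Re2: "complex_of_real (Re z) = (z + cnj z) / 2" for z
    by (simp add: complex_eq_iff)
  have "fexp L (- k) x * complex_of_real (trig L N c x)
      = (\<Sum>j\<in>?I. c j / 2 * fexp L (j - k) x + cnj (c j) / 2 * fexp L (- j - k) x)" for x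
  proof -
    have "fexp L (- k) x * complex_of_real (Re (c j * fexp L j x))
        = c j / 2 * (fexp L j x * fexp L (- k) x) + cnj (c j) / 2 * (fexp L (- j) x * fexp L (- k) x)" for j
      unfolding Re2 by (simp add: cnj_fexp ring_distribs add_divide_distrib mult_ac)
    thus ?thesis by (simp add: trig_def sum_distrib_left fexp_mult)
  qed
  hence "(LINT x|period_measure L. fexp L (- k) x * complex_of_real (trig L N c x))
      = (LINT x|period_measure L. (\<Sum>j\<in>?I. c j / 2 * fexp L (j - k) x + cnj (c j) / 2 * fexp L (- j - k) x))"
    by simp
  also have "\<dots> = (\<Sum>j\<in>?I. (LINT x|period_measure L. c j / 2 * fexp L (j - k) x + cnj (c j) / 2 * fexp L (- j - k) x))"
    by (rule Bochner_Integration.integral_sum)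
       (intro Bochner_Integration.integrable_add integrable_mult_right integrable_fexp)
  also have "\<dots> = (\<Sum>j\<in>?I. of_real L * ((if j = k then c j / 2 else 0) + (if j = - k then cnj (c j) / 2 else 0)))"
  proof (rule sum.cong[OF refl])
    fix j
    have "(LINT x|period_measure L. c j / 2 * fexp L (j - k) x + cnj (c j) / 2 * fexp L (- j - k) x)
        = c j / 2 * (LINT x|period_measure L. fexp L (j - k) x) + cnj (c j) / 2 * (LINT x|period_measure L. fexp L (- j - k) x)"
      by (subst Bochner_Integration.integral_add)
         (intro integrable_mult_right integrable_fexp | simp only: integral_mult_right_zero)+
    also have "\<dots> = of_real L * ((if j = k then c j / 2 else 0) + (if j = - k then cnj (c j) / 2 else 0))"
      unfolding integral_fexp[OF assms] by (auto simp: ring_distribs mult.commute)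
    finally show "(LINT x|period_measure L. c j / 2 * fexp L (j - k) x + cnj (c j) / 2 * fexp L (- j - k) x)
       = of_real L * ((if j = k then c j / 2 else 0) + (if j = - k then cnj (c j) / 2 else 0))"
      .
  qed
  also have "\<dots> = of_real L * (if \<bar>k\<bar> \<le> int N then (c k + cnj (c (- k))) / 2 else 0)"
    by (auto simp: sum_distrib_left[symmetric] sum.distrib add_divide_distrib)
  finally show ?thesis using assms by (simp add: fourier_coeff_fexp)
qed

definition trunc :: "real \<Rightarrow> (real \<Rightarrow> real) \<Rightarrow> nat \<Rightarrow> real \<Rightarrow> real" where
  "trunc L g N = trig L N (fourier_coeff L g)"

lemma trunc_in_trig_polys: "trunc L g N \<in> trig_polys L"
  by (auto simp: trunc_def trig_polys_def)

text \<open>The coefficients of a real function are Hermitian, so the symmetrization in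
  \<open>fourier_coeff_trig\<close> returns them unchanged.\<close>

lemma fourier_coeff_trunc:
  "L > 0 \<Longrightarrow> fourier_coeff L (trunc L g N) k = (if \<bar>k\<bar> \<le> int N then fourier_coeff L g k else 0)"
  by (simp add: trunc_def fourier_coeff_trig fourier_coeff_neg)

text \<open>The squared norm of \<open>g\<close> minus its truncation is nonnegative, and both
  \<open>l2_inner L g ?p\<close> and \<open>l2_inner L ?p ?p\<close> equal the partial sum
  \<open>?S\<close>. Fourier sums are thus controlled by the $L^2$ norm; the comparison in the other
  direction is \<open>l2_norm_le_nrm\<close>.\<close>

lemma Bessel:
  assumes "L > 0" "g \<in> L2_per L" "finite K"
  shows "L * (\<Sum>k\<in>K. (cmod (fourier_coeff L g k))\<^sup>2) \<le> (l2_norm L g)\<^sup>2"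
proof -
  obtain N where N: "K \<subseteq> {- int N..int N}"
  proof -
    have "finite (abs ` K)" using assms(3) by simp
    then obtain b where b: "\<And>k. k \<in> K \<Longrightarrow> \<bar>k\<bar> \<le> b" by (meson finite_imageI bdd_above_finite bdd_above_def imageI bdd_above.unfold)
    show ?thesis by (rule that[of "nat b"]) (use b in fastforce)
  qed
  let ?S = "L * (\<Sum>k\<in>{- int N..int N}. (cmod (fourier_coeff L g k))\<^sup>2)"
  let ?p = "trunc L g N"
  have p: "?p \<in> L2_per L" by (simp add: trunc_def trig_in_L2_per assms)
  have 1: "l2_inner L g ?p = ?S"
    by (simp add: trunc_def l2_inner_trig assms flip: complex_norm_square)
  have 2: "l2_inner L ?p ?p = ?S"
    unfolding trunc_def l2_inner_trig[OF assms(1) trig_in_L2_per[OF assms(1)]]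
    by (subst trunc_def[symmetric], rule arg_cong[where f = "(*) L"], rule sum.cong)
       (auto simp: fourier_coeff_trunc assms abs_le_iff simp flip: complex_norm_square)
  have "0 \<le> l2_inner L (\<lambda>x. 1 * g x + (-1) * ?p x) (\<lambda>x. 1 * g x + (-1) * ?p x)"
    by (rule l2_inner_self_nonneg)
  also have "\<dots> = l2_inner L g g - ?S"
    by (subst l2_inner_lincomb_self[OF assms(2) p]) (simp add: 1 2)
  finally have "?S \<le> (l2_norm L g)\<^sup>2" by (simp add: l2_norm_sq)
  moreover have "(\<Sum>k\<in>K. (cmod (fourier_coeff L g k))\<^sup>2)
       \<le> (\<Sum>k\<in>{- int N..int N}. (cmod (fourier_coeff L g k))\<^sup>2)"
    by (rule sum_mono2) (use N in auto)
  ultimately show ?thesis using assms(1) by (meson mult_left_mono order_trans less_imp_le)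
qed

subsection \<open>Periodic Sobolev spaces\<close>

text \<open>The Sobolev norm is the limit of Euclidean norms of finitely many of these coordinates.\<close>

definition H_coord :: "real \<Rightarrow> real \<Rightarrow> (real \<Rightarrow> real) \<Rightarrow> int \<Rightarrow> real" where
  "H_coord L s g k = sqrt (L * (1 + (of_int k)\<^sup>2) powr s) * cmod (fourier_coeff L g k)"

lemma H_coord_nonneg: "L > 0 \<Longrightarrow> H_coord L s g k \<ge> 0"
  by (simp add: H_coord_def)

lemma H_coord_sq:
  "L > 0 \<Longrightarrow> (H_coord L s g k)\<^sup>2 = L * ((1 + (of_int k)\<^sup>2) powr s * (cmod (fourier_coeff L g k))\<^sup>2)"
  by (simp add: H_coord_def power_mult_distrib)

lemma H_coord_summable_iff:
  assumes "L > 0"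
  shows "(\<lambda>k. (H_coord L s g k)\<^sup>2) summable_on UNIV \<longleftrightarrow>
    (\<lambda>k::int. (1 + (of_int k)\<^sup>2) powr s * (cmod (fourier_coeff L g k))\<^sup>2) summable_on UNIV"
  unfolding H_coord_sq[OF assms] using assms by (subst summable_on_cmult_right') auto

lemma H_norm_sq:
  assumes "L > 0"
  shows "(H_norm L s g)\<^sup>2 = (\<Sum>\<^sub>\<infinity>k. (H_coord L s g k)\<^sup>2)"
  unfolding H_coord_sq[OF assms] H_norm_def using assms
  by (subst real_sqrt_pow2) (auto intro!: mult_nonneg_nonneg infsum_nonneg simp: infsum_cmult_right')

lemma H_norm_nonneg: "L > 0 \<Longrightarrow> H_norm L s g \<ge> 0"
  unfolding H_norm_def by (auto intro!: mult_nonneg_nonneg infsum_nonneg)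

lemma H_perD: "g \<in> H_per L s \<Longrightarrow> g \<in> L2_per L"
  by (simp add: H_per_def)

lemma H_per_summable: "L > 0 \<Longrightarrow> g \<in> H_per L s \<Longrightarrow> (\<lambda>k. (H_coord L s g k)\<^sup>2) summable_on UNIV"
  by (simp add: H_coord_summable_iff H_per_def)

lemma sum_H_coord_le:
  assumes "L > 0" "g \<in> H_per L s" "finite K"
  shows "(\<Sum>k\<in>K. (H_coord L s g k)\<^sup>2) \<le> (H_norm L s g)\<^sup>2"
  unfolding H_norm_sq[OF assms(1)]
  by (rule finite_sum_le_infsum) (use assms H_per_summable in auto)

text \<open>Infinite sums are dealt with here once: an estimate of finite partial sums gives
  membership and the norm bound together.\<close>

lemma H_perI:
  assumes "L > 0" "g \<in> L2_per L" "\<And>K. finite K \<Longrightarrow> (\<Sum>k\<in>K. (H_coord L s g k)\<^sup>2) \<le> C"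
  shows "g \<in> H_per L s" and "(H_norm L s g)\<^sup>2 \<le> C"
proof -
  have sum: "(\<lambda>k. (H_coord L s g k)\<^sup>2) summable_on UNIV"
    by (rule nonneg_bounded_partial_sums_imp_summable_on[where C = C])
       (auto intro!: assms eventually_finite_subsets_at_top_weakI)
  thus "g \<in> H_per L s" using assms by (simp add: H_per_def H_coord_summable_iff)
  show "(H_norm L s g)\<^sup>2 \<le> C"
    unfolding H_norm_sq[OF assms(1)] by (rule infsum_le_finite_sums[OF sum]) (use assms in auto)
qed

text \<open>Minkowski's inequality for \<open>L2_set\<close> on each finite set of frequencies, with
  a bound that does not depend on the set.\<close>

lemma H_per_lincomb_norm:
  assumes "L > 0" "g \<in> H_per L s" "h \<in> H_per L s"
  shows H_per_lincomb: "(\<lambda>x. a * g x + b * h x) \<in> H_per L s"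
    and H_norm_lincomb_le: "H_norm L s (\<lambda>x. a * g x + b * h x) \<le> \<bar>a\<bar> * H_norm L s g + \<bar>b\<bar> * H_norm L s h"
proof -
  let ?f = "\<lambda>x. a * g x + b * h x" and ?C = "\<bar>a\<bar> * H_norm L s g + \<bar>b\<bar> * H_norm L s h"
  have C: "?C \<ge> 0" by (auto intro!: add_nonneg_nonneg mult_nonneg_nonneg H_norm_nonneg assms)
  have "(\<Sum>k\<in>K. (H_coord L s ?f k)\<^sup>2) \<le> ?C\<^sup>2" if K: "finite K" for K
  proof -
    have bd: "L2_set (H_coord L s u) K \<le> H_norm L s u" if "u \<in> H_per L s" for u
      unfolding L2_set_def using sum_H_coord_le[OF assms(1) that K] H_norm_nonneg[OF assms(1)]
      by (intro real_le_lsqrt) (auto intro: sum_nonneg)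
    have "L2_set (H_coord L s ?f) K \<le> L2_set (\<lambda>k. \<bar>a\<bar> * H_coord L s g k + \<bar>b\<bar> * H_coord L s h k) K"
    proof (rule L2_set_mono)
      fix k
      have "cmod (fourier_coeff L ?f k) \<le> \<bar>a\<bar> * cmod (fourier_coeff L g k) + \<bar>b\<bar> * cmod (fourier_coeff L h k)"
        unfolding fourier_coeff_lincomb[OF H_perD[OF assms(2)] H_perD[OF assms(3)]]
        by (rule order_trans[OF norm_triangle_ineq]) (simp add: norm_mult)
      hence "H_coord L s ?f k \<le> sqrt (L * (1 + (of_int k)\<^sup>2) powr s) *
           (\<bar>a\<bar> * cmod (fourier_coeff L g k) + \<bar>b\<bar> * cmod (fourier_coeff L h k))"
        unfolding H_coord_def using assms(1) by (intro mult_left_mono) auto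
      thus "H_coord L s ?f k \<le> \<bar>a\<bar> * H_coord L s g k + \<bar>b\<bar> * H_coord L s h k"
        by (simp add: H_coord_def algebra_simps)
    qed (simp add: H_coord_nonneg assms)
    also have "\<dots> \<le> L2_set (\<lambda>k. \<bar>a\<bar> * H_coord L s g k) K + L2_set (\<lambda>k. \<bar>b\<bar> * H_coord L s h k) K"
      by (rule L2_set_triangle_ineq)
    also have "\<dots> = \<bar>a\<bar> * L2_set (H_coord L s g) K + \<bar>b\<bar> * L2_set (H_coord L s h) K"
      by (simp add: L2_set_right_distrib)
    also have "\<dots> \<le> ?C" by (intro add_mono mult_left_mono bd assms) auto
    finally have "(L2_set (H_coord L s ?f) K)\<^sup>2 \<le> ?C\<^sup>2" by (intro power_mono L2_set_nonneg)
    thus ?thesis by (simp add: L2_set_def sum_nonneg)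
  qed
  note * = H_perI[OF assms(1) L2_per_lincomb[OF H_perD[OF assms(2)] H_perD[OF assms(3)]] this]
  show "?f \<in> H_per L s" by (rule *(1))
  show "H_norm L s ?f \<le> ?C" by (rule power2_le_imp_le[OF *(2) C])
qed

lemma H_norm_triangle:
  assumes "L > 0" "g \<in> H_per L s" "h \<in> H_per L s"
  shows "H_norm L s (\<lambda>x. g x + h x) \<le> H_norm L s g + H_norm L s h"
  using H_norm_lincomb_le[OF assms, of 1 1] by simp

lemma H_per_diff:
  assumes "L > 0" "g \<in> H_per L s" "h \<in> H_per L s"
  shows "(\<lambda>x. g x - h x) \<in> H_per L s"
  using H_per_lincomb[OF assms, of 1 "-1"] by simp

lemma H_norm_diff_le:
  assumes "L > 0" "g \<in> H_per L s" "h \<in> H_per L s"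
  shows "H_norm L s (\<lambda>x. g x - h x) \<le> H_norm L s g + H_norm L s h"
  using H_norm_lincomb_le[OF assms, of 1 "-1"] by simp

lemma H_per_cmult:
  assumes "L > 0" "g \<in> H_per L s"
  shows "(\<lambda>x. a * g x) \<in> H_per L s"
  using H_per_lincomb[OF assms assms(2), of a 0] by simp

lemma H_norm_cmult:
  assumes "L > 0" "g \<in> H_per L s"
  shows "H_norm L s (\<lambda>x. a * g x) = \<bar>a\<bar> * H_norm L s g"
proof -
  have "fourier_coeff L (\<lambda>x. a * g x) k = of_real a * fourier_coeff L g k" for k
    using fourier_coeff_lincomb[OF H_perD[OF assms(2)] H_perD[OF assms(2)], of a 0] by simp
  hence "(H_coord L s (\<lambda>x. a * g x) k)\<^sup>2 = a\<^sup>2 * (H_coord L s g k)\<^sup>2" for k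
    by (simp add: H_coord_def norm_mult power_mult_distrib)
  hence "(H_norm L s (\<lambda>x. a * g x))\<^sup>2 = (\<bar>a\<bar> * H_norm L s g)\<^sup>2"
    by (simp add: H_norm_sq assms infsum_cmult_right' power_mult_distrib)
  thus ?thesis by (simp add: power2_eq_iff_nonneg H_norm_nonneg assms)
qed

lemma H_norm_cong_AE:
  assumes "AE x in lborel. g x = h x" "g \<in> borel_measurable borel" "h \<in> borel_measurable borel"
  shows "H_norm L s g = H_norm L s h"
  by (simp add: H_norm_def fourier_coeff_cong_AE[OF assms])

lemma H_per_mono_norm:
  assumes "L > 0" "s \<le> s'" "g \<in> H_per L s'"
  shows H_per_mono: "g \<in> H_per L s" and H_norm_mono: "H_norm L s g \<le> H_norm L s' g"
proof -
  have "(\<Sum>k\<in>K. (H_coord L s g k)\<^sup>2) \<le> (H_norm L s' g)\<^sup>2" if K: "finite K" for K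
  proof -
    have "(\<Sum>k\<in>K. (H_coord L s g k)\<^sup>2) \<le> (\<Sum>k\<in>K. (H_coord L s' g k)\<^sup>2)"
      unfolding H_coord_sq[OF assms(1)] using assms
      by (intro sum_mono mult_left_mono mult_right_mono powr_mono) auto
    also have "\<dots> \<le> (H_norm L s' g)\<^sup>2" by (rule sum_H_coord_le[OF assms(1,3) K])
    finally show ?thesis .
  qed
  note * = H_perI[OF assms(1) H_perD[OF assms(3)] this]
  show "g \<in> H_per L s" by (rule *(1))
  show "H_norm L s g \<le> H_norm L s' g"
    by (rule power2_le_imp_le[OF *(2)]) (auto simp: H_norm_nonneg[OF assms(1)])
qed

lemma H_shift:
  assumes "L > 0" "g \<in> H_per L s"
  shows H_per_shift: "(\<lambda>x. g (x + r)) \<in> H_per L s"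
    and H_norm_shift: "H_norm L s (\<lambda>x. g (x + r)) = H_norm L s g"
proof -
  have "cmod (fourier_coeff L (\<lambda>x. g (x + r)) k) = cmod (fourier_coeff L g k)" for k
    by (simp add: fourier_coeff_shift[OF assms(1) H_perD[OF assms(2)]] norm_mult)
  thus "(\<lambda>x. g (x + r)) \<in> H_per L s" "H_norm L s (\<lambda>x. g (x + r)) = H_norm L s g"
    using assms L2_per_shift[OF assms(1) H_perD[OF assms(2)]] by (auto simp: H_per_def H_norm_def)
qed

text \<open>Young's inequality for the weights: (2 \<eta> w - 1)^2 \<ge> 0 gives w \<le> \<eta> w^2
  + 1 / (4 \<eta>), and w^2 is the weight of the doubled order. After summation, Bessel's inequality
  turns the constant part into the $L^2$ norm.\<close>

lemma interpolation:
  assumes "L > 0" "g \<in> H_per L (2 * s)" "\<eta> > 0" "s \<ge> 0"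
  shows "(H_norm L s g)\<^sup>2 \<le> \<eta> * (H_norm L (2 * s) g)\<^sup>2 + (l2_norm L g)\<^sup>2 / (4 * \<eta>)"
proof (rule H_perI(2)[OF assms(1) H_perD[OF assms(2)]])
  fix K :: "int set" assume K: "finite K"
  have w: "(1 + (of_int k)\<^sup>2) powr s \<le> \<eta> * (1 + (of_int k)\<^sup>2) powr (2 * s) + 1 / (4 * \<eta>)" for k :: int
  proof -
    let ?w = "(1 + (of_int k)\<^sup>2) powr s :: real"
    have "(1 + (real_of_int k)\<^sup>2) powr (2 * s) = ?w\<^sup>2" by (simp only: power2_eq_square mult_2 powr_add)
    moreover have "0 \<le> (2 * \<eta> * ?w - 1)\<^sup>2 / (4 * \<eta>)" using assms(3) by simp
    hence "?w \<le> \<eta> * ?w\<^sup>2 + 1 / (4 * \<eta>)" using assms(3) by (simp add: power2_eq_square field_simps)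
    ultimately show ?thesis by simp
  qed
  have "(\<Sum>k\<in>K. (H_coord L s g k)\<^sup>2)
      \<le> (\<Sum>k\<in>K. \<eta> * (H_coord L (2 * s) g k)\<^sup>2 + 1 / (4 * \<eta>) * (L * (cmod (fourier_coeff L g k))\<^sup>2))"
  proof (rule sum_mono)
    fix k
    have "L * (cmod (fourier_coeff L g k))\<^sup>2 * (1 + (of_int k)\<^sup>2) powr s
      \<le> L * (cmod (fourier_coeff L g k))\<^sup>2 * (\<eta> * (1 + (of_int k)\<^sup>2) powr (2 * s) + 1 / (4 * \<eta>))"
      using assms(1) by (intro mult_left_mono w) simp
    thus "(H_coord L s g k)\<^sup>2 \<le> \<eta> * (H_coord L (2 * s) g k)\<^sup>2 + 1 / (4 * \<eta>) * (L * (cmod (fourier_coeff L g k))\<^sup>2)"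
      unfolding H_coord_sq[OF assms(1)] by (simp add: algebra_simps)
  qed
  also have "\<dots> = \<eta> * (\<Sum>k\<in>K. (H_coord L (2 * s) g k)\<^sup>2)
       + 1 / (4 * \<eta>) * (L * (\<Sum>k\<in>K. (cmod (fourier_coeff L g k))\<^sup>2))"
    by (simp add: sum.distrib sum_distrib_left)
  also have "\<dots> \<le> \<eta> * (H_norm L (2 * s) g)\<^sup>2 + 1 / (4 * \<eta>) * (l2_norm L g)\<^sup>2"
    using assms by (intro add_mono mult_left_mono sum_H_coord_le Bessel K H_perD) auto
  finally show "(\<Sum>k\<in>K. (H_coord L s g k)\<^sup>2) \<le> \<eta> * (H_norm L (2 * s) g)\<^sup>2 + (l2_norm L g)\<^sup>2 / (4 * \<eta>)"
    by simp
qed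

lemma trig_in_H_per:
  assumes "L > 0" "p \<in> trig_polys L"
  shows "p \<in> H_per L s"
proof -
  from assms obtain N c where p: "p = trig L N c" by (auto simp: trig_polys_def)
  show ?thesis
  proof (rule H_perI(1)[OF assms(1)])
    fix K :: "int set" assume K: "finite K"
    have "(\<Sum>k\<in>K. (H_coord L s p k)\<^sup>2) = (\<Sum>k\<in>K \<inter> {- int N..int N}. (H_coord L s p k)\<^sup>2)"
      by (rule sum.mono_neutral_right)
         (use K in \<open>auto simp: p H_coord_def fourier_coeff_trig assms(1)\<close>)
    also have "\<dots> \<le> (\<Sum>k\<in>{- int N..int N}. (H_coord L s p k)\<^sup>2)"
      by (rule sum_mono2) auto
    finally show "(\<Sum>k\<in>K. (H_coord L s p k)\<^sup>2) \<le> (\<Sum>k\<in>{- int N..int N}. (H_coord L s p k)\<^sup>2)" .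
  qed (simp add: p trig_in_L2_per assms)
qed

text \<open>The truncation error has only coefficients with |k| > N. Once N exceeds all frequencies
  of a finite set carrying almost the whole sum, every finite part of the error is disjoint from
  that set and bounded by what is left over.\<close>

lemma trunc_tendsto:
  assumes "L > 0" "g \<in> H_per L s"
  shows "(\<lambda>N. H_norm L s (\<lambda>x. g x - trunc L g N x)) \<longlonglongrightarrow> 0"
proof (rule LIMSEQ_I)
  fix r :: real assume r: "r > 0"
  let ?x = "\<lambda>k. (H_coord L s g k)\<^sup>2"
  have sm: "?x summable_on UNIV" by (rule H_per_summable[OF assms])
  obtain F where F: "finite F" "dist (sum ?x F) (infsum ?x UNIV) \<le> (r / 2)\<^sup>2"
    using infsum_finite_approximation[OF sm, of "(r / 2)\<^sup>2"] r by auto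
  obtain b where b: "\<And>k. k \<in> F \<Longrightarrow> \<bar>k\<bar> \<le> b"
    by (metis F(1) bdd_above.unfold bdd_above_finite finite_imageI imageI)
  have "norm (H_norm L s (\<lambda>x. g x - trunc L g N x) - 0) < r" if N: "N \<ge> nat b" for N
  proof -
    let ?h = "\<lambda>x. g x - trunc L g N x"
    have tr: "trunc L g N \<in> H_per L s" by (rule trig_in_H_per[OF assms(1) trunc_in_trig_polys])
    have co: "fourier_coeff L ?h k = (if \<bar>k\<bar> \<le> int N then 0 else fourier_coeff L g k)" for k
      using fourier_coeff_lincomb[OF H_perD[OF assms(2)] H_perD[OF tr], of 1 "-1" k]
      by (auto simp: fourier_coeff_trunc assms)
    have "(H_norm L s ?h)\<^sup>2 \<le> (r / 2)\<^sup>2"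
    proof (rule H_perI(2)[OF assms(1) H_perD[OF H_per_diff[OF assms tr]]])
      fix K :: "int set" assume K: "finite K"
      let ?K = "{k \<in> K. \<bar>k\<bar> > int N}"
      have disj: "?K \<inter> F = {}" using b N by fastforce
      have "(\<Sum>k\<in>K. (H_coord L s ?h k)\<^sup>2) = (\<Sum>k\<in>?K. ?x k)"
        by (rule sum.mono_neutral_cong_right) (use K in \<open>auto simp: H_coord_def co\<close>)
      also have "\<dots> = (\<Sum>k\<in>?K \<union> F. ?x k) - (\<Sum>k\<in>F. ?x k)"
        by (subst sum.union_disjoint) (use K F disj in auto)
      also have "\<dots> \<le> infsum ?x UNIV - (\<Sum>k\<in>F. ?x k)"
        using finite_sum_le_infsum[OF sm, of "?K \<union> F"] K F by simp
      also have "\<dots> \<le> (r / 2)\<^sup>2" using F(2) by (simp add: dist_real_def)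
      finally show "(\<Sum>k\<in>K. (H_coord L s ?h k)\<^sup>2) \<le> (r / 2)\<^sup>2" .
    qed
    hence "H_norm L s ?h \<le> r / 2" by (rule power2_le_imp_le) (use r in simp)
    thus ?thesis using r H_norm_nonneg[OF assms(1), of s ?h] by simp
  qed
  thus "\<exists>N0. \<forall>N\<ge>N0. norm (H_norm L s (\<lambda>x. g x - trunc L g N x) - 0) < r" by blast
qed

subsection \<open>Smooth periodic functions and multipliers\<close>

lemma smooth_DERIV: "smooth g \<Longrightarrow> ((deriv ^^ n) g has_real_derivative (deriv ^^ Suc n) g x) (at x)"
  by (simp add: smooth_def DERIV_deriv_iff_field_differentiable)

lemma smooth_continuous: "smooth g \<Longrightarrow> continuous_on S ((deriv ^^ n) g)"
  by (meson smooth_DERIV DERIV_continuous_on has_field_derivative_at_within)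

lemma smooth_deriv: "smooth g \<Longrightarrow> smooth (deriv g)"
  unfolding smooth_def by (metis funpow_swap1 funpow.simps(2) o_apply)

lemma smooth_DERIV_lincomb:
  assumes "smooth g" "smooth h"
  shows "smooth (\<lambda>x. a * g x + b * h x)"
proof -
  have d: "((deriv ^^ n) g has_real_derivative deriv ((deriv ^^ n) g) x) (at x)"
    "((deriv ^^ n) h has_real_derivative deriv ((deriv ^^ n) h) x) (at x)" for n x
    using smooth_DERIV[OF assms(1), of n x] smooth_DERIV[OF assms(2), of n x] by simp_all
  have "(deriv ^^ n) (\<lambda>x. a * g x + b * h x) = (\<lambda>x. a * (deriv ^^ n) g x + b * (deriv ^^ n) h x)" for n
  proof (induction n)
    case (Suc n)
    have "deriv (\<lambda>x. a * (deriv ^^ n) g x + b * (deriv ^^ n) h x) x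
        = a * (deriv ^^ Suc n) g x + b * (deriv ^^ Suc n) h x" for x
      by (intro DERIV_imp_deriv) (auto intro!: derivative_eq_intros d)
    thus ?case using Suc by auto
  qed simp
  moreover have "((\<lambda>x. a * (deriv ^^ n) g x + b * (deriv ^^ n) h x) has_real_derivative
      a * (deriv ^^ Suc n) g x + b * (deriv ^^ Suc n) h x) (at x)" for n x
    by (auto intro!: derivative_eq_intros d)
  ultimately show ?thesis unfolding smooth_def field_differentiable_def by metis
qed

lemma Cinf_perD:
  assumes "g \<in> Cinf_per L"
  shows "periodic L g" "smooth g" "(g has_real_derivative deriv g x) (at x)" "continuous_on S g"
  using assms smooth_DERIV[of g 0 x] smooth_continuous[of g S 0] by (auto simp: Cinf_per_def)

lemma Cinf_per_lincomb:
  "g \<in> Cinf_per L \<Longrightarrow> h \<in> Cinf_per L \<Longrightarrow> (\<lambda>x. a * g x + b * h x) \<in> Cinf_per L"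
  by (auto simp: Cinf_per_def periodic_def smooth_DERIV_lincomb)

lemma Cinf_per_deriv:
  assumes "g \<in> Cinf_per L"
  shows "deriv g \<in> Cinf_per L"
proof -
  have "deriv g (x + L) = deriv g x" for x
  proof -
    have "((\<lambda>x. g (x + L)) has_real_derivative deriv g (x + L)) (at x)"
      using Cinf_perD(3)[OF assms, of "x + L"] by (simp add: DERIV_shift)
    moreover have "(\<lambda>x. g (x + L)) = g" using Cinf_perD(1)[OF assms] by (auto simp: periodic_def)
    ultimately show ?thesis using Cinf_perD(3)[OF assms] DERIV_unique by metis
  qed
  thus ?thesis using assms by (auto simp: Cinf_per_def periodic_def smooth_deriv)
qed

lemma Cinf_in_L2_per: "g \<in> Cinf_per L \<Longrightarrow> g \<in> L2_per L"
  by (intro continuous_in_L2_per Cinf_perD)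

text \<open>Integration by parts, read off from the vanishing integral of the derivative of the
  periodic product \<open>?G\<close>.\<close>

lemma fourier_coeff_deriv:
  assumes "L > 0" "g \<in> Cinf_per L"
  shows "fourier_coeff L (deriv g) k = \<i> * of_real (2 * pi * of_int k / L) * fourier_coeff L g k"
proof -
  let ?a = "\<i> * of_real (2 * pi * of_int k / L) :: complex"
  let ?G = "\<lambda>x. fexp L (- k) x * complex_of_real (g x)"
  let ?H = "\<lambda>x. fexp L (- k) x * complex_of_real (deriv g x)"
  have int: "integrable (period_measure L) ?G" "integrable (period_measure L) ?H"
    by (intro integrable_period_continuous continuous_intros Cinf_perD(4)[OF assms(2)]
        Cinf_perD(4)[OF Cinf_per_deriv[OF assms(2)]])+
  have "(LINT x|period_measure L. ?H x - ?a * ?G x) = 0"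
  proof (rule integral_deriv_periodic[OF assms(1), of ?G])
    show "(?G has_vector_derivative ?H x - ?a * ?G x) (at x)" for x
    proof -
      have "((\<lambda>x. complex_of_real (g x)) has_vector_derivative complex_of_real (deriv g x)) (at x)"
        using Cinf_perD(3)[OF assms(2), of x] bounded_linear.has_vector_derivative[OF bounded_linear_of_real]
        by (auto simp: has_real_derivative_iff_has_vector_derivative)
      from has_vector_derivative_mult[OF fexp_has_vector_derivative this]
      show ?thesis by (rule back_subst[where P = "\<lambda>d. (?G has_vector_derivative d) (at x)"])
          (simp add: algebra_simps)
    qed
    show "?G L = ?G 0"
      using fexp_period[of L "- k" 0] Cinf_perD(1)[OF assms(2)] assms(1)
      by (auto simp: periodic_def dest: spec[of _ 0])
  qed (intro continuous_intros Cinf_perD(4)[OF assms(2)] Cinf_perD(4)[OF Cinf_per_deriv[OF assms(2)]])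
  hence "(LINT x|period_measure L. ?H x) = ?a * (LINT x|period_measure L. ?G x)"
    by (subst (asm) Bochner_Integration.integral_diff)
       (use int in \<open>auto simp only: integral_mult_right_zero right_minus_eq intro: integrable_mult_right\<close>)
  thus ?thesis by (simp add: fourier_coeff_fexp)
qed

text \<open>The operator 1 - (L / (2 \<pi>))^2 d^2/dx^2 has symbol 1 + k^2, exactly the Sobolev
  weight, and maps smooth periodic functions to such functions; \<open>h\<close> arises from
  \<open>g\<close> by applying it \<open>n\<close> times. This converts smoothness into bounds on
  coefficients.\<close>

lemma Cinf_bessel_potential:
  assumes "L > 0" "g \<in> Cinf_per L"
  obtains h where "h \<in> Cinf_per L"
    "\<And>k. fourier_coeff L h k = (1 + (of_int k)\<^sup>2) ^ n * fourier_coeff L g k"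
proof -
  have "\<exists>h\<in>Cinf_per L. \<forall>k. fourier_coeff L h k = (1 + (of_int k)\<^sup>2) ^ n * fourier_coeff L g k"
  proof (induction n)
    case (Suc n)
    then obtain h where h: "h \<in> Cinf_per L"
      "\<And>k. fourier_coeff L h k = (1 + (of_int k)\<^sup>2) ^ n * fourier_coeff L g k" by blast
    let ?b = "- (L / (2 * pi))\<^sup>2"
    let ?h = "\<lambda>x. 1 * h x + ?b * deriv (deriv h) x"
    note h' = Cinf_per_deriv[OF h(1)]
    note h'' = Cinf_per_deriv[OF h']
    have "fourier_coeff L ?h k = (1 + (of_int k)\<^sup>2) ^ Suc n * fourier_coeff L g k" for k
      using assms(1)
      by (subst fourier_coeff_lincomb[OF Cinf_in_L2_per[OF h(1)] Cinf_in_L2_per[OF h'']])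
         (simp add: fourier_coeff_deriv h' h field_simps power2_eq_square)
    moreover have "?h \<in> Cinf_per L" by (rule Cinf_per_lincomb[OF h(1) h''])
    ultimately show ?case by blast
  qed (use assms in auto)
  thus ?thesis using that by blast
qed

text \<open>For s \<le> n the weight of order s is at most the squared symbol of the n-th potential
  \<open>h\<close>, so the coordinates of \<open>g\<close> are dominated by the coefficients of
  \<open>h\<close>, to which Bessel's inequality applies.\<close>

lemma Cinf_in_H_per:
  assumes "L > 0" "g \<in> Cinf_per L"
  shows "g \<in> H_per L s"
proof -
  obtain n :: nat where n: "s \<le> real n" using real_arch_simple by blast
  obtain h where h: "h \<in> Cinf_per L"
    "\<And>k. fourier_coeff L h k = (1 + (of_int k)\<^sup>2) ^ n * fourier_coeff L g k"
    by (rule Cinf_bessel_potential[OF assms]) blast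
  show ?thesis
  proof (rule H_perI(1)[OF assms(1) Cinf_in_L2_per[OF assms(2)]])
    fix K :: "int set" assume K: "finite K"
    have "(\<Sum>k\<in>K. (H_coord L s g k)\<^sup>2) \<le> (\<Sum>k\<in>K. L * (cmod (fourier_coeff L h k))\<^sup>2)"
    proof (rule sum_mono)
      fix k :: int
      let ?w = "1 + (real_of_int k)\<^sup>2"
      have "?w powr s \<le> ?w powr (real n)" using n by (intro powr_mono) auto
      also have "\<dots> = ?w ^ n" by (simp add: powr_realpow add_pos_nonneg)
      also have "\<dots> \<le> ?w ^ (2 * n)" by (intro power_increasing) auto
      finally have "?w powr s \<le> (?w ^ n)\<^sup>2" by (simp add: power_mult[symmetric] mult.commute)
      hence "?w powr s * (cmod (fourier_coeff L g k))\<^sup>2 \<le> (?w ^ n)\<^sup>2 * (cmod (fourier_coeff L g k))\<^sup>2"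
        by (intro mult_right_mono) auto
      also have "\<dots> = (cmod (fourier_coeff L h k))\<^sup>2"
      proof -
        have "(1 + (of_int k)\<^sup>2 :: complex) = of_real ?w" by simp
        thus ?thesis unfolding h(2) by (simp only: norm_mult norm_power norm_of_real power_mult_distrib) simp
      qed
      finally show "(H_coord L s g k)\<^sup>2 \<le> L * (cmod (fourier_coeff L h k))\<^sup>2"
        unfolding H_coord_sq[OF assms(1)] using assms(1) by (intro mult_left_mono) auto
    qed
    also have "\<dots> \<le> (l2_norm L h)\<^sup>2"
      using Bessel[OF assms(1) Cinf_in_L2_per[OF h(1)] K] by (simp add: sum_distrib_left)
    finally show "(\<Sum>k\<in>K. (H_coord L s g k)\<^sup>2) \<le> (l2_norm L h)\<^sup>2" .
  qed
qed

text \<open>The n-th potential is continuous and periodic, hence bounded with bounded coefficients;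
  dividing by its symbol gives the decay.\<close>

lemma Cinf_fourier_decay:
  assumes "L > 0" "g \<in> Cinf_per L"
  obtains B where "\<And>k. cmod (fourier_coeff L g k) \<le> B / (1 + (of_int k)\<^sup>2) ^ n"
proof -
  obtain h where h: "h \<in> Cinf_per L"
    "\<And>k. fourier_coeff L h k = (1 + (of_int k)\<^sup>2) ^ n * fourier_coeff L g k"
    by (rule Cinf_bessel_potential[OF assms]) blast
  obtain B where B: "\<And>x. \<bar>h x\<bar> \<le> B"
    using periodic_bounded[OF assms(1) Cinf_perD(1)[OF h(1)] Cinf_perD(4)[OF h(1)]] by blast
  show ?thesis
  proof (rule that)
    fix k :: int
    let ?w = "1 + (real_of_int k)\<^sup>2"
    have w: "(1 + (of_int k)\<^sup>2 :: complex) = of_real ?w" by simp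
    have "cmod (fourier_coeff L h k) \<le> B"
      by (rule fourier_coeff_norm_le[OF assms(1) B])
         (intro borel_measurable_continuous_onI Cinf_perD(4)[OF h(1)])
    moreover have "cmod (fourier_coeff L h k) = ?w ^ n * cmod (fourier_coeff L g k)"
      unfolding h(2) w by (simp only: norm_mult norm_power norm_of_real) simp
    moreover have "?w ^ n > 0" by (simp add: add_pos_nonneg)
    ultimately show "cmod (fourier_coeff L g k) \<le> B / ?w ^ n"
      by (simp add: pos_le_divide_eq mult.commute)
  qed
qed

text \<open>Absolute convergence makes the symmetric partial sums converge uniformly to a continuous
  periodic function, and a uniform error of size e changes each coefficient by at most e. The lemma
  supplies the witness behind the choice in \<open>multiplier\<close>.\<close>

lemma fourier_series_realizable:
  assumes "L > 0" and bd: "\<And>k. cmod (c k) \<le> C / (1 + (of_int k)\<^sup>2)" and herm: "\<And>k. c (- k) = cnj (c k)"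
  shows "\<exists>h\<in>L2_per L. \<forall>k. fourier_coeff L h k = c k"
proof -
  \<comment> \<open>Pairing the frequencies \<open>n\<close> and \<open>- n\<close> turns the
    symmetric sums into partial sums of a series over the naturals; frequency 0 must be counted only
    once.\<close>
  define T where "T n x = (if n = 0 then Re (c 0 * fexp L 0 x)
     else Re (c (int n) * fexp L (int n) x) + Re (c (- int n) * fexp L (- int n) x))" for n x
  have trig_T: "trig L N c x = (\<Sum>i<Suc N. T i x)" for N x
  proof (induction N)
    case 0 thus ?case by (simp add: trig_def T_def)
  next
    case (Suc N)
    have "{- int (Suc N)..int (Suc N)} = insert (- int (Suc N)) (insert (int (Suc N)) {- int N..int N})"
      by auto
    hence "trig L (Suc N) c x = trig L N c x + T (Suc N) x"
      by (simp add: trig_def T_def)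
    thus ?case using Suc by simp
  qed
  have C: "C \<ge> 0" using order_trans[OF norm_ge_zero bd[of 0]] by simp
  have T_le: "norm (T n x) \<le> 2 * C / (1 + (real n)\<^sup>2)" for n x
  proof -
    have 1: "\<bar>Re (c k * fexp L k x)\<bar> \<le> C / (1 + (of_int k)\<^sup>2)" for k
      using order_trans[OF abs_Re_le_cmod, of "c k * fexp L k x"] bd[of k] by (simp add: norm_mult)
    have "C / (1 + (real n)\<^sup>2) \<ge> 0" using C by simp
    thus ?thesis using 1[of "int n"] 1[of "- int n"] 1[of 0] unfolding T_def by auto
  qed
  have sumC: "summable (\<lambda>n. 2 * C / (1 + (real n)\<^sup>2))"
  proof (rule summable_comparison_test')
    have "summable (\<lambda>n. 1 / (real n)\<^sup>2)" using inverse_power_summable[of 2, where ?'a = real]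
      by (simp add: inverse_eq_divide)
    thus "summable (\<lambda>n. 2 * C * (1 / (real n)\<^sup>2))" by (rule summable_mult)
    show "norm (2 * C / (1 + (real n)\<^sup>2)) \<le> 2 * C * (1 / (real n)\<^sup>2)" if "n \<ge> 1" for n
      using that C by (auto intro!: divide_left_mono mult_pos_pos add_pos_nonneg)
  qed
  let ?h = "\<lambda>x. suminf (\<lambda>i. T i x)"
  have "uniform_limit UNIV (\<lambda>n x. \<Sum>i<n. T i x) ?h sequentially"
    by (rule Weierstrass_m_test[OF T_le sumC])
  hence "uniform_limit UNIV (\<lambda>N x. \<Sum>i<Suc N. T i x) ?h sequentially"
    by (rule filterlim_compose) (rule filterlim_Suc)
  hence ul: "uniform_limit UNIV (\<lambda>N. trig L N c) ?h sequentially"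
    unfolding trig_T[abs_def] .
  have cont: "continuous_on UNIV ?h"
    by (rule uniform_limit_theorem[OF _ ul]) (auto intro!: always_eventually continuous_intros)
  have "T i (x + L) = T i x" for i x using assms(1) by (simp add: T_def fexp_period)
  hence "periodic L ?h" by (simp add: periodic_def)
  hence h: "?h \<in> L2_per L" by (rule continuous_in_L2_per[OF _ cont])
  have "fourier_coeff L ?h k = c k" for k
  proof -
    have "cmod (fourier_coeff L ?h k - c k) \<le> e" if e: "e > 0" for e
    proof -
      have "\<forall>\<^sub>F N in sequentially. N \<ge> nat \<bar>k\<bar> \<and> (\<forall>x\<in>UNIV. dist (trig L N c x) (?h x) < e)"
        using uniform_limitD[OF ul e] eventually_ge_at_top by (rule eventually_elim2) blast
      then obtain N where N: "N \<ge> nat \<bar>k\<bar>" "\<And>x. \<bar>?h x - trig L N c x\<bar> < e"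
        by (auto simp: eventually_sequentially dist_real_def abs_minus_commute)
      have "fourier_coeff L (\<lambda>x. 1 * ?h x + (-1) * trig L N c x) k = fourier_coeff L ?h k - c k"
        using N(1) assms(1) by (subst fourier_coeff_lincomb[OF h trig_in_L2_per])
          (auto simp: fourier_coeff_trig herm)
      moreover have "cmod (fourier_coeff L (\<lambda>x. 1 * ?h x + (-1) * trig L N c x) k) \<le> e"
        by (rule fourier_coeff_norm_le[OF assms(1)])
           (use N(2) in \<open>auto intro!: less_imp_le borel_measurable_continuous_onI continuous_intros cont\<close>)
      ultimately show ?thesis by simp
    qed
    thus ?thesis using field_le_epsilon[of "cmod (fourier_coeff L ?h k - c k)" 0] by simp
  qed
  thus ?thesis using h by blast
qed

text \<open>Continuity bounds \<theta> on the compact range below \<open>\<kappa>0\<close>. Above it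
  the growth condition applies; its lower half gives \<theta> \<ge> 0 there, so that the upper half
  bounds the absolute value.\<close>

lemma admissible_symbol_bound:
  assumes "admissible_symbol \<theta> m"
  obtains C where "C > 0" "\<And>k::int. \<bar>\<theta> (of_int k)\<bar> \<le> C * (1 + (of_int k)\<^sup>2) powr (m / 2)"
proof -
  from assms obtain v1 v2 \<kappa>0 where v: "v1 > 0" "v2 > 0" and m: "m > 0"
    and up: "\<And>\<kappa>. \<bar>\<kappa>\<bar> \<ge> \<kappa>0 \<Longrightarrow> v1 * \<bar>\<kappa>\<bar> powr m \<le> \<theta> \<kappa> \<and> \<theta> \<kappa> \<le> v2 * \<bar>\<kappa>\<bar> powr m"
    and cont: "continuous_on UNIV \<theta>"
    unfolding admissible_symbol_def by blast
  have "compact (\<theta> ` {- \<kappa>0..\<kappa>0})"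
    by (rule compact_continuous_image) (use cont continuous_on_subset in auto)
  then obtain B where B: "\<And>x. x \<in> {- \<kappa>0..\<kappa>0} \<Longrightarrow> \<bar>\<theta> x\<bar> \<le> B"
    by (metis bounded_iff compact_imp_bounded imageI real_norm_def)
  show ?thesis
  proof (rule that[of "max B 0 + v2"])
    fix k :: int
    let ?w = "(1 + (real_of_int k)\<^sup>2) powr (m / 2)"
    have w1: "?w \<ge> 1" using m by (intro ge_one_powr_ge_zero) auto
    show "\<bar>\<theta> (of_int k)\<bar> \<le> (max B 0 + v2) * ?w"
    proof (cases "\<bar>real_of_int k\<bar> \<ge> \<kappa>0")
      case True
      have "\<bar>real_of_int k\<bar> powr m = ((real_of_int k)\<^sup>2) powr (m / 2)"
      proof (cases "k = 0")
        case False
        hence "(real_of_int k)\<^sup>2 = \<bar>real_of_int k\<bar> powr 2" by simp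
        thus ?thesis by (simp only: powr_powr) simp
      qed (use m in simp)
      also have "\<dots> \<le> ?w" using m by (intro powr_mono2) auto
      finally have "v2 * \<bar>real_of_int k\<bar> powr m \<le> v2 * ?w" using v by simp
      moreover have "0 \<le> v1 * \<bar>real_of_int k\<bar> powr m" using v by simp
      moreover have "0 \<le> max B 0 * ?w" by simp
      ultimately have "\<bar>\<theta> (of_int k)\<bar> \<le> max B 0 * ?w + v2 * ?w"
        using conjunct1[OF up[OF True]] conjunct2[OF up[OF True]] by linarith
      thus ?thesis by (simp only: distrib_right)
    next
      case False
      hence "\<bar>\<theta> (of_int k)\<bar> \<le> max B 0 + v2" using B[of "of_int k"] v by fastforce
      also have "\<dots> \<le> (max B 0 + v2) * ?w" using w1 v by (simp add: mult_le_cancel_left1)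
      finally show ?thesis .
    qed
  qed (use v in simp)
qed

lemma multiplier_Cinf:
  assumes "L > 0" "admissible_symbol \<theta> m" "g \<in> Cinf_per L"
  shows "multiplier \<theta> L g \<in> L2_per L"
    and "fourier_coeff L (multiplier \<theta> L g) k = of_real (\<theta> (of_int k)) * fourier_coeff L g k"
proof -
  obtain C where C: "C > 0" "\<And>k::int. \<bar>\<theta> (of_int k)\<bar> \<le> C * (1 + (of_int k)\<^sup>2) powr (m / 2)"
    using admissible_symbol_bound[OF assms(2)] by blast
  \<comment> \<open>Decay of order \<open>n\<close> absorbs the growth m / 2 of the symbol and
    leaves the power -1 of 1 + k^2 required by \<open>fourier_series_realizable\<close>.\<close>
  obtain n :: nat where n: "m / 2 + 1 \<le> real n" using real_arch_simple by blast
  obtain B where B: "\<And>k. cmod (fourier_coeff L g k) \<le> B / (1 + (of_int k)\<^sup>2) ^ n"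
    using Cinf_fourier_decay[OF assms(1,3)] by blast
  have "\<exists>h\<in>L2_per L. \<forall>k. fourier_coeff L h k = of_real (\<theta> (of_int k)) * fourier_coeff L g k"
  proof (rule fourier_series_realizable[OF assms(1)])
    fix k :: int
    let ?w = "1 + (real_of_int k)\<^sup>2"
    have w: "?w \<ge> 1" "?w > 0" by (auto simp: add_pos_nonneg)
    have B0: "B \<ge> 0" using order_trans[OF norm_ge_zero B[of 0]] by simp
    have "cmod (of_real (\<theta> (of_int k)) * fourier_coeff L g k) \<le> (C * ?w powr (m / 2)) * (B / ?w ^ n)"
      unfolding norm_mult norm_of_real by (intro mult_mono C B) (use C in auto)
    also have "\<dots> = C * B * ?w powr (m / 2 - real n)"
      using w by (simp add: powr_diff powr_realpow)
    also have "\<dots> \<le> C * B * ?w powr (- 1)"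
      using C B0 n w by (intro mult_left_mono powr_mono) auto
    also have "\<dots> = C * B / ?w" using w by (simp add: powr_minus_divide)
    finally show "cmod (of_real (\<theta> (of_int k)) * fourier_coeff L g k) \<le> C * B / ?w" .
    show "of_real (\<theta> (of_int (- k))) * fourier_coeff L g (- k) = cnj (of_real (\<theta> (of_int k)) * fourier_coeff L g k)"
      using assms(2) by (simp add: fourier_coeff_neg admissible_symbol_def)
  qed
  hence ex: "\<exists>h. h \<in> L2_per L \<and>
     (\<forall>k. fourier_coeff L h k = of_real (\<theta> (of_int k)) * fourier_coeff L g k)" by blast
  have "multiplier \<theta> L g \<in> L2_per L \<and>
     (\<forall>k. fourier_coeff L (multiplier \<theta> L g) k = of_real (\<theta> (of_int k)) * fourier_coeff L g k)"
    unfolding multiplier_def by (rule someI_ex[OF ex])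
  thus "multiplier \<theta> L g \<in> L2_per L"
    "fourier_coeff L (multiplier \<theta> L g) k = of_real (\<theta> (of_int k)) * fourier_coeff L g k" by blast+
qed

subsection \<open>Second order expansions\<close>

text \<open>Along the segment from \<open>u\<close> to \<open>u + h\<close> the functional has the
  first form as its derivative. Differentiability of that form at \<open>u\<close> bounds the
  derivative of the Taylor remainder by \<epsilon> (N h)^2 on the unit interval, and the mean value
  inequality integrates this bound.\<close>

lemma smooth_functional_second_order:
  assumes sm: "smooth_functional X N G"
    and lin: "\<And>g h a b. g \<in> X \<Longrightarrow> h \<in> X \<Longrightarrow> (\<lambda>x. a * g x + b * h x) \<in> X"
    and N0: "\<And>h. N h \<ge> 0" and Ns: "\<And>h a. h \<in> X \<Longrightarrow> N (\<lambda>x. a * h x) = \<bar>a\<bar> * N h"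
    and u: "u \<in> X"
  obtains D1 D2 C where
    "C > 0"
    "\<And>h. h \<in> X \<Longrightarrow> \<bar>D1 h\<bar> \<le> C * N h"
    "\<And>h k. h \<in> X \<Longrightarrow> k \<in> X \<Longrightarrow> \<bar>D2 h k\<bar> \<le> C * N h * N k"
    "\<And>g h a b. g \<in> X \<Longrightarrow> h \<in> X \<Longrightarrow> D1 (\<lambda>x. a * g x + b * h x) = a * D1 g + b * D1 h"
    "\<And>g h k a b. g \<in> X \<Longrightarrow> h \<in> X \<Longrightarrow> k \<in> X \<Longrightarrow> D2 (\<lambda>x. a * g x + b * h x) k = a * D2 g k + b * D2 h k"
    "\<And>g h k a b. g \<in> X \<Longrightarrow> h \<in> X \<Longrightarrow> k \<in> X \<Longrightarrow> D2 k (\<lambda>x. a * g x + b * h x) = a * D2 k g + b * D2 k h"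
    "\<And>\<epsilon>. \<epsilon> > 0 \<Longrightarrow> \<exists>\<delta>>0. \<forall>h\<in>X. N h < \<delta> \<longrightarrow>
       \<bar>G (\<lambda>x. u x + h x) - G u - D1 h - D2 h h / 2\<bar> \<le> \<epsilon> * (N h)\<^sup>2"
proof -
  obtain D where D0': "\<forall>v\<in>X. D 0 v [] = G v"
    and D': "\<forall>n. \<forall>v\<in>X. multilinear_on X n (D n v) \<and>
           (\<exists>C. \<forall>hs. set hs \<subseteq> X \<longrightarrow> length hs = n \<longrightarrow>
              \<bar>D n v hs\<bar> \<le> C * prod_list (map N hs)) \<and>
           (\<forall>\<epsilon>>0. \<exists>\<delta>>0. \<forall>h\<in>X. N h < \<delta> \<longrightarrow>
              (\<forall>hs. set hs \<subseteq> X \<longrightarrow> length hs = n \<longrightarrow>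
                 \<bar>D n (\<lambda>x. v x + h x) hs - D n v hs - D (Suc n) v (h # hs)\<bar>
                   \<le> \<epsilon> * N h * prod_list (map N hs)))"
    using sm[unfolded smooth_functional_def] by (elim exE conjE) (rule that)
  have D0: "D 0 v [] = G v" if "v \<in> X" for v using D0' that by (rule bspec)
  note D'' = D'[THEN spec, THEN bspec]
  note ml = conjunct1[OF D''] and bd = conjunct1[OF conjunct2[OF D'']]
    and df = conjunct2[OF conjunct2[OF D''], THEN spec, THEN mp]
  obtain C1 where C1: "\<And>h. h \<in> X \<Longrightarrow> \<bar>D 1 u [h]\<bar> \<le> C1 * N h"
  proof -
    obtain C where "\<forall>hs. set hs \<subseteq> X \<longrightarrow> length hs = 1 \<longrightarrow> \<bar>D 1 u hs\<bar> \<le> C * prod_list (map N hs)"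
      using bd[OF u] by blast
    from spec[OF this, of "[_]"] show ?thesis by (intro that[of C]) simp
  qed
  obtain C2 where C2: "\<And>h k. h \<in> X \<Longrightarrow> k \<in> X \<Longrightarrow> \<bar>D 2 u [h, k]\<bar> \<le> C2 * N h * N k"
  proof -
    obtain C where "\<forall>hs. set hs \<subseteq> X \<longrightarrow> length hs = 2 \<longrightarrow> \<bar>D 2 u hs\<bar> \<le> C * prod_list (map N hs)"
      using bd[OF u] by blast
    from spec[OF this, of "[_, _]"] show ?thesis by (intro that[of C]) (simp add: mult.assoc)
  qed
  define C where "C = max 1 (max C1 C2)"
  have l1: "D 1 v [\<lambda>x. a * g x + b * h x] = a * D 1 v [g] + b * D 1 v [h]"
    if "v \<in> X" "g \<in> X" "h \<in> X" for v a b g h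
    using ml[OF that(1), of 1] that(2,3) unfolding multilinear_on_def
    by (elim allE[of _ "[]"]) (auto dest!: bspec[of _ _ g] bspec[of _ _ h])
  have l2: "D 2 v [\<lambda>x. a * g x + b * h x, k] = a * D 2 v [g, k] + b * D 2 v [h, k]"
    if "v \<in> X" "g \<in> X" "h \<in> X" "k \<in> X" for v a b g h k
    using ml[OF that(1), of 2, unfolded multilinear_on_def, rule_format, of g h "[]" "[k]" a b] that by simp
  have l3: "D 2 v [k, \<lambda>x. a * g x + b * h x] = a * D 2 v [k, g] + b * D 2 v [k, h]"
    if "v \<in> X" "g \<in> X" "h \<in> X" "k \<in> X" for v a b g h k
    using ml[OF that(1), of 2, unfolded multilinear_on_def, rule_format, of g h "[k]" "[]" a b] that by simp
  have X_add: "(\<lambda>x. v x + t * h x) \<in> X" if "v \<in> X" "h \<in> X" for v h t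
    using lin[OF that, of 1 t] by simp
  have X_mult: "(\<lambda>x. t * h x) \<in> X" if "h \<in> X" for h t
    using lin[OF that that, of t 0] by simp
  have hom1: "D 1 v [\<lambda>x. t * h x] = t * D 1 v [h]" if "v \<in> X" "h \<in> X" for v h t
    using l1[OF that(1,2,2), of t 0] by simp
  have hom2: "D 2 v [\<lambda>x. t * h x, k] = t * D 2 v [h, k]" if "v \<in> X" "h \<in> X" "k \<in> X" for v h k t
    using l2[OF that(1,2,2,3), of t 0] by simp
  have deriv: "((\<lambda>t. G (\<lambda>x. u x + t * h x)) has_real_derivative D 1 (\<lambda>x. u x + t * h x) [h]) (at t)"
    if h: "h \<in> X" for h t
    unfolding has_field_derivative_def has_derivative_at_alt
  proof (intro conjI allI impI)
    let ?v = "\<lambda>x. u x + t * h x"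
    have v: "?v \<in> X" by (rule X_add[OF u h])
    fix e :: real assume e: "e > 0"
    \<comment> \<open>The added 1 keeps \<open>e'\<close> positive when
      \<open>N h = 0\<close>.\<close>
    define e' where "e' = e / (N h + 1)"
    have e': "e' > 0" using e N0[of h] by (simp add: e'_def add_nonneg_pos)
    obtain d where d: "d > 0" "\<And>k. k \<in> X \<Longrightarrow> N k < d \<Longrightarrow>
        \<bar>D 0 (\<lambda>x. ?v x + k x) [] - D 0 ?v [] - D 1 ?v [k]\<bar> \<le> e' * N k"
      using df[OF v e', of 0] by (auto dest!: spec[of _ "[]"])
    show "\<exists>d>0. \<forall>y. norm (y - t) < d \<longrightarrow> norm (G (\<lambda>x. u x + y * h x) - G ?v - D 1 ?v [h] * (y - t)) \<le> e * norm (y - t)"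
    proof (intro exI conjI allI impI)
      show "d / (N h + 1) > 0" using d N0[of h] by (simp add: add_nonneg_pos)
      fix y assume y: "norm (y - t) < d / (N h + 1)"
      let ?k = "\<lambda>x. (y - t) * h x"
      have Nk: "N ?k = \<bar>y - t\<bar> * N h" by (rule Ns[OF h])
      have "\<bar>y - t\<bar> * N h \<le> \<bar>y - t\<bar> * (N h + 1)" by (intro mult_left_mono) auto
      also have "\<dots> < d" using y N0[of h] by (simp add: pos_less_divide_eq add_nonneg_pos)
      finally have "\<bar>D 0 (\<lambda>x. ?v x + ?k x) [] - D 0 ?v [] - D 1 ?v [?k]\<bar> \<le> e' * (\<bar>y - t\<bar> * N h)"
        using d(2)[OF X_mult[OF h, of "y - t"]] unfolding Nk by blast
      moreover have "(\<lambda>x. ?v x + ?k x) = (\<lambda>x. u x + y * h x)" by (auto simp: algebra_simps)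
      moreover have "e' * (\<bar>y - t\<bar> * N h) \<le> e * \<bar>y - t\<bar>"
      proof -
        have "e' * N h \<le> e" using e N0[of h] by (simp add: e'_def field_simps)
        thus ?thesis using mult_right_mono[of "e' * N h" e "\<bar>y - t\<bar>"] by (simp add: mult_ac)
      qed
      ultimately show "norm (G (\<lambda>x. u x + y * h x) - G ?v - D 1 ?v [h] * (y - t)) \<le> e * norm (y - t)"
        unfolding mult.commute[of "D 1 ?v [h]"] hom1[OF v h, symmetric] real_norm_def
          D0[OF v, symmetric] D0[OF X_add[OF u h], symmetric] by simp
    qed
  qed (rule bounded_linear_mult_right)
  show ?thesis
  proof (rule that[of C "\<lambda>h. D 1 u [h]" "\<lambda>h k. D 2 u [h, k]"])
    show "C > 0" by (simp add: C_def)
    show "\<bar>D 1 u [h]\<bar> \<le> C * N h" if "h \<in> X" for h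
      by (rule order_trans[OF C1[OF that]]) (auto simp: C_def intro!: mult_right_mono N0)
    show "\<bar>D 2 u [h, k]\<bar> \<le> C * N h * N k" if "h \<in> X" "k \<in> X" for h k
      by (rule order_trans[OF C2[OF that]]) (auto simp: C_def intro!: mult_right_mono N0)
    fix \<epsilon> :: real assume eps: "\<epsilon> > 0"
    \<comment> \<open>Differentiability of the form of order 1 at \<open>u\<close>; the increment
      \<open>h\<close> becomes the first argument of the second form.\<close>
    obtain d where d: "d > 0" "\<And>h k. h \<in> X \<Longrightarrow> k \<in> X \<Longrightarrow> N h < d \<Longrightarrow>
        \<bar>D 1 (\<lambda>x. u x + h x) [k] - D 1 u [k] - D 2 u [h, k]\<bar> \<le> \<epsilon> * N h * N k"
    proof -
      obtain d where "d > 0" and d: "\<forall>h\<in>X. N h < d \<longrightarrow> (\<forall>hs. set hs \<subseteq> X \<longrightarrow> length hs = 1 \<longrightarrow>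
                 \<bar>D 1 (\<lambda>x. u x + h x) hs - D 1 u hs - D (Suc 1) u (h # hs)\<bar>
                   \<le> \<epsilon> * N h * prod_list (map N hs))"
        using df[OF u eps, of 1] by blast
      thus ?thesis using d[rule_format, of _ "[_]"] by (intro that[of d]) (simp_all add: numeral_2_eq_2)
    qed
    show "\<exists>\<delta>>0. \<forall>h\<in>X. N h < \<delta> \<longrightarrow>
       \<bar>G (\<lambda>x. u x + h x) - G u - D 1 u [h] - D 2 u [h, h] / 2\<bar> \<le> \<epsilon> * (N h)\<^sup>2"
    proof (intro exI[of _ d] conjI ballI impI d(1))
      fix h assume h: "h \<in> X" "N h < d"
      \<comment> \<open>The Taylor remainder along the segment: the quantity to be bounded is
        \<open>?\<psi> 1 - ?\<psi> 0\<close>.\<close>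
      let ?\<psi> = "\<lambda>t. G (\<lambda>x. u x + t * h x) - t * D 1 u [h] - t\<^sup>2 * (D 2 u [h, h] / 2)"
      have der: "(?\<psi> has_real_derivative (D 1 (\<lambda>x. u x + t * h x) [h] - D 1 u [h] - t * D 2 u [h, h])) (at t)" for t
        by (auto intro!: derivative_eq_intros deriv[OF h(1)])
      have bound: "norm (D 1 (\<lambda>x. u x + t * h x) [h] - D 1 u [h] - t * D 2 u [h, h]) \<le> \<epsilon> * (N h)\<^sup>2"
        if t: "t \<in> {0..1}" for t
      proof -
        have le: "N (\<lambda>x. t * h x) \<le> N h"
          using t N0[of h] by (simp add: Ns[OF h(1)] mult_left_le_one_le)
        hence "norm (D 1 (\<lambda>x. u x + t * h x) [h] - D 1 u [h] - t * D 2 u [h, h]) \<le> \<epsilon> * N (\<lambda>x. t * h x) * N h"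
          using d(2)[OF X_mult[OF h(1)] h(1)] h(2) hom2[OF u h(1) h(1)] by simp
        also have "\<dots> \<le> \<epsilon> * N h * N h" using le eps N0 by (intro mult_right_mono mult_left_mono) auto
        finally show ?thesis by (simp add: power2_eq_square mult.assoc)
      qed
      have "norm (?\<psi> 1 - ?\<psi> 0) \<le> \<epsilon> * (N h)\<^sup>2 * norm (1 - 0 :: real)"
      proof (rule field_differentiable_bound[of "{0..1}"])
        show "(?\<psi> has_real_derivative (D 1 (\<lambda>x. u x + t * h x) [h] - D 1 u [h] - t * D 2 u [h, h])) (at t within {0..1})" for t
          by (rule has_field_derivative_at_within[OF der])
      qed (use bound in auto)
      thus "\<bar>G (\<lambda>x. u x + h x) - G u - D 1 u [h] - D 2 u [h, h] / 2\<bar> \<le> \<epsilon> * (N h)\<^sup>2"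
        by (simp add: algebra_simps)
    qed
  qed (use l1 l2 l3 u in blast)+
qed

text \<open>Dividing the bound by t and letting t tend to 0 kills \<open>a\<close>; dividing by t^2
  then kills \<open>b\<close>.\<close>

lemma second_order_coeffs_unique:
  fixes a b :: real
  assumes "\<And>\<epsilon>. \<epsilon> > 0 \<Longrightarrow> \<exists>\<delta>>0. \<forall>t. 0 < t \<longrightarrow> t < \<delta> \<longrightarrow> \<bar>t * a + t\<^sup>2 * b\<bar> \<le> \<epsilon> * t\<^sup>2"
  shows "a = 0" "b = 0"
proof -
  show a: "a = 0"
  proof (rule ccontr)
    assume "a \<noteq> 0"
    obtain d where d: "d > 0" "\<And>t. 0 < t \<Longrightarrow> t < d \<Longrightarrow> \<bar>t * a + t\<^sup>2 * b\<bar> \<le> 1 * t\<^sup>2"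
      using assms[of 1] by auto
    \<comment> \<open>With \<epsilon> = 1 the hypothesis gives |a + t b| \<le> t, hence |a| \<le> t
      (|b| + 1), which fails for this \<open>t\<close>.\<close>
    define t where "t = min (d / 2) (\<bar>a\<bar> / (2 * (\<bar>b\<bar> + 1)))"
    have t: "t > 0" "t < d" "t * (\<bar>b\<bar> + 1) < \<bar>a\<bar>"
    proof -
      show "t > 0" "t < d" using d \<open>a \<noteq> 0\<close> by (auto simp: t_def)
      have "t * (\<bar>b\<bar> + 1) \<le> \<bar>a\<bar> / (2 * (\<bar>b\<bar> + 1)) * (\<bar>b\<bar> + 1)"
        by (intro mult_right_mono) (auto simp: t_def)
      also have "\<dots> = \<bar>a\<bar> / 2" by (simp add: field_simps add_eq_0_iff)
      also have "\<dots> < \<bar>a\<bar>" using \<open>a \<noteq> 0\<close> by simp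
      finally show "t * (\<bar>b\<bar> + 1) < \<bar>a\<bar>" .
    qed
    have "t * \<bar>a + t * b\<bar> \<le> t * t"
    proof -
      have "t * a + t\<^sup>2 * b = t * (a + t * b)" by (simp add: power2_eq_square algebra_simps)
      thus ?thesis using d(2)[OF t(1,2)] t(1) by (simp add: power2_eq_square abs_mult)
    qed
    hence "\<bar>a + t * b\<bar> \<le> t" using t(1) by simp
    hence "\<bar>a\<bar> \<le> t + t * \<bar>b\<bar>" using t(1) abs_triangle_ineq4[of "a + t * b" "t * b"] by (simp add: abs_mult)
    thus False using t(3) by (simp add: algebra_simps)
  qed
  show "b = 0"
  proof (rule ccontr)
    assume "b \<noteq> 0"
    obtain d where d: "d > 0" "\<And>t. 0 < t \<Longrightarrow> t < d \<Longrightarrow> \<bar>t * a + t\<^sup>2 * b\<bar> \<le> \<bar>b\<bar> / 2 * t\<^sup>2"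
      using assms[of "\<bar>b\<bar> / 2"] \<open>b \<noteq> 0\<close> by auto
    show False using d(2)[of "d / 2"] d(1) \<open>b \<noteq> 0\<close> by (simp add: a abs_mult)
  qed
qed

text \<open>The abstract forms are computed on a single ray: their Taylor expansion and an explicit
  one with cubic error describe the same function of t, so the two quadratic polynomials differ by
  o(t^2).\<close>

lemma second_order_identify:
  fixes G N D1 :: "(real \<Rightarrow> real) \<Rightarrow> real"
  assumes tay: "\<And>\<epsilon>. \<epsilon> > 0 \<Longrightarrow> \<exists>\<delta>>0. \<forall>h\<in>X. N h < \<delta> \<longrightarrow>
       \<bar>G (\<lambda>x. u x + h x) - G u - D1 h - D2 h h / 2\<bar> \<le> \<epsilon> * (N h)\<^sup>2"
    and X_mult: "\<And>t. (\<lambda>x. t * h x) \<in> X"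
    and N0: "N h \<ge> 0" and Ns: "\<And>t. N (\<lambda>x. t * h x) = \<bar>t\<bar> * N h"
    and hom1: "\<And>t. D1 (\<lambda>x. t * h x) = t * D1 h"
    and hom2: "\<And>t. D2 (\<lambda>x. t * h x) (\<lambda>x. t * h x) = t\<^sup>2 * D2 h h"
    and ex: "\<And>t. \<bar>t\<bar> \<le> 1 \<Longrightarrow> \<bar>G (\<lambda>x. u x + t * h x) - G u - t * a - t\<^sup>2 * b / 2\<bar> \<le> K * \<bar>t\<bar> ^ 3"
  shows "D1 h = a" "D2 h h = b"
proof -
  have K: "K \<ge> 0" using order_trans[OF abs_ge_zero ex[of 1]] by simp
  have *: "\<exists>\<delta>>0. \<forall>t. 0 < t \<longrightarrow> t < \<delta> \<longrightarrow> \<bar>t * (D1 h - a) + t\<^sup>2 * ((D2 h h - b) / 2)\<bar> \<le> \<epsilon> * t\<^sup>2"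
    if e: "\<epsilon> > 0" for \<epsilon>
  proof -
    define e' where "e' = \<epsilon> / (2 * ((N h)\<^sup>2 + 1))"
    have e': "e' > 0" using e by (simp add: e'_def add_nonneg_pos)
    have e'': "e' * (N h)\<^sup>2 \<le> \<epsilon> / 2"
    proof -
      have "e' * (N h)\<^sup>2 \<le> e' * ((N h)\<^sup>2 + 1)" using e' by simp
      also have "\<dots> = \<epsilon> / 2"
      proof -
        have "\<epsilon> / (2 * w) * w = \<epsilon> / 2" if "w \<noteq> 0" for w using that by simp
        moreover have "(N h)\<^sup>2 + 1 \<noteq> 0" using zero_le_power2[of "N h"] by linarith
        ultimately show ?thesis unfolding e'_def by blast
      qed
      finally show ?thesis .
    qed
    obtain d where d: "d > 0" "\<And>k. k \<in> X \<Longrightarrow> N k < d \<Longrightarrow>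
        \<bar>G (\<lambda>x. u x + k x) - G u - D1 k - D2 k k / 2\<bar> \<le> e' * (N k)\<^sup>2"
      using tay[OF e'] by blast
    \<comment> \<open>The three bounds serve, in this order, the range of \<open>ex\<close>, the
      smallness of \<open>N\<close> on the scaled increment, and
      \<open>K * t \<le> \<epsilon> / 2\<close>.\<close>
    define d' where "d' = min 1 (min (d / (N h + 1)) (\<epsilon> / (2 * (K + 1))))"
    have "d' > 0" using d e K N0 by (simp add: d'_def)
    moreover have "\<bar>t * (D1 h - a) + t\<^sup>2 * ((D2 h h - b) / 2)\<bar> \<le> \<epsilon> * t\<^sup>2" if t: "0 < t" "t < d'" for t
    proof -
      have "t * N h \<le> t * (N h + 1)" using t by (intro mult_left_mono) auto
      also have "\<dots> < d" using t N0 by (simp add: d'_def pos_less_divide_eq)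
      finally have "\<bar>G (\<lambda>x. u x + t * h x) - G u - t * D1 h - t\<^sup>2 * D2 h h / 2\<bar> \<le> e' * (t * N h)\<^sup>2"
        using d(2)[OF X_mult[of t]] t by (simp add: Ns hom1 hom2)
      also have "\<dots> = (e' * (N h)\<^sup>2) * t\<^sup>2" by (simp add: power_mult_distrib mult_ac)
      also have "\<dots> \<le> \<epsilon> / 2 * t\<^sup>2" by (intro mult_right_mono e'') simp
      finally have 1: "\<bar>G (\<lambda>x. u x + t * h x) - G u - t * D1 h - t\<^sup>2 * D2 h h / 2\<bar> \<le> \<epsilon> / 2 * t\<^sup>2" .
      have "K * t \<le> (K + 1) * t" using t by simp
      also have "\<dots> \<le> \<epsilon> / 2" using t K by (simp add: d'_def pos_less_divide_eq field_simps)
      finally have "K * t * t\<^sup>2 \<le> \<epsilon> / 2 * t\<^sup>2" by (intro mult_right_mono) auto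
      hence 2: "\<bar>G (\<lambda>x. u x + t * h x) - G u - t * a - t\<^sup>2 * b / 2\<bar> \<le> \<epsilon> / 2 * t\<^sup>2"
      proof -
        have "K * \<bar>t\<bar> ^ 3 = K * t * t\<^sup>2"
          using t by (simp add: power3_eq_cube power2_eq_square)
        moreover have "\<bar>t\<bar> \<le> 1" using t by (simp add: d'_def)
        ultimately show ?thesis using ex[of t] \<open>K * t * t\<^sup>2 \<le> _\<close> by linarith
      qed
      have "t * (D1 h - a) + t\<^sup>2 * ((D2 h h - b) / 2)
         = (G (\<lambda>x. u x + t * h x) - G u - t * a - t\<^sup>2 * b / 2)
          - (G (\<lambda>x. u x + t * h x) - G u - t * D1 h - t\<^sup>2 * D2 h h / 2)" by (simp add: field_simps)
      thus ?thesis using 1 2 by linarith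
    qed
    ultimately show ?thesis by blast
  qed
  show "D1 h = a" "D2 h h = b" using second_order_coeffs_unique[OF *] by auto
qed

text \<open>With the second derivative of \<open>f\<close> bounded by \<open>B\<close> on [-2R, 2R],
  the mean value inequality is applied to the derivative of \<open>f\<close>, to \<open>f\<close>
  and to \<open>W\<close> in turn; y + s stays in that interval for |y|, |s| \<le> R. No attempt is
  made at the sharp Taylor constant.\<close>

lemma potential_third_order:
  assumes f: "smooth f" and W: "\<And>x. (W has_real_derivative f x) (at x)" and R: "R > 0"
  obtains K where "K \<ge> 0" "\<And>y z. \<bar>y\<bar> \<le> R \<Longrightarrow> \<bar>z\<bar> \<le> R \<Longrightarrow>
    \<bar>W (y + z) - W y - f y * z - deriv f y * z\<^sup>2 / 2\<bar> \<le> K * \<bar>z\<bar> ^ 3"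
proof -
  have f1: "(f has_real_derivative deriv f x) (at x)" for x using smooth_DERIV[OF f, of 0] by simp
  have f2: "(deriv f has_real_derivative deriv (deriv f) x) (at x)" for x
    using smooth_DERIV[OF f, of 1] by simp
  have "continuous_on {- 2 * R..2 * R} (deriv (deriv f))"
    using smooth_continuous[OF f, of _ 2] by (simp add: numeral_2_eq_2)
  then obtain B where B: "\<And>x. x \<in> {- 2 * R..2 * R} \<Longrightarrow> \<bar>deriv (deriv f) x\<bar> \<le> B"
    by (metis bounded_iff compact_Icc compact_continuous_image compact_imp_bounded imageI real_norm_def)
  have B0: "B \<ge> 0" using order_trans[OF abs_ge_zero B[of 0]] R by simp
  show ?thesis
  proof (rule that[OF B0])
    fix y z :: real assume y: "\<bar>y\<bar> \<le> R" and z: "\<bar>z\<bar> \<le> R"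
    let ?S = "{- \<bar>z\<bar>..\<bar>z\<bar>}"
    have S: "convex ?S" "0 \<in> ?S" "z \<in> ?S" by auto
    have 1: "\<bar>deriv f (y + s) - deriv f y\<bar> \<le> B * \<bar>z\<bar>" if s: "s \<in> ?S" for s
    proof -
      have "norm (deriv f (y + s) - deriv f (y + 0)) \<le> B * norm (s - 0)"
      proof (rule field_differentiable_bound[OF S(1) _ _ s S(2), of "\<lambda>s. deriv f (y + s)"])
        show "((\<lambda>s. deriv f (y + s)) has_real_derivative deriv (deriv f) (y + r)) (at r within ?S)" for r
          by (rule has_field_derivative_at_within) (use f2[of "y + r"] in \<open>simp add: DERIV_shift add.commute\<close>)
        show "norm (deriv (deriv f) (y + r)) \<le> B" if "r \<in> ?S" for r
          unfolding real_norm_def by (rule B) (use that y z in auto)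
      qed
      also have "\<dots> \<le> B * \<bar>z\<bar>" using s B0 by (intro mult_left_mono) auto
      finally show ?thesis by simp
    qed
    have 2: "\<bar>f (y + s) - f y - deriv f y * s\<bar> \<le> B * \<bar>z\<bar> * \<bar>z\<bar>" if s: "s \<in> ?S" for s
    proof -
      have "norm ((f (y + s) - deriv f y * s) - (f (y + 0) - deriv f y * 0)) \<le> B * \<bar>z\<bar> * norm (s - 0)"
      proof (rule field_differentiable_bound[OF S(1) _ _ s S(2), of "\<lambda>s. f (y + s) - deriv f y * s"])
        show "((\<lambda>s. f (y + s) - deriv f y * s) has_real_derivative deriv f (y + r) - deriv f y) (at r within ?S)" for r
        proof (rule has_field_derivative_at_within)
          have "((\<lambda>s. f (y + s)) has_real_derivative deriv f (y + r)) (at r)"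
            using f1[of "y + r"] by (simp add: DERIV_shift add.commute)
          thus "((\<lambda>s. f (y + s) - deriv f y * s) has_real_derivative deriv f (y + r) - deriv f y) (at r)"
            by (auto intro!: derivative_eq_intros)
        qed
      qed (use 1 in auto)
      also have "\<dots> \<le> B * \<bar>z\<bar> * \<bar>z\<bar>" using s B0 by (intro mult_left_mono) auto
      finally show ?thesis by simp
    qed
    have "norm ((W (y + z) - f y * z - deriv f y * z\<^sup>2 / 2) - (W (y + 0) - f y * 0 - deriv f y * 0\<^sup>2 / 2))
         \<le> B * \<bar>z\<bar> * \<bar>z\<bar> * norm (z - 0)"
    proof (rule field_differentiable_bound[OF S(1) _ _ S(3,2), of "\<lambda>s. W (y + s) - f y * s - deriv f y * s\<^sup>2 / 2"])
      show "((\<lambda>s. W (y + s) - f y * s - deriv f y * s\<^sup>2 / 2) has_real_derivative f (y + r) - f y - deriv f y * r) (at r within ?S)" for r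
      proof (rule has_field_derivative_at_within)
        have "((\<lambda>s. W (y + s)) has_real_derivative f (y + r)) (at r)"
          using W[of "y + r"] by (simp add: DERIV_shift add.commute)
        thus "((\<lambda>s. W (y + s) - f y * s - deriv f y * s\<^sup>2 / 2) has_real_derivative f (y + r) - f y - deriv f y * r) (at r)"
          by (auto intro!: derivative_eq_intros)
      qed
    qed (use 2 in auto)
    thus "\<bar>W (y + z) - W y - f y * z - deriv f y * z\<^sup>2 / 2\<bar> \<le> B * \<bar>z\<bar> ^ 3"
      by (simp add: power3_eq_cube algebra_simps)
  qed
qed

text \<open>Split v = s p + z with \<open>l p = 1\<close>, \<open>s = l v\<close> and z in the
  kernel of \<open>l\<close>. Coercivity holds for z; the rest is of size s^2 + |s| n z and is
  absorbed by Young's inequality and a large multiple of s^2. Assumption \<open>pert\<close>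
  expresses bounded cross terms without reference to an underlying bilinear form.\<close>

lemma penalty:
  fixes b l n :: "(real \<Rightarrow> real) \<Rightarrow> real"
  assumes lin: "\<And>p q a b. p \<in> X \<Longrightarrow> q \<in> X \<Longrightarrow> (\<lambda>x. a * p x + b * q x) \<in> X"
    and l: "\<And>p q a b. p \<in> X \<Longrightarrow> q \<in> X \<Longrightarrow> l (\<lambda>x. a * p x + b * q x) = a * l p + b * l q"
    and n0: "\<And>p. n p \<ge> 0"
    and n: "\<And>p q a b. p \<in> X \<Longrightarrow> q \<in> X \<Longrightarrow> n (\<lambda>x. a * p x + b * q x) \<le> \<bar>a\<bar> * n p + \<bar>b\<bar> * n q"
    and pert: "\<And>p. p \<in> X \<Longrightarrow> \<exists>C. \<forall>q\<in>X. \<forall>s. b (\<lambda>x. s * p x + 1 * q x) \<ge> b q - C * (s\<^sup>2 + \<bar>s\<bar> * n q)"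
    and coer: "\<exists>c>0. \<forall>q\<in>X. l q = 0 \<longrightarrow> b q \<ge> c * (n q)\<^sup>2"
  shows "\<exists>K\<ge>0. \<exists>c>0. \<forall>q\<in>X. b q + K * (l q)\<^sup>2 \<ge> c * (n q)\<^sup>2"
proof (cases "\<exists>p\<in>X. l p \<noteq> 0")
  case False
  \<comment> \<open>Here \<open>l\<close> vanishes on \<open>X\<close>, so the side condition in
    \<open>coer\<close> always holds.\<close>
  thus ?thesis using coer by (intro exI[of _ 0]) auto
next
  case True
  then obtain p0 where p0: "p0 \<in> X" "l p0 \<noteq> 0" by blast
  define p where "p = (\<lambda>x. (1 / l p0) * p0 x + 0 * p0 x)"
  have p: "p \<in> X" "l p = 1" unfolding p_def by (rule lin[OF p0(1) p0(1)], subst l[OF p0(1) p0(1)]) (use p0(2) in simp)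
  obtain C0 where C0: "\<And>q s. q \<in> X \<Longrightarrow> b (\<lambda>x. s * p x + 1 * q x) \<ge> b q - C0 * (s\<^sup>2 + \<bar>s\<bar> * n q)"
    using pert[OF p(1)] by blast
  obtain c where c: "c > 0" "\<And>q. q \<in> X \<Longrightarrow> l q = 0 \<Longrightarrow> b q \<ge> c * (n q)\<^sup>2" using coer by blast
  define C where "C = max C0 0"
  have C: "C \<ge> 0" "C0 \<le> C" by (auto simp: C_def)
  \<comment> \<open>The three terms pay, in order, for the s^2 part of the perturbation, for Young's
    inequality on its mixed part, and for the share of s p in \<open>n v\<close>.\<close>
  define K where "K = C + C\<^sup>2 / (2 * c) + c / 2 * (n p)\<^sup>2"
  have K: "K \<ge> 0" using C c by (simp add: K_def)
  have "b v + K * (l v)\<^sup>2 \<ge> c / 4 * (n v)\<^sup>2" if v: "v \<in> X" for v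
  proof -
    define s where "s = l v"
    define z where "z = (\<lambda>x. (- s) * p x + 1 * v x)"
    have z: "z \<in> X" unfolding z_def by (rule lin[OF p(1) v])
    have lz: "l z = 0" unfolding z_def by (subst l[OF p(1) v]) (simp add: p s_def)
    have v_eq: "v = (\<lambda>x. s * p x + 1 * z x)" by (auto simp: z_def)
    have nv: "n v \<le> \<bar>s\<bar> * n p + n z" using n[OF p(1) z, of s 1] v_eq by simp
    have 1: "b v \<ge> c * (n z)\<^sup>2 - C * (s\<^sup>2 + \<bar>s\<bar> * n z)"
    proof -
      have "b v \<ge> b z - C0 * (s\<^sup>2 + \<bar>s\<bar> * n z)" using C0[OF z, of s] v_eq by simp
      moreover have "C0 * (s\<^sup>2 + \<bar>s\<bar> * n z) \<le> C * (s\<^sup>2 + \<bar>s\<bar> * n z)"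
        using C(2) n0[of z] by (intro mult_right_mono) auto
      ultimately show ?thesis using c(2)[OF z lz] by linarith
    qed
    have 2: "C * (\<bar>s\<bar> * n z) \<le> C\<^sup>2 / (2 * c) * s\<^sup>2 + c / 2 * (n z)\<^sup>2"
    proof -
      have "0 \<le> (C * \<bar>s\<bar> - c * n z)\<^sup>2 / (2 * c)" using c by simp
      also have "\<dots> = C\<^sup>2 / (2 * c) * s\<^sup>2 + c / 2 * (n z)\<^sup>2 - C * (\<bar>s\<bar> * n z)"
        using c by (simp add: power2_diff power_mult_distrib field_simps) (simp add: power2_eq_square)
      finally show ?thesis by simp
    qed
    have 3: "c / 4 * (n v)\<^sup>2 \<le> c / 2 * (n p)\<^sup>2 * s\<^sup>2 + c / 2 * (n z)\<^sup>2"
    proof -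
      have "(n v)\<^sup>2 \<le> (\<bar>s\<bar> * n p + n z)\<^sup>2" by (intro power_mono nv n0)
      also have "\<dots> \<le> 2 * (\<bar>s\<bar> * n p)\<^sup>2 + 2 * (n z)\<^sup>2"
        using sum_squares_bound[of "\<bar>s\<bar> * n p" "n z"] by (simp add: power2_sum)
      finally have "c / 4 * (n v)\<^sup>2 \<le> c / 4 * (2 * (\<bar>s\<bar> * n p)\<^sup>2 + 2 * (n z)\<^sup>2)"
        using c by (intro mult_left_mono) auto
      thus ?thesis by (simp add: power_mult_distrib algebra_simps)
    qed
    have "K * (l v)\<^sup>2 = C * s\<^sup>2 + C\<^sup>2 / (2 * c) * s\<^sup>2 + c / 2 * (n p)\<^sup>2 * s\<^sup>2"
      by (simp add: K_def s_def distrib_right)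
    moreover have "C * (s\<^sup>2 + \<bar>s\<bar> * n z) = C * s\<^sup>2 + C * (\<bar>s\<bar> * n z)" by (rule distrib_left)
    ultimately show ?thesis using 1 2 3 by linarith
  qed
  thus ?thesis using K c(1) by (intro exI[of _ K] exI[of _ "c / 4"] conjI) auto
qed

subsection \<open>Coercivity\<close>

text \<open>In place of the ambiguous family in \<open>trig\<close> the true coefficients of
  \<open>p\<close> appear, and every large N is allowed, so that two polynomials can be treated over
  a common range of frequencies.\<close>

lemma l2_inner_trig_poly:
  assumes "L > 0" "p \<in> trig_polys L"
  shows "\<exists>N0. (\<forall>k. \<bar>k\<bar> > int N0 \<longrightarrow> fourier_coeff L p k = 0) \<and>
    (\<forall>N\<ge>N0. \<forall>g\<in>L2_per L. l2_inner L g p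
       = L * (\<Sum>k\<in>{- int N..int N}. Re (fourier_coeff L p k * cnj (fourier_coeff L g k))))"
proof -
  from assms(2) obtain N0 c where p: "p = trig L N0 c" by (auto simp: trig_polys_def)
  have pc: "fourier_coeff L p k = (if \<bar>k\<bar> \<le> int N0 then (c k + cnj (c (- k))) / 2 else 0)" for k
    by (simp add: p fourier_coeff_trig assms)
  show ?thesis
  proof (intro exI[of _ N0] conjI allI impI ballI)
    show "fourier_coeff L p k = 0" if "\<bar>k\<bar> > int N0" for k using that by (simp add: pc)
    fix N g assume N: "N \<ge> N0" and g: "g \<in> L2_per L"
    let ?I = "{- int N0..int N0}"
    let ?G = "fourier_coeff L g"
    \<comment> \<open>As \<open>g\<close> is real, the reflection of \<open>k\<close> to
      \<open>- k\<close> turns the conjugate half of the symmetrized coefficient into the other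
      half.\<close>
    have refl: "(\<Sum>k\<in>?I. Re (cnj (c (- k)) * cnj (?G k))) = (\<Sum>k\<in>?I. Re (c k * cnj (?G k)))"
      by (rule sum.reindex_bij_witness[of _ uminus uminus])
         (auto simp: fourier_coeff_neg simp flip: complex_cnj_mult)
    have "(\<Sum>k\<in>{- int N..int N}. Re (fourier_coeff L p k * cnj (?G k)))
        = (\<Sum>k\<in>?I. Re ((c k + cnj (c (- k))) / 2 * cnj (?G k)))"
      by (rule sum.mono_neutral_cong_right) (use N in \<open>auto simp: pc abs_le_iff\<close>)
    also have "\<dots> = (\<Sum>k\<in>?I. Re (c k * cnj (?G k)) / 2 + Re (cnj (c (- k)) * cnj (?G k)) / 2)"
      by (rule sum.cong) (auto simp: algebra_simps add_divide_distrib diff_divide_distrib)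
    also have "\<dots> = (\<Sum>k\<in>?I. Re (c k * cnj (?G k)))"
      unfolding sum.distrib sum_divide_distrib[symmetric] refl by simp
    finally show "l2_inner L g p = L * (\<Sum>k\<in>{- int N..int N}. Re (fourier_coeff L p k * cnj (?G k)))"
      unfolding p l2_inner_trig[OF assms(1) g] by (simp add: p)
  qed
qed

lemma trig_poly_in_Cinf: "L > 0 \<Longrightarrow> p \<in> trig_polys L \<Longrightarrow> p \<in> Cinf_per L"
  by (auto simp: trig_polys_def trig_in_Cinf_per)

text \<open>Since \<theta> is real, the two finite sums agree term by term once both polynomials are
  written over the same frequencies.\<close>

lemma multiplier_inner_commute:
  assumes "L > 0" "admissible_symbol \<theta> m" "p \<in> trig_polys L" "q \<in> trig_polys L"
  shows "l2_inner L (multiplier \<theta> L p) q = l2_inner L (multiplier \<theta> L q) p"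
proof -
  note M = multiplier_Cinf[OF assms(1,2) trig_poly_in_Cinf[OF assms(1)]]
  have sw: "Re (a * cnj (of_real r * b)) = Re (b * cnj (of_real r * a))" for a b r
    unfolding times_complex.sel cnj.sel by (simp add: algebra_simps)
  obtain N1 where N1: "\<forall>N\<ge>N1. \<forall>g\<in>L2_per L. l2_inner L g p
       = L * (\<Sum>k\<in>{- int N..int N}. Re (fourier_coeff L p k * cnj (fourier_coeff L g k)))"
    using l2_inner_trig_poly[OF assms(1,3)] by blast
  obtain N2 where N2: "\<forall>N\<ge>N2. \<forall>g\<in>L2_per L. l2_inner L g q
       = L * (\<Sum>k\<in>{- int N..int N}. Re (fourier_coeff L q k * cnj (fourier_coeff L g k)))"
    using l2_inner_trig_poly[OF assms(1,4)] by blast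
  show ?thesis
    unfolding N1[THEN spec, of "max N1 N2", THEN mp, OF max.cobounded1, THEN bspec, OF M(1)[OF assms(4)]]
      N2[THEN spec, of "max N1 N2", THEN mp, OF max.cobounded2, THEN bspec, OF M(1)[OF assms(3)]]
      M(2)[OF assms(3)] M(2)[OF assms(4)]
    by (intro arg_cong[where f = "(*) L"] sum.cong refl sw)
qed

text \<open>Adding t p alters only finitely many coefficients, so the two infinite sums differ by
  the finite sum of \<open>?d\<close>; summability for \<open>g\<close> justifies the splitting. The
  expansion is exact in t.\<close>

lemma mult_form_expand:
  assumes "L > 0" "admissible_symbol \<theta> m" "g \<in> Cinf_per L" "p \<in> trig_polys L"
    and sm: "(\<lambda>k::int. \<theta> (of_int k) * (cmod (fourier_coeff L g k))\<^sup>2) summable_on UNIV"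
  shows "mult_form \<theta> L (\<lambda>x. g x + t * p x) = mult_form \<theta> L g
    + t * (2 * l2_inner L (multiplier \<theta> L g) p) + t\<^sup>2 * l2_inner L (multiplier \<theta> L p) p"
proof -
  obtain N where N0: "\<forall>k. \<bar>k\<bar> > int N \<longrightarrow> fourier_coeff L p k = 0"
    "\<forall>M\<ge>N. \<forall>g\<in>L2_per L. l2_inner L g p
       = L * (\<Sum>k\<in>{- int M..int M}. Re (fourier_coeff L p k * cnj (fourier_coeff L g k)))"
    using l2_inner_trig_poly[OF assms(1,4)] by blast
  note N = N0(1)[THEN spec, THEN mp] N0(2)[THEN spec, THEN mp, OF order_refl, THEN bspec]
  note p = trig_poly_in_Cinf[OF assms(1,4)]
  let ?I = "{- int N..int N}"
  let ?p = "fourier_coeff L p" and ?g = "fourier_coeff L g"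
  let ?d = "\<lambda>k::int. \<theta> (of_int k) * (2 * t * Re (?p k * cnj (?g k)) + t\<^sup>2 * (cmod (?p k))\<^sup>2)"
  have co: "fourier_coeff L (\<lambda>x. g x + t * p x) k = ?g k + of_real t * ?p k" for k
    using fourier_coeff_lincomb[OF Cinf_in_L2_per[OF assms(3)] Cinf_in_L2_per[OF p], of 1 t] by simp
  have sq: "(cmod (a + of_real t * b))\<^sup>2 = (cmod a)\<^sup>2 + (2 * t * Re (b * cnj a) + t\<^sup>2 * (cmod b)\<^sup>2)" for a b
    unfolding cmod_power2 by (simp add: power2_eq_square algebra_simps)
  have d0: "?d k = 0" if "k \<notin> ?I" for k
  proof -
    have "?p k = 0" by (rule N(1)) (use that in auto)
    thus ?thesis by simp
  qed
  have dsum: "(?d has_sum sum ?d ?I) UNIV"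
    by (rule has_sum_cong_neutral[THEN iffD1, OF _ _ _ has_sum_finite[of ?I]]) (use d0 in auto)
  have "(\<Sum>\<^sub>\<infinity>k::int. \<theta> (of_int k) * (cmod (?g k + of_real t * ?p k))\<^sup>2)
      = (\<Sum>\<^sub>\<infinity>k::int. \<theta> (of_int k) * (cmod (?g k))\<^sup>2 + ?d k)"
    unfolding sq by (simp only: distrib_left)
  also have "\<dots> = (\<Sum>\<^sub>\<infinity>k::int. \<theta> (of_int k) * (cmod (?g k))\<^sup>2) + sum ?d ?I"
    using infsum_add[OF sm has_sum_imp_summable[OF dsum]] infsumI[OF dsum] by simp
  also have "sum ?d ?I = 2 * t * (\<Sum>k\<in>?I. \<theta> (of_int k) * Re (?p k * cnj (?g k)))
      + t\<^sup>2 * (\<Sum>k\<in>?I. \<theta> (of_int k) * (cmod (?p k))\<^sup>2)"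
    by (simp add: sum_distrib_left sum.distrib distrib_left mult_ac)
  finally have 1: "mult_form \<theta> L (\<lambda>x. g x + t * p x) = mult_form \<theta> L g
     + t * (2 * (L * (\<Sum>k\<in>?I. \<theta> (of_int k) * Re (?p k * cnj (?g k)))))
     + t\<^sup>2 * (L * (\<Sum>k\<in>?I. \<theta> (of_int k) * (cmod (?p k))\<^sup>2))"
    unfolding mult_form_def co by (simp add: algebra_simps)
  have 2: "l2_inner L (multiplier \<theta> L g) p = L * (\<Sum>k\<in>?I. \<theta> (of_int k) * Re (?p k * cnj (?g k)))"
    unfolding N(2)[OF multiplier_Cinf(1)[OF assms(1-3)]] multiplier_Cinf(2)[OF assms(1-3)]
    by (intro arg_cong[where f = "(*) L"] sum.cong refl) (simp add: algebra_simps)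
  have 3: "l2_inner L (multiplier \<theta> L p) p = L * (\<Sum>k\<in>?I. \<theta> (of_int k) * (cmod (?p k))\<^sup>2)"
    unfolding N(2)[OF multiplier_Cinf(1)[OF assms(1,2) p]] multiplier_Cinf(2)[OF assms(1,2) p]
    by (intro arg_cong[where f = "(*) L"] sum.cong refl)
       (simp add: cmod_power2, simp add: power2_eq_square algebra_simps)
  show ?thesis unfolding 1 2 3 ..
qed

lemma Cinf_per_compose_L2:
  assumes "\<phi> \<in> Cinf_per L" "continuous_on UNIV F"
  shows "(\<lambda>x. F (\<phi> x)) \<in> L2_per L"
  by (rule continuous_in_L2_per)
     (use Cinf_perD(1)[OF assms(1)] continuous_on_compose2[OF assms(2) Cinf_perD(4)[OF assms(1)]]
       in \<open>auto simp: periodic_def\<close>)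

text \<open>Both \<phi> and \<open>p\<close> are bounded, so the pointwise cubic bound holds
  uniformly in x for |t| \<le> 1; integrating it over the period contributes the factor L.\<close>

lemma potential_expand:
  assumes L: "L > 0" and f: "smooth f" and W: "\<And>x. (W has_real_derivative f x) (at x)"
    and \<phi>: "\<phi> \<in> Cinf_per L" and p: "p \<in> Cinf_per L"
  obtains K where "\<And>t. \<bar>t\<bar> \<le> 1 \<Longrightarrow>
    \<bar>(LINT x|period_measure L. W (\<phi> x + t * p x)) - (LINT x|period_measure L. W (\<phi> x))
      - t * l2_inner L (\<lambda>x. f (\<phi> x)) p - t\<^sup>2 / 2 * l2_inner L (\<lambda>x. deriv f (\<phi> x) * p x) p\<bar> \<le> K * \<bar>t\<bar> ^ 3"
proof -
  interpret finite_measure "period_measure L" by (rule finite_measure_period)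
  obtain R1 where R1: "R1 > 0" "\<And>x. \<bar>\<phi> x\<bar> \<le> R1"
    using periodic_bounded[OF L Cinf_perD(1)[OF \<phi>] Cinf_perD(4)[OF \<phi>]] by blast
  obtain R2 where R2: "R2 > 0" "\<And>x. \<bar>p x\<bar> \<le> R2"
    using periodic_bounded[OF L Cinf_perD(1)[OF p] Cinf_perD(4)[OF p]] by blast
  define R where "R = max R1 R2"
  obtain K where K: "K \<ge> 0" "\<And>y z. \<bar>y\<bar> \<le> R \<Longrightarrow> \<bar>z\<bar> \<le> R \<Longrightarrow>
    \<bar>W (y + z) - W y - f y * z - deriv f y * z\<^sup>2 / 2\<bar> \<le> K * \<bar>z\<bar> ^ 3"
  proof -
    have "R > 0" using R1(1) by (simp add: R_def)
    from potential_third_order[OF f W this] show ?thesis using that by blast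
  qed
  have cW: "continuous_on UNIV W" using W by (meson DERIV_continuous_on has_field_derivative_at_within)
  have cf: "continuous_on UNIV f" "continuous_on UNIV (deriv f)"
    using smooth_continuous[OF f, of UNIV 0] smooth_continuous[OF f, of UNIV 1] by simp_all
  note c\<phi> = Cinf_perD(4)[OF \<phi>] and cp = Cinf_perD(4)[OF p]
  note [continuous_intros] = c\<phi> cp continuous_on_compose2[OF cW, of UNIV]
    continuous_on_compose2[OF cf(1), of UNIV] continuous_on_compose2[OF cf(2), of UNIV]
  show ?thesis
  proof (rule that[of "K * R ^ 3 * L"])
    fix t :: real assume t: "\<bar>t\<bar> \<le> 1"
    have i1: "integrable (period_measure L) (\<lambda>x. W (\<phi> x + t * p x))"
      and i2: "integrable (period_measure L) (\<lambda>x. W (\<phi> x))"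
      and i3: "integrable (period_measure L) (\<lambda>x. f (\<phi> x) * p x)"
      and i4: "integrable (period_measure L) (\<lambda>x. deriv f (\<phi> x) * p x * p x)"
      by (intro integrable_period_continuous continuous_intros; simp)+
    let ?r = "\<lambda>x. W (\<phi> x + t * p x) - W (\<phi> x) - t * (f (\<phi> x) * p x) - t\<^sup>2 / 2 * (deriv f (\<phi> x) * p x * p x)"
    have eq: "(LINT x|period_measure L. W (\<phi> x + t * p x)) - (LINT x|period_measure L. W (\<phi> x))
      - t * l2_inner L (\<lambda>x. f (\<phi> x)) p - t\<^sup>2 / 2 * l2_inner L (\<lambda>x. deriv f (\<phi> x) * p x) p
      = (LINT x|period_measure L. ?r x)"
      unfolding l2_inner_eq using i1 i2 i3 i4 by simp
    have "\<bar>LINT x|period_measure L. ?r x\<bar> \<le> (LINT x|period_measure L. K * (\<bar>t\<bar> * R) ^ 3)"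
    proof (rule order_trans[OF integral_abs_bound integral_mono])
      show "integrable (period_measure L) (\<lambda>x. \<bar>?r x\<bar>)"
        by (intro integrable_abs Bochner_Integration.integrable_diff integrable_mult_right i1 i2 i3 i4)
      fix x
      have p: "\<bar>p x\<bar> \<le> R" using R2(2)[of x] by (simp add: R_def)
      have "\<bar>t * p x\<bar> \<le> \<bar>t\<bar> * R" using p by (simp add: abs_mult mult_left_mono)
      moreover have "\<bar>t\<bar> * R \<le> R" using t R1(1) by (intro mult_left_le_one_le) (auto simp: R_def)
      ultimately have tp: "\<bar>t * p x\<bar> \<le> \<bar>t\<bar> * R" "\<bar>t * p x\<bar> \<le> R" by auto
      have "\<bar>?r x\<bar> \<le> K * \<bar>t * p x\<bar> ^ 3"
        using K(2)[of "\<phi> x" "t * p x"] R1(2)[of x] tp(2)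
        by (simp add: R_def power_mult_distrib power2_eq_square algebra_simps)
      also have "\<dots> \<le> K * (\<bar>t\<bar> * R) ^ 3" by (intro mult_left_mono power_mono tp K(1)) auto
      finally show "\<bar>?r x\<bar> \<le> K * (\<bar>t\<bar> * R) ^ 3" .
    qed simp
    also have "\<dots> = K * R ^ 3 * L * \<bar>t\<bar> ^ 3"
      using L by (simp add: measure_restrict_space space_restrict_space power_mult_distrib)
    finally show "\<bar>(LINT x|period_measure L. W (\<phi> x + t * p x)) - (LINT x|period_measure L. W (\<phi> x))
      - t * l2_inner L (\<lambda>x. f (\<phi> x)) p - t\<^sup>2 / 2 * l2_inner L (\<lambda>x. deriv f (\<phi> x) * p x) p\<bar>
      \<le> K * R ^ 3 * L * \<bar>t\<bar> ^ 3" unfolding eq .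
  qed
qed

section \<open>The linearized operator at the wave and its coercivity\<close>

locale periodic_wave =
  fixes L m \<omega> A \<mu> \<nu> :: real and \<theta> f W \<phi> :: "real \<Rightarrow> real"
  assumes L_pos: "L > 0" and smooth_f: "smooth f"
    and W_deriv: "\<And>x. (W has_real_derivative f x) (at x)"
    and symbol: "admissible_symbol \<theta> m"
    and functionals: "functionals_smooth \<theta> W L m"
    and wave: "traveling_wave \<theta> f \<omega> A L \<phi>"
    and Garding: "\<exists>c1>0. \<exists>c2>0. \<forall>v\<in>Cinf_per L. l2_inner L (linearized_op \<theta> f \<omega> L \<phi> v) v
          \<ge> c1 * (H_norm L (m / 2) v)\<^sup>2 - c2 * (l2_norm L v)\<^sup>2"
    and coercive: "\<exists>c3>0. \<forall>v\<in>H_per L m. l2_inner L v (deriv \<phi>) = 0 \<longrightarrow>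
          l2_inner L v (\<lambda>x. \<mu> + \<nu> * \<phi> x) = 0 \<longrightarrow>
          l2_inner L (linearized_op \<theta> f \<omega> L \<phi> v) v \<ge> c3 * (l2_norm L v)\<^sup>2"
begin

abbreviation "X \<equiv> H_per L (m / 2)"
abbreviation "nrm \<equiv> H_norm L (m / 2)"
abbreviation "inner2 \<equiv> l2_inner L"
abbreviation "Lop \<equiv> linearized_op \<theta> f \<omega> L \<phi>"
abbreviation "Q' \<equiv> (\<lambda>x. \<mu> + \<nu> * \<phi> x)"

lemma m_pos: "m > 0" using symbol by (simp add: admissible_symbol_def)

lemma phi_Cinf: "\<phi> \<in> Cinf_per L" using wave by (simp add: traveling_wave_def)

lemma phi_in_X: "\<phi> \<in> X" by (rule Cinf_in_H_per[OF L_pos phi_Cinf])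

lemma phi_L2: "\<phi> \<in> L2_per L" by (rule Cinf_in_L2_per[OF phi_Cinf])

lemma dphi_L2: "deriv \<phi> \<in> L2_per L" by (intro Cinf_in_L2_per Cinf_per_deriv phi_Cinf)

lemma Q'_L2: "Q' \<in> L2_per L"
  using L2_per_lincomb[OF const_in_L2_per[of 1] phi_L2, of \<mu> \<nu>] by simp

lemma X_L2: "h \<in> X \<Longrightarrow> h \<in> L2_per L" by (rule H_perD)

lemma trig_in_X: "p \<in> trig_polys L \<Longrightarrow> p \<in> X" by (rule trig_in_H_per[OF L_pos])

lemma trig_L2: "p \<in> trig_polys L \<Longrightarrow> p \<in> L2_per L" using trig_in_X X_L2 by blast

lemma X_mult: "h \<in> X \<Longrightarrow> (\<lambda>x. t * h x) \<in> X" by (rule H_per_cmult[OF L_pos])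

lemma nrm_nonneg: "nrm h \<ge> 0" by (rule H_norm_nonneg[OF L_pos])

lemma nrm_mult: "h \<in> X \<Longrightarrow> nrm (\<lambda>x. t * h x) = \<bar>t\<bar> * nrm h" by (rule H_norm_cmult[OF L_pos])

lemma F_fun_eq: "F_fun L u = inner2 u u / 2"
  by (simp add: F_fun_def l2_inner_def power2_eq_square)

lemma M_fun_eq: "M_fun L u = inner2 (\<lambda>x. 1) u"
  by (simp add: M_fun_def l2_inner_def)

lemma F_fun_add:
  assumes "u \<in> L2_per L" "h \<in> L2_per L"
  shows "F_fun L (\<lambda>x. u x + t * h x) = F_fun L u + t * inner2 u h + t\<^sup>2 * inner2 h h / 2"
  using l2_inner_lincomb_self[OF assms, of 1 t] by (simp add: F_fun_eq algebra_simps)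

lemma M_fun_add:
  assumes "u \<in> L2_per L" "h \<in> L2_per L"
  shows "M_fun L (\<lambda>x. u x + h x) = M_fun L u + inner2 (\<lambda>x. 1) h"
  using l2_inner_lincomb_right[OF assms const_in_L2_per, of 1 1 1] by (simp add: M_fun_eq)

text \<open>The embedding into $L^2$ comes for free: the second derivative of \<open>F_fun\<close> is the square of
  the $L^2$ norm, and it is bounded since \<open>F_fun\<close> is a smooth functional.\<close>

lemma l2_norm_le_nrm: "\<exists>C>0. \<forall>h\<in>X. l2_norm L h \<le> C * nrm h"
proof -
  have sm: "smooth_functional X nrm (F_fun L)" using functionals by (simp add: functionals_smooth_def)
  obtain D1 D2 C where C: "C > 0"
    and D2: "\<And>h k. h \<in> X \<Longrightarrow> k \<in> X \<Longrightarrow> \<bar>D2 h k\<bar> \<le> C * nrm h * nrm k"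
    and l1: "\<And>g h a b. g \<in> X \<Longrightarrow> h \<in> X \<Longrightarrow> D1 (\<lambda>x. a * g x + b * h x) = a * D1 g + b * D1 h"
    and l2: "\<And>g h k a b. g \<in> X \<Longrightarrow> h \<in> X \<Longrightarrow> k \<in> X \<Longrightarrow> D2 (\<lambda>x. a * g x + b * h x) k = a * D2 g k + b * D2 h k"
    and l3: "\<And>g h k a b. g \<in> X \<Longrightarrow> h \<in> X \<Longrightarrow> k \<in> X \<Longrightarrow> D2 k (\<lambda>x. a * g x + b * h x) = a * D2 k g + b * D2 k h"
    and tay: "\<And>\<epsilon>. \<epsilon> > 0 \<Longrightarrow> \<exists>\<delta>>0. \<forall>h\<in>X. nrm h < \<delta> \<longrightarrow>
       \<bar>F_fun L (\<lambda>x. \<phi> x + h x) - F_fun L \<phi> - D1 h - D2 h h / 2\<bar> \<le> \<epsilon> * (nrm h)\<^sup>2"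
    by (rule smooth_functional_second_order[OF sm H_per_lincomb[OF L_pos] nrm_nonneg nrm_mult phi_in_X]) blast+
  have "l2_norm L h \<le> sqrt C * nrm h" if h: "h \<in> X" for h
  proof -
    have "D2 h h = inner2 h h"
    proof (rule second_order_identify(2)[where X = X and N = nrm and h = h and a = "inner2 \<phi> h" and K = 0
          and G = "F_fun L" and u = \<phi> and ?D1.0 = D1 and ?D2.0 = D2])
      show "D1 (\<lambda>x. t * h x) = t * D1 h" for t using l1[OF h h, of t 0] by simp
      show "D2 (\<lambda>x. t * h x) (\<lambda>x. t * h x) = t\<^sup>2 * D2 h h" for t
        using l2[OF h h X_mult[OF h], of t 0 t] l3[OF h h h, of t 0] by (simp add: power2_eq_square)
    qed (use h X_mult nrm_nonneg nrm_mult F_fun_add[OF phi_L2 X_L2[OF h]] tay in auto)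
    hence "inner2 h h \<le> C * (nrm h)\<^sup>2" using D2[OF h h] by (simp add: power2_eq_square mult.assoc)
    hence "(l2_norm L h)\<^sup>2 \<le> (sqrt C * nrm h)\<^sup>2" using C by (simp add: l2_norm_sq power_mult_distrib)
    thus ?thesis by (rule power2_le_imp_le) (use C nrm_nonneg in simp)
  qed
  thus ?thesis using C by (intro exI[of _ "sqrt C"]) auto
qed

lemma trunc_inner_tendsto:
  assumes h: "h \<in> X" and g: "g \<in> L2_per L"
  shows "(\<lambda>N. inner2 (trunc L h N) g) \<longlonglongrightarrow> inner2 h g"
proof -
  obtain C where C: "C > 0" "\<And>h. h \<in> X \<Longrightarrow> l2_norm L h \<le> C * nrm h" using l2_norm_le_nrm by blast
  note tr = trig_in_X[OF trunc_in_trig_polys]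
  have "(\<lambda>N. nrm (\<lambda>x. h x - trunc L h N x) * (C * l2_norm L g)) \<longlonglongrightarrow> 0"
    using trunc_tendsto[OF L_pos h] by (rule tendsto_mult_left_zero)
  hence "(\<lambda>N. inner2 h g - inner2 (trunc L h N) g) \<longlonglongrightarrow> 0"
  proof (rule Lim_null_comparison[rotated], intro always_eventually allI)
    fix N
    have "inner2 h g - inner2 (trunc L h N) g = inner2 (\<lambda>x. h x - trunc L h N x) g"
      using l2_inner_lincomb_left[OF X_L2[OF h] X_L2[OF tr] g, of 1 "-1"] by simp
    also have "\<bar>\<dots>\<bar> \<le> l2_norm L (\<lambda>x. h x - trunc L h N x) * l2_norm L g"
      by (rule l2_Cauchy_Schwarz[OF X_L2[OF H_per_diff[OF L_pos h tr]] g])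
    also have "\<dots> \<le> (C * nrm (\<lambda>x. h x - trunc L h N x)) * l2_norm L g"
      by (intro mult_right_mono C(2) H_per_diff L_pos h tr l2_norm_nonneg)
    finally show "norm (inner2 h g - inner2 (trunc L h N) g) \<le> nrm (\<lambda>x. h x - trunc L h N x) * (C * l2_norm L g)"
      by (simp add: mult_ac)
  qed
  from tendsto_diff[OF tendsto_const[of "inner2 h g"] this] show ?thesis by simp
qed

lemma trunc_nrm_tendsto:
  assumes h: "h \<in> X"
  shows "(\<lambda>N. nrm (trunc L h N)) \<longlonglongrightarrow> nrm h"
proof -
  have "(\<lambda>N. nrm (trunc L h N) - nrm h) \<longlonglongrightarrow> 0"
  proof (rule Lim_null_comparison[OF always_eventually trunc_tendsto[OF L_pos h]], rule allI)
    fix N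
    let ?t = "trunc L h N"
    have tr: "?t \<in> X" by (intro trig_in_X trunc_in_trig_polys)
    have d: "(\<lambda>x. h x - ?t x) \<in> X" by (rule H_per_diff[OF L_pos h tr])
    have "nrm h \<le> nrm (\<lambda>x. h x - ?t x) + nrm ?t"
      using H_norm_triangle[OF L_pos d tr] by simp
    moreover have "nrm ?t \<le> nrm h + nrm (\<lambda>x. h x - ?t x)"
      using H_norm_diff_le[OF L_pos h d] by simp
    ultimately show "norm (nrm ?t - nrm h) \<le> nrm (\<lambda>x. h x - ?t x)" by simp
  qed
  from tendsto_add[OF this tendsto_const[of "nrm h"]] show ?thesis by simp
qed

definition energy :: "(real \<Rightarrow> real) \<Rightarrow> real" where
  "energy u = P_fun \<theta> W L u + \<omega> * F_fun L u + A * M_fun L u"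

lemma continuous_f: "continuous_on UNIV f" "continuous_on UNIV (deriv f)"
  using smooth_continuous[OF smooth_f, of UNIV 0] smooth_continuous[OF smooth_f, of UNIV 1] by simp_all

lemma potential_L2:
  assumes "p \<in> Cinf_per L"
  shows "(\<lambda>x. deriv f (\<phi> x) * p x) \<in> L2_per L"
  by (rule continuous_in_L2_per)
     (use Cinf_perD(1)[OF assms] Cinf_perD(1)[OF phi_Cinf] in
       \<open>auto simp: periodic_def intro!: continuous_intros Cinf_perD(4)[OF assms]
         continuous_on_compose2[OF continuous_f(2) Cinf_perD(4)[OF phi_Cinf]]\<close>)

lemma Lop_L2:
  assumes "p \<in> Cinf_per L"
  shows "Lop p \<in> L2_per L"
proof -
  note M = multiplier_Cinf(1)[OF L_pos symbol assms]
  have "(\<lambda>x. 1 * (1 * multiplier \<theta> L p x + \<omega> * p x) + (-1) * (deriv f (\<phi> x) * p x)) \<in> L2_per L"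
    by (intro L2_per_lincomb M Cinf_in_L2_per assms potential_L2)
  thus ?thesis by (simp add: linearized_op_def[abs_def])
qed

lemma inner2_Lop:
  assumes p: "p \<in> Cinf_per L" and q: "q \<in> L2_per L"
  shows "inner2 (Lop p) q = inner2 (multiplier \<theta> L p) q + \<omega> * inner2 p q - inner2 (\<lambda>x. deriv f (\<phi> x) * p x) q"
proof -
  note M = multiplier_Cinf(1)[OF L_pos symbol p]
  have "inner2 (\<lambda>x. 1 * (1 * multiplier \<theta> L p x + \<omega> * p x) + (-1) * (deriv f (\<phi> x) * p x)) q
    = 1 * (1 * inner2 (multiplier \<theta> L p) q + \<omega> * inner2 p q) + (-1) * inner2 (\<lambda>x. deriv f (\<phi> x) * p x) q"
    by (subst l2_inner_lincomb_left l2_inner_lincomb_left;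
        (intro L2_per_lincomb M Cinf_in_L2_per p potential_L2 q)?)+ simp
  thus ?thesis by (simp add: linearized_op_def[abs_def])
qed

lemma inner2_Lop_commute:
  assumes "p \<in> trig_polys L" "q \<in> trig_polys L"
  shows "inner2 (Lop p) q = inner2 (Lop q) p"
proof -
  have "inner2 (\<lambda>x. deriv f (\<phi> x) * p x) q = inner2 (\<lambda>x. deriv f (\<phi> x) * q x) p"
    by (simp add: l2_inner_eq mult_ac)
  thus ?thesis
    using multiplier_inner_commute[OF L_pos symbol assms]
    by (simp add: inner2_Lop trig_poly_in_Cinf[OF L_pos] trig_L2 assms l2_inner_commute[of L p q])
qed

lemma inner2_Lop_lincomb:
  assumes p: "p \<in> trig_polys L" and q: "q \<in> trig_polys L"
  shows "inner2 (Lop (\<lambda>x. s * p x + 1 * q x)) (\<lambda>x. s * p x + 1 * q x)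
       = s\<^sup>2 * inner2 (Lop p) p + 2 * s * inner2 (Lop p) q + inner2 (Lop q) q"
proof -
  let ?v = "\<lambda>x. s * p x + 1 * q x"
  have v: "?v \<in> trig_polys L" by (rule trig_polys_lincomb[OF p q])
  have r: "inner2 (Lop u) ?v = s * inner2 (Lop u) p + 1 * inner2 (Lop u) q" if "u \<in> trig_polys L" for u
    by (rule l2_inner_lincomb_right[OF trig_L2[OF p] trig_L2[OF q] Lop_L2[OF trig_poly_in_Cinf[OF L_pos that]]])
  show ?thesis
    unfolding r[OF v] inner2_Lop_commute[OF v p] inner2_Lop_commute[OF v q] r[OF p] r[OF q]
      inner2_Lop_commute[OF q p] by (simp add: power2_eq_square algebra_simps)
qed

text \<open>Each use of \<open>penalty\<close> removes one constraint: first that of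
  \<open>Q'\<close> inside the subspace orthogonal to \<open>deriv \<phi>\<close>, where the
  coercivity hypothesis applies, then that of \<open>deriv \<phi>\<close> on all trigonometric
  polynomials, with the first penalty already part of the form.\<close>

lemma trig_coercive:
  "\<exists>K1\<ge>0. \<exists>K2\<ge>0. \<exists>c>0. \<forall>p\<in>trig_polys L.
     inner2 (Lop p) p + K2 * (inner2 p Q')\<^sup>2 + K1 * (inner2 p (deriv \<phi>))\<^sup>2 \<ge> c * (nrm p)\<^sup>2"
proof -
  let ?T = "trig_polys L"
  let ?Y = "{p \<in> ?T. inner2 p (deriv \<phi>) = 0}"
  have lin: "inner2 (\<lambda>x. a * p x + b * q x) g = a * inner2 p g + b * inner2 q g"
    if "p \<in> ?T" "q \<in> ?T" "g \<in> L2_per L" for p q g a b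
    using that by (intro l2_inner_lincomb_left) (auto intro: trig_L2)
  have n: "l2_norm L (\<lambda>x. a * p x + b * q x) \<le> \<bar>a\<bar> * l2_norm L p + \<bar>b\<bar> * l2_norm L q"
    if "p \<in> ?T" "q \<in> ?T" for p q a b using that by (intro l2_norm_lincomb_le) (auto intro: trig_L2)
  \<comment> \<open>The parameter \<open>K\<close> covers both applications: 0 for the bare form,
    \<open>K2\<close> for the form with the first penalty.\<close>
  have pert: "\<exists>C. \<forall>q\<in>?T. \<forall>s. inner2 (Lop (\<lambda>x. s * p x + 1 * q x)) (\<lambda>x. s * p x + 1 * q x)
        + K * (inner2 (\<lambda>x. s * p x + 1 * q x) Q')\<^sup>2
     \<ge> inner2 (Lop q) q + K * (inner2 q Q')\<^sup>2 - C * (s\<^sup>2 + \<bar>s\<bar> * l2_norm L q)"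
    if p: "p \<in> ?T" and K: "K \<ge> 0" for p K
  proof -
    \<comment> \<open>The polarization of the form against \<open>p\<close>. It is bounded by the
      $L^2$ norm of \<open>q\<close> alone because \<open>Lop p\<close> is itself square
      integrable.\<close>
    let ?S = "\<lambda>q. inner2 (Lop p) q + K * inner2 p Q' * inner2 q Q'"
    define B where "B = l2_norm L (Lop p) + K * \<bar>inner2 p Q'\<bar> * l2_norm L Q'"
    define C where "C = max \<bar>?S p\<bar> (2 * B)"
    have Sq: "\<bar>?S q\<bar> \<le> B * l2_norm L q" if q: "q \<in> ?T" for q
    proof -
      have "\<bar>?S q\<bar> \<le> \<bar>inner2 (Lop p) q\<bar> + K * \<bar>inner2 p Q'\<bar> * \<bar>inner2 q Q'\<bar>"
        using abs_triangle_ineq[of "inner2 (Lop p) q" "K * inner2 p Q' * inner2 q Q'"] K by (simp add: abs_mult)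
      also have "\<dots> \<le> l2_norm L (Lop p) * l2_norm L q + K * \<bar>inner2 p Q'\<bar> * (l2_norm L q * l2_norm L Q')"
        by (intro add_mono mult_left_mono l2_Cauchy_Schwarz Lop_L2 trig_poly_in_Cinf L_pos p trig_L2 q Q'_L2) (use K in auto)
      finally show ?thesis by (simp add: B_def algebra_simps)
    qed
    show ?thesis
    proof (intro exI[of _ C] ballI allI)
      fix q s assume q: "q \<in> ?T"
      have "inner2 (Lop (\<lambda>x. s * p x + 1 * q x)) (\<lambda>x. s * p x + 1 * q x)
        + K * (inner2 (\<lambda>x. s * p x + 1 * q x) Q')\<^sup>2
        = inner2 (Lop q) q + K * (inner2 q Q')\<^sup>2 + (s\<^sup>2 * ?S p + 2 * s * ?S q)"
        unfolding inner2_Lop_lincomb[OF p q] lin[OF p q Q'_L2] by (simp add: power2_eq_square algebra_simps)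
      moreover have "- (s\<^sup>2 * ?S p) \<le> s\<^sup>2 * C"
        unfolding mult_minus_right[symmetric] by (intro mult_left_mono) (auto simp: C_def)
      moreover have "- (2 * s * ?S q) \<le> \<bar>s\<bar> * (C * l2_norm L q)"
      proof -
        have "- (2 * s * ?S q) \<le> \<bar>s\<bar> * (2 * \<bar>?S q\<bar>)"
        proof -
          have "- (2 * s * x) \<le> \<bar>s\<bar> * (2 * \<bar>x\<bar>)" for x :: real
            using abs_ge_minus_self[of "2 * s * x"] by (simp add: abs_mult)
          thus ?thesis by blast
        qed
        also have "\<dots> \<le> \<bar>s\<bar> * (2 * (B * l2_norm L q))" by (intro mult_left_mono Sq q) auto
        also have "\<dots> \<le> \<bar>s\<bar> * (C * l2_norm L q)"
          unfolding mult.assoc[symmetric, of 2]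
          by (intro mult_left_mono mult_right_mono l2_norm_nonneg) (auto simp: C_def)
        finally show ?thesis .
      qed
      ultimately show "inner2 (Lop (\<lambda>x. s * p x + 1 * q x)) (\<lambda>x. s * p x + 1 * q x)
          + K * (inner2 (\<lambda>x. s * p x + 1 * q x) Q')\<^sup>2
        \<ge> inner2 (Lop q) q + K * (inner2 q Q')\<^sup>2 - C * (s\<^sup>2 + \<bar>s\<bar> * l2_norm L q)"
        by (simp add: algebra_simps)
    qed
  qed
  have Y: "(\<lambda>x. a * p x + b * q x) \<in> ?Y" if "p \<in> ?Y" "q \<in> ?Y" for p q a b
    using that lin[of p q "deriv \<phi>" a b] dphi_L2 by (auto intro: trig_polys_lincomb)
  have "\<exists>K\<ge>0. \<exists>c>0. \<forall>q\<in>?Y. inner2 (Lop q) q + K * (inner2 q Q')\<^sup>2 \<ge> c * (l2_norm L q)\<^sup>2"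
  proof (rule penalty[where X = ?Y and l = "\<lambda>q. inner2 q Q'"])
    show "\<exists>C. \<forall>q\<in>?Y. \<forall>s. inner2 (Lop q) q - C * (s\<^sup>2 + \<bar>s\<bar> * l2_norm L q)
       \<le> inner2 (Lop (\<lambda>x. s * p x + 1 * q x)) (\<lambda>x. s * p x + 1 * q x)" if "p \<in> ?Y" for p
      using pert[of p 0] that by auto
    show "\<exists>c>0. \<forall>q\<in>?Y. inner2 q Q' = 0 \<longrightarrow> c * (l2_norm L q)\<^sup>2 \<le> inner2 (Lop q) q"
      using coercive trig_in_H_per[OF L_pos] by blast
  qed (use Y lin n Q'_L2 l2_norm_nonneg in auto)
  then obtain K2 where K2: "K2 \<ge> 0"
    "\<exists>c>0. \<forall>q\<in>?Y. inner2 (Lop q) q + K2 * (inner2 q Q')\<^sup>2 \<ge> c * (l2_norm L q)\<^sup>2" by blast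
  have "\<exists>K\<ge>0. \<exists>c>0. \<forall>q\<in>?T. inner2 (Lop q) q + K2 * (inner2 q Q')\<^sup>2 + K * (inner2 q (deriv \<phi>))\<^sup>2 \<ge> c * (l2_norm L q)\<^sup>2"
    by (rule penalty[where X = ?T and l = "\<lambda>q. inner2 q (deriv \<phi>)"])
       (use trig_polys_lincomb lin n dphi_L2 l2_norm_nonneg pert K2 in auto)
  then obtain K1 c where K1: "K1 \<ge> 0" "c > 0"
    "\<And>q. q \<in> ?T \<Longrightarrow> inner2 (Lop q) q + K2 * (inner2 q Q')\<^sup>2 + K1 * (inner2 q (deriv \<phi>))\<^sup>2 \<ge> c * (l2_norm L q)\<^sup>2"
    by blast
  obtain c1 c2 where c12: "c1 > 0" "c2 > 0"
    "\<And>v. v \<in> Cinf_per L \<Longrightarrow> inner2 (Lop v) v \<ge> c1 * (nrm v)\<^sup>2 - c2 * (l2_norm L v)\<^sup>2"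
    using Garding by blast
  \<comment> \<open>With n and l the two norms of \<open>p\<close> and b the penalized form, c1 n^2
    \<le> b + c2 l^2 and c l^2 \<le> b combine to this constant.\<close>
  have "inner2 (Lop p) p + K2 * (inner2 p Q')\<^sup>2 + K1 * (inner2 p (deriv \<phi>))\<^sup>2 \<ge> c1 / (1 + c2 / c) * (nrm p)\<^sup>2"
    if p: "p \<in> ?T" for p
  proof -
    let ?b = "inner2 (Lop p) p + K2 * (inner2 p Q')\<^sup>2 + K1 * (inner2 p (deriv \<phi>))\<^sup>2"
    have "?b \<ge> inner2 (Lop p) p" using K1(1) K2(1) by simp
    hence 1: "c1 * (nrm p)\<^sup>2 \<le> ?b + c2 * (l2_norm L p)\<^sup>2"
      using c12(3)[OF trig_poly_in_Cinf[OF L_pos p]] by linarith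
    have "c2 * (l2_norm L p)\<^sup>2 = c2 / c * (c * (l2_norm L p)\<^sup>2)" using K1(2) by simp
    also have "\<dots> \<le> c2 / c * ?b" using c12(2) K1(2) by (intro mult_left_mono K1(3) p) auto
    finally have "c1 * (nrm p)\<^sup>2 \<le> ?b * (1 + c2 / c)" using 1 by (simp add: algebra_simps)
    moreover have "1 + c2 / c > 0" using c12 K1 by (simp add: add_pos_pos)
    ultimately show ?thesis by (simp add: pos_divide_le_eq)
  qed
  moreover have "c1 / (1 + c2 / c) > 0" using c12 K1 by (simp add: add_pos_pos)
  ultimately show ?thesis using K1(1) K2(1) by blast
qed

subsection \<open>Expansion of the energy\<close>

lemma trunc_bilinear_tendsto:
  assumes h: "h \<in> X"
    and B: "\<And>h k. h \<in> X \<Longrightarrow> k \<in> X \<Longrightarrow> \<bar>B h k\<bar> \<le> C * nrm h * nrm k"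
    and l1: "\<And>g h k a b. g \<in> X \<Longrightarrow> h \<in> X \<Longrightarrow> k \<in> X \<Longrightarrow> B (\<lambda>x. a * g x + b * h x) k = a * B g k + b * B h k"
    and l2: "\<And>g h k a b. g \<in> X \<Longrightarrow> h \<in> X \<Longrightarrow> k \<in> X \<Longrightarrow> B k (\<lambda>x. a * g x + b * h x) = a * B k g + b * B k h"
  shows "(\<lambda>N. B (trunc L h N) (trunc L h N)) \<longlonglongrightarrow> (B h h :: real)"
proof -
  let ?d = "\<lambda>N. nrm (\<lambda>x. h x - trunc L h N x)"
  have "(\<lambda>N. C * ?d N * nrm h + C * nrm (trunc L h N) * ?d N) \<longlonglongrightarrow> C * 0 * nrm h + C * nrm h * 0"
    by (intro tendsto_intros trunc_tendsto[OF L_pos h] trunc_nrm_tendsto[OF h])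
  hence "(\<lambda>N. C * ?d N * nrm h + C * nrm (trunc L h N) * ?d N) \<longlonglongrightarrow> 0" by simp
  hence "(\<lambda>N. B h h - B (trunc L h N) (trunc L h N)) \<longlonglongrightarrow> 0"
  proof (rule Lim_null_comparison[rotated], intro always_eventually allI)
    fix N
    let ?t = "trunc L h N"
    have t: "?t \<in> X" by (intro trig_in_X trunc_in_trig_polys)
    have d: "(\<lambda>x. h x - ?t x) \<in> X" by (rule H_per_diff[OF L_pos h t])
    have "B h h - B ?t ?t = B (\<lambda>x. h x - ?t x) h + B ?t (\<lambda>x. h x - ?t x)"
      using l1[OF h t h, of 1 "-1"] l2[OF h t t, of 1 "-1"] by simp
    thus "norm (B h h - B ?t ?t) \<le> C * ?d N * nrm h + C * nrm ?t * ?d N"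
      using B[OF d h] B[OF t d] by simp
  qed
  from tendsto_diff[OF tendsto_const[of "B h h"] this] show ?thesis by simp
qed

lemma trunc_linear_tendsto:
  assumes h: "h \<in> X"
    and B: "\<And>h. h \<in> X \<Longrightarrow> \<bar>D h\<bar> \<le> C * nrm h"
    and l: "\<And>g h a b. g \<in> X \<Longrightarrow> h \<in> X \<Longrightarrow> D (\<lambda>x. a * g x + b * h x) = a * D g + b * D h"
  shows "(\<lambda>N. D (trunc L h N)) \<longlonglongrightarrow> (D h :: real)"
proof -
  have "(\<lambda>N. C * nrm (\<lambda>x. h x - trunc L h N x)) \<longlonglongrightarrow> 0"
    using trunc_tendsto[OF L_pos h] by (rule tendsto_mult_right_zero)
  hence "(\<lambda>N. D h - D (trunc L h N)) \<longlonglongrightarrow> 0"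
  proof (rule Lim_null_comparison[rotated], intro always_eventually allI)
    fix N
    have t: "trunc L h N \<in> X" by (intro trig_in_X trunc_in_trig_polys)
    show "norm (D h - D (trunc L h N)) \<le> C * nrm (\<lambda>x. h x - trunc L h N x)"
      using B[OF H_per_diff[OF L_pos h t]] l[OF h t, of 1 "-1"] by simp
  qed
  from tendsto_diff[OF tendsto_const[of "D h"] this] show ?thesis by simp
qed

text \<open>The wave equation tested against \<open>p\<close>: the first variation of
  \<open>P_fun\<close> at \<phi> cancels that of \<omega> F + A M.\<close>

lemma inner2_multiplier_phi:
  assumes p: "p \<in> L2_per L"
  shows "inner2 (multiplier \<theta> L \<phi>) p - inner2 (\<lambda>x. f (\<phi> x)) p = - \<omega> * inner2 \<phi> p - A * inner2 (\<lambda>x. 1) p"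
proof -
  note M = multiplier_Cinf(1)[OF L_pos symbol phi_Cinf]
  note fp = Cinf_per_compose_L2[OF phi_Cinf continuous_f(1)]
  \<comment> \<open>The left side of the wave equation, bracketed into nested two-term combinations
    to fit the linearity lemmas.\<close>
  let ?g = "\<lambda>x. 1 * (1 * multiplier \<theta> L \<phi> x + (-1) * f (\<phi> x)) + 1 * (\<omega> * \<phi> x + A * 1)"
  have "AE x in lborel. multiplier \<theta> L \<phi> x + \<omega> * \<phi> x - f (\<phi> x) + A = 0"
    using wave by (simp add: traveling_wave_def)
  hence "AE x in lborel. ?g x = 0" by (rule AE_mp) (auto intro!: AE_I2)
  hence "inner2 ?g p = inner2 (\<lambda>x. 0) p"
    by (rule l2_inner_cong_AE)
       (intro L2_perD(2)[of _ L] L2_per_lincomb M fp phi_L2 const_in_L2_per p)+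
  also have "\<dots> = 0" by (simp add: l2_inner_eq)
  also have "inner2 ?g p = 1 * inner2 (\<lambda>x. 1 * multiplier \<theta> L \<phi> x + (-1) * f (\<phi> x)) p
      + 1 * inner2 (\<lambda>x. \<omega> * \<phi> x + A * 1) p"
    by (rule l2_inner_lincomb_left) (intro L2_per_lincomb M fp phi_L2 const_in_L2_per p)+
  also have "inner2 (\<lambda>x. 1 * multiplier \<theta> L \<phi> x + (-1) * f (\<phi> x)) p
      = 1 * inner2 (multiplier \<theta> L \<phi>) p + (-1) * inner2 (\<lambda>x. f (\<phi> x)) p"
    by (rule l2_inner_lincomb_left[OF M fp p])
  also have "inner2 (\<lambda>x. \<omega> * \<phi> x + A * 1) p = \<omega> * inner2 \<phi> p + A * inner2 (\<lambda>x. 1) p"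
    by (rule l2_inner_lincomb_left[OF phi_L2 const_in_L2_per p])
  finally show ?thesis by simp
qed

text \<open>The multiplier form expands exactly in t and the potential up to a cubic error; the wave
  equation then rewrites the linear term.\<close>

lemma P_fun_expand:
  assumes p: "p \<in> trig_polys L"
  obtains K where "\<And>t. \<bar>t\<bar> \<le> 1 \<Longrightarrow> \<bar>P_fun \<theta> W L (\<lambda>x. \<phi> x + t * p x) - P_fun \<theta> W L \<phi>
     - t * (- \<omega> * inner2 \<phi> p - A * inner2 (\<lambda>x. 1) p)
     - t\<^sup>2 * (inner2 (multiplier \<theta> L p) p - inner2 (\<lambda>x. deriv f (\<phi> x) * p x) p) / 2\<bar> \<le> K * \<bar>t\<bar> ^ 3"
proof -
  have sm: "(\<lambda>k::int. \<theta> (of_int k) * (cmod (fourier_coeff L \<phi> k))\<^sup>2) summable_on UNIV"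
    using functionals phi_in_X by (simp add: functionals_smooth_def)
  obtain K where K: "\<And>t. \<bar>t\<bar> \<le> 1 \<Longrightarrow>
    \<bar>(LINT x|period_measure L. W (\<phi> x + t * p x)) - (LINT x|period_measure L. W (\<phi> x))
      - t * inner2 (\<lambda>x. f (\<phi> x)) p - t\<^sup>2 / 2 * inner2 (\<lambda>x. deriv f (\<phi> x) * p x) p\<bar> \<le> K * \<bar>t\<bar> ^ 3"
    using potential_expand[OF L_pos smooth_f W_deriv phi_Cinf trig_poly_in_Cinf[OF L_pos p]] by blast
  show ?thesis
  proof (rule that[of K])
    fix t :: real assume t: "\<bar>t\<bar> \<le> 1"
    have eq: "P_fun \<theta> W L (\<lambda>x. \<phi> x + t * p x) - P_fun \<theta> W L \<phi>
     - t * (inner2 (multiplier \<theta> L \<phi>) p - inner2 (\<lambda>x. f (\<phi> x)) p)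
     - t\<^sup>2 * (inner2 (multiplier \<theta> L p) p - inner2 (\<lambda>x. deriv f (\<phi> x) * p x) p) / 2
     = - ((LINT x|period_measure L. W (\<phi> x + t * p x)) - (LINT x|period_measure L. W (\<phi> x))
      - t * inner2 (\<lambda>x. f (\<phi> x)) p - t\<^sup>2 / 2 * inner2 (\<lambda>x. deriv f (\<phi> x) * p x) p)"
      unfolding P_fun_def set_integral_period_eq mult_form_expand[OF L_pos symbol phi_Cinf p sm]
      by (simp add: field_simps)
    show "\<bar>P_fun \<theta> W L (\<lambda>x. \<phi> x + t * p x) - P_fun \<theta> W L \<phi>
     - t * (- \<omega> * inner2 \<phi> p - A * inner2 (\<lambda>x. 1) p)
     - t\<^sup>2 * (inner2 (multiplier \<theta> L p) p - inner2 (\<lambda>x. deriv f (\<phi> x) * p x) p) / 2\<bar> \<le> K * \<bar>t\<bar> ^ 3"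
      unfolding inner2_multiplier_phi[OF trig_L2[OF p], symmetric] eq abs_minus_cancel by (rule K[OF t])
  qed
qed

text \<open>\<open>q\<close> is the second derivative of \<open>P_fun\<close> at \<phi> plus
  \<omega> times the squared $L^2$ norm. It replaces the quadratic form of \<open>Lop\<close> on
  elements of \<open>X\<close> whose image under the multiplier need not be a function. The linear
  term cancels by the wave equation, first on trigonometric polynomials and then on all of
  \<open>X\<close>.\<close>

lemma energy_second_order:
  obtains q C where "C > 0"
    "\<And>p. p \<in> trig_polys L \<Longrightarrow> q p = inner2 (Lop p) p"
    "\<And>h. h \<in> X \<Longrightarrow> \<bar>q h\<bar> \<le> C * (nrm h)\<^sup>2"
    "\<And>h. h \<in> X \<Longrightarrow> (\<lambda>N. q (trunc L h N)) \<longlonglongrightarrow> q h"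
    "\<And>\<epsilon>. \<epsilon> > 0 \<Longrightarrow> \<exists>\<delta>>0. \<forall>h\<in>X. nrm h < \<delta> \<longrightarrow>
       \<bar>energy (\<lambda>x. \<phi> x + h x) - energy \<phi> - q h / 2\<bar> \<le> \<epsilon> * (nrm h)\<^sup>2"
proof -
  have sm: "smooth_functional X nrm (P_fun \<theta> W L)" using functionals by (simp add: functionals_smooth_def)
  obtain D1 D2 C where C: "C > 0"
    and D1: "\<And>h. h \<in> X \<Longrightarrow> \<bar>D1 h\<bar> \<le> C * nrm h"
    and D2: "\<And>h k. h \<in> X \<Longrightarrow> k \<in> X \<Longrightarrow> \<bar>D2 h k\<bar> \<le> C * nrm h * nrm k"
    and l1: "\<And>g h a b. g \<in> X \<Longrightarrow> h \<in> X \<Longrightarrow> D1 (\<lambda>x. a * g x + b * h x) = a * D1 g + b * D1 h"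
    and l2: "\<And>g h k a b. g \<in> X \<Longrightarrow> h \<in> X \<Longrightarrow> k \<in> X \<Longrightarrow> D2 (\<lambda>x. a * g x + b * h x) k = a * D2 g k + b * D2 h k"
    and l3: "\<And>g h k a b. g \<in> X \<Longrightarrow> h \<in> X \<Longrightarrow> k \<in> X \<Longrightarrow> D2 k (\<lambda>x. a * g x + b * h x) = a * D2 k g + b * D2 k h"
    and tay: "\<And>\<epsilon>. \<epsilon> > 0 \<Longrightarrow> \<exists>\<delta>>0. \<forall>h\<in>X. nrm h < \<delta> \<longrightarrow>
       \<bar>P_fun \<theta> W L (\<lambda>x. \<phi> x + h x) - P_fun \<theta> W L \<phi> - D1 h - D2 h h / 2\<bar> \<le> \<epsilon> * (nrm h)\<^sup>2"
    by (rule smooth_functional_second_order[OF sm H_per_lincomb[OF L_pos] nrm_nonneg nrm_mult phi_in_X]) blast+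
  obtain C' where C': "C' > 0" "\<And>h. h \<in> X \<Longrightarrow> l2_norm L h \<le> C' * nrm h" using l2_norm_le_nrm by blast
  have ident: "D1 p = - \<omega> * inner2 \<phi> p - A * inner2 (\<lambda>x. 1) p \<and>
    D2 p p = inner2 (multiplier \<theta> L p) p - inner2 (\<lambda>x. deriv f (\<phi> x) * p x) p" if p: "p \<in> trig_polys L" for p
  proof -
    note h = trig_in_X[OF p]
    obtain K where K: "\<And>t. \<bar>t\<bar> \<le> 1 \<Longrightarrow> \<bar>P_fun \<theta> W L (\<lambda>x. \<phi> x + t * p x) - P_fun \<theta> W L \<phi>
     - t * (- \<omega> * inner2 \<phi> p - A * inner2 (\<lambda>x. 1) p)
     - t\<^sup>2 * (inner2 (multiplier \<theta> L p) p - inner2 (\<lambda>x. deriv f (\<phi> x) * p x) p) / 2\<bar> \<le> K * \<bar>t\<bar> ^ 3"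
      using P_fun_expand[OF p] by blast
    have hom1: "D1 (\<lambda>x. t * p x) = t * D1 p" for t using l1[OF h h, of t 0] by simp
    have hom2: "D2 (\<lambda>x. t * p x) (\<lambda>x. t * p x) = t\<^sup>2 * D2 p p" for t
      using l2[OF h h X_mult[OF h], of t 0 t] l3[OF h h h, of t 0] by (simp add: power2_eq_square)
    note * = second_order_identify[where X = X and N = nrm and G = "P_fun \<theta> W L" and u = \<phi>
        and ?D1.0 = D1 and ?D2.0 = D2 and h = p, OF _ X_mult[OF h] nrm_nonneg nrm_mult[OF h] hom1 hom2 K]
    show ?thesis by (intro conjI *) (use tay in auto)
  qed
  \<comment> \<open>Both sides are continuous in \<open>nrm\<close> and agree on the
    truncations.\<close>
  have D1_eq: "D1 h = - \<omega> * inner2 \<phi> h - A * inner2 (\<lambda>x. 1) h" if h: "h \<in> X" for h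
  proof (rule LIMSEQ_unique)
    show "(\<lambda>N. D1 (trunc L h N)) \<longlonglongrightarrow> D1 h" by (rule trunc_linear_tendsto[OF h D1 l1])
    have "(\<lambda>N. - \<omega> * inner2 (trunc L h N) \<phi> - A * inner2 (trunc L h N) (\<lambda>x. 1))
        \<longlonglongrightarrow> - \<omega> * inner2 h \<phi> - A * inner2 h (\<lambda>x. 1)"
      by (intro tendsto_intros trunc_inner_tendsto h phi_L2 const_in_L2_per)
    thus "(\<lambda>N. D1 (trunc L h N)) \<longlonglongrightarrow> - \<omega> * inner2 \<phi> h - A * inner2 (\<lambda>x. 1) h"
      using ident[OF trunc_in_trig_polys] by (simp add: l2_inner_commute)
  qed
  have i2: "\<bar>inner2 h k\<bar> \<le> C'\<^sup>2 * nrm h * nrm k" if "h \<in> X" "k \<in> X" for h k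
  proof -
    have "\<bar>inner2 h k\<bar> \<le> l2_norm L h * l2_norm L k" by (intro l2_Cauchy_Schwarz X_L2 that)
    also have "\<dots> \<le> (C' * nrm h) * (C' * nrm k)"
      by (intro mult_mono C' that) (auto simp: l2_norm_nonneg nrm_nonneg C'(1) less_imp_le)
    finally show ?thesis by (simp add: power2_eq_square mult_ac)
  qed
  define q where "q h = D2 h h + \<omega> * inner2 h h" for h
  show ?thesis
  proof (rule that[of "C + \<bar>\<omega>\<bar> * C'\<^sup>2" q])
    show "C + \<bar>\<omega>\<bar> * C'\<^sup>2 > 0" using C by (simp add: add_pos_nonneg)
    show "q p = inner2 (Lop p) p" if "p \<in> trig_polys L" for p
      using ident[OF that] by (simp add: q_def inner2_Lop trig_poly_in_Cinf[OF L_pos that] trig_L2[OF that])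
    show "\<bar>q h\<bar> \<le> (C + \<bar>\<omega>\<bar> * C'\<^sup>2) * (nrm h)\<^sup>2" if h: "h \<in> X" for h
    proof -
      have "\<bar>q h\<bar> \<le> \<bar>D2 h h\<bar> + \<bar>\<omega>\<bar> * \<bar>inner2 h h\<bar>"
        unfolding q_def abs_mult[symmetric] by (rule abs_triangle_ineq)
      also have "\<dots> \<le> C * nrm h * nrm h + \<bar>\<omega>\<bar> * (C'\<^sup>2 * nrm h * nrm h)"
        by (intro add_mono mult_left_mono D2 i2 h) simp
      finally show ?thesis by (simp add: power2_eq_square algebra_simps)
    qed
    show "(\<lambda>N. q (trunc L h N)) \<longlonglongrightarrow> q h" if h: "h \<in> X" for h
      unfolding q_def
    proof (intro tendsto_intros)
      show "(\<lambda>N. D2 (trunc L h N) (trunc L h N)) \<longlonglongrightarrow> D2 h h"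
        by (rule trunc_bilinear_tendsto[OF h D2 l2 l3])
      show "(\<lambda>N. inner2 (trunc L h N) (trunc L h N)) \<longlonglongrightarrow> inner2 h h"
        by (rule trunc_bilinear_tendsto[OF h i2])
           (auto intro!: l2_inner_lincomb_left l2_inner_lincomb_right X_L2)
    qed
    fix \<epsilon> :: real assume "\<epsilon> > 0"
    then obtain \<delta> where d: "\<delta> > 0" "\<And>h. h \<in> X \<Longrightarrow> nrm h < \<delta> \<Longrightarrow>
       \<bar>P_fun \<theta> W L (\<lambda>x. \<phi> x + h x) - P_fun \<theta> W L \<phi> - D1 h - D2 h h / 2\<bar> \<le> \<epsilon> * (nrm h)\<^sup>2"
      using tay by blast
    have "energy (\<lambda>x. \<phi> x + h x) - energy \<phi> - q h / 2
        = P_fun \<theta> W L (\<lambda>x. \<phi> x + h x) - P_fun \<theta> W L \<phi> - D1 h - D2 h h / 2" if h: "h \<in> X" for h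
      using F_fun_add[OF phi_L2 X_L2[OF h], of 1] M_fun_add[OF phi_L2 X_L2[OF h]]
      by (simp add: energy_def q_def D1_eq[OF h] algebra_simps add_divide_distrib)
    thus "\<exists>\<delta>>0. \<forall>h\<in>X. nrm h < \<delta> \<longrightarrow>
       \<bar>energy (\<lambda>x. \<phi> x + h x) - energy \<phi> - q h / 2\<bar> \<le> \<epsilon> * (nrm h)\<^sup>2"
      using d by (intro exI[of _ \<delta>]) auto
  qed
qed

section \<open>The Lyapunov functional near the wave\<close>

definition Q_fun :: "(real \<Rightarrow> real) \<Rightarrow> real" where
  "Q_fun u = \<mu> * M_fun L u + \<nu> * F_fun L u"

definition lyapunov :: "real \<Rightarrow> (real \<Rightarrow> real) \<Rightarrow> real" where
  "lyapunov K u = energy u - energy \<phi> + K * (Q_fun u - Q_fun \<phi>)\<^sup>2"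

lemma Q_fun_add:
  assumes h: "h \<in> L2_per L"
  shows "Q_fun (\<lambda>x. \<phi> x + h x) - Q_fun \<phi> = inner2 h Q' + \<nu> / 2 * (l2_norm L h)\<^sup>2"
proof -
  have "inner2 h Q' = \<mu> * inner2 (\<lambda>x. 1) h + \<nu> * inner2 \<phi> h"
    using l2_inner_lincomb_left[OF const_in_L2_per[of 1] phi_L2 h, of \<mu> \<nu>]
    by (simp add: l2_inner_commute[of L h])
  thus ?thesis using F_fun_add[OF phi_L2 h, of 1] M_fun_add[OF phi_L2 h]
    by (simp add: Q_fun_def l2_norm_sq algebra_simps)
qed

text \<open>For \<open>h\<close> orthogonal to \<open>deriv \<phi>\<close> the penalty with
  \<open>K1\<close> vanishes, and the one with \<open>K2\<close> comes from the square in
  \<open>lyapunov\<close>. The Hessian enters Taylor's formula halved, so half of that penalty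
  suffices; giving up the other half absorbs the mixed term of the square at the cost of the squared
  quadratic part of \<open>Q_fun\<close>.\<close>

lemma lyapunov_local:
  obtains K c \<delta> where "c > 0" "\<delta> > 0"
    "\<And>h. h \<in> X \<Longrightarrow> nrm h < \<delta> \<Longrightarrow> inner2 h (deriv \<phi>) = 0 \<Longrightarrow> lyapunov K (\<lambda>x. \<phi> x + h x) \<ge> c * (nrm h)\<^sup>2"
    "\<And>\<epsilon>. \<epsilon> > 0 \<Longrightarrow> \<exists>d>0. \<forall>h\<in>X. nrm h < d \<longrightarrow> lyapunov K (\<lambda>x. \<phi> x + h x) < \<epsilon>"
proof -
  obtain q C where C: "C > 0"
    and q_trig: "\<And>p. p \<in> trig_polys L \<Longrightarrow> q p = inner2 (Lop p) p"
    and q_le: "\<And>h. h \<in> X \<Longrightarrow> \<bar>q h\<bar> \<le> C * (nrm h)\<^sup>2"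
    and q_lim: "\<And>h. h \<in> X \<Longrightarrow> (\<lambda>N. q (trunc L h N)) \<longlonglongrightarrow> q h"
    and tay: "\<And>\<epsilon>. \<epsilon> > 0 \<Longrightarrow> \<exists>\<delta>>0. \<forall>h\<in>X. nrm h < \<delta> \<longrightarrow>
       \<bar>energy (\<lambda>x. \<phi> x + h x) - energy \<phi> - q h / 2\<bar> \<le> \<epsilon> * (nrm h)\<^sup>2"
    by (rule energy_second_order) blast
  obtain K1 K2 c where K: "K1 \<ge> 0" "K2 \<ge> 0" and c: "c > 0"
    and coer: "\<And>p. p \<in> trig_polys L \<Longrightarrow> inner2 (Lop p) p + K2 * (inner2 p Q')\<^sup>2
         + K1 * (inner2 p (deriv \<phi>))\<^sup>2 \<ge> c * (nrm p)\<^sup>2"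
    using trig_coercive by blast
  obtain C' where C': "C' > 0" "\<And>h. h \<in> X \<Longrightarrow> l2_norm L h \<le> C' * nrm h" using l2_norm_le_nrm by blast
  have coer_X: "c * (nrm h)\<^sup>2 \<le> q h + K2 * (inner2 h Q')\<^sup>2" if h: "h \<in> X" "inner2 h (deriv \<phi>) = 0" for h
  proof -
    have "c * (nrm h)\<^sup>2 \<le> q h + K2 * (inner2 h Q')\<^sup>2 + K1 * (inner2 h (deriv \<phi>))\<^sup>2"
    proof (rule LIMSEQ_le)
      show "(\<lambda>N. c * (nrm (trunc L h N))\<^sup>2) \<longlonglongrightarrow> c * (nrm h)\<^sup>2"
        by (intro tendsto_intros trunc_nrm_tendsto h)
      show "(\<lambda>N. q (trunc L h N) + K2 * (inner2 (trunc L h N) Q')\<^sup>2 + K1 * (inner2 (trunc L h N) (deriv \<phi>))\<^sup>2)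
        \<longlonglongrightarrow> q h + K2 * (inner2 h Q')\<^sup>2 + K1 * (inner2 h (deriv \<phi>))\<^sup>2"
        by (intro tendsto_intros q_lim trunc_inner_tendsto h Q'_L2 dphi_L2)
    qed (use coer trunc_in_trig_polys in \<open>auto simp: q_trig\<close>)
    thus ?thesis using h(2) by simp
  qed
  \<comment> \<open>\<open>E\<close> times the fourth power of \<open>nrm h\<close> bounds
    \<open>K2\<close> times the squared quadratic part of \<open>Q_fun\<close>.\<close>
  define E where "E = K2 * (\<nu> / 2)\<^sup>2 * C' ^ 4"
  have E: "E \<ge> 0" using K C' by (simp add: E_def)
  obtain d1 where d1: "d1 > 0" "\<And>h. h \<in> X \<Longrightarrow> nrm h < d1 \<Longrightarrow>
       \<bar>energy (\<lambda>x. \<phi> x + h x) - energy \<phi> - q h / 2\<bar> \<le> c / 8 * (nrm h)\<^sup>2"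
    using tay[of "c / 8"] c by auto
  \<comment> \<open>The second entry forces \<open>E * (nrm h)^2 \<le> c / 8\<close>, so that this
    quartic error is dominated by a quadratic one.\<close>
  define d where "d = min d1 (sqrt (c / (8 * (E + 1))))"
  have d: "d > 0" using d1(1) c E by (simp add: d_def)
  have l2_4: "((l2_norm L h)\<^sup>2)\<^sup>2 \<le> C' ^ 4 * ((nrm h)\<^sup>2)\<^sup>2" if h: "h \<in> X" for h
  proof -
    have "(l2_norm L h) ^ 4 \<le> (C' * nrm h) ^ 4" by (intro power_mono C' h l2_norm_nonneg)
    thus ?thesis by (simp add: power_mult_distrib flip: power_mult)
  qed
  show ?thesis
  \<comment> \<open>c / 4 is what remains of c / 2 after c / 8 for the Taylor error and c / 8 for
    the quadratic part of \<open>Q_fun\<close>.\<close>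
  proof (rule that[of "c / 4" d K2])
    show "c / 4 > 0" using c by simp
    show "d > 0" by (rule d)
    show "lyapunov K2 (\<lambda>x. \<phi> x + h x) \<ge> c / 4 * (nrm h)\<^sup>2"
      if h: "h \<in> X" "nrm h < d" "inner2 h (deriv \<phi>) = 0" for h
    proof -
      let ?a = "inner2 h Q'" and ?b = "\<nu> / 2 * (l2_norm L h)\<^sup>2"
      have "(?a + ?b)\<^sup>2 \<ge> ?a\<^sup>2 / 2 - ?b\<^sup>2"
      proof -
        have "0 \<le> (?a + 2 * ?b)\<^sup>2 / 2" by simp
        also have "\<dots> = (?a + ?b)\<^sup>2 - (?a\<^sup>2 / 2 - ?b\<^sup>2)" by (simp add: power2_eq_square algebra_simps add_divide_distrib)
        finally show ?thesis by simp
      qed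
      hence "K2 * (?a\<^sup>2 / 2 - ?b\<^sup>2) \<le> K2 * (?a + ?b)\<^sup>2" using K(2) by (rule mult_left_mono)
      hence 1: "K2 * ?a\<^sup>2 / 2 - K2 * ?b\<^sup>2 \<le> K2 * (?a + ?b)\<^sup>2" by (simp add: right_diff_distrib)
      have "K2 * ?b\<^sup>2 = K2 * (\<nu> / 2)\<^sup>2 * ((l2_norm L h)\<^sup>2)\<^sup>2" by (simp add: power_mult_distrib power_divide)
      also have "\<dots> \<le> K2 * (\<nu> / 2)\<^sup>2 * (C' ^ 4 * ((nrm h)\<^sup>2)\<^sup>2)"
        by (intro mult_left_mono l2_4 h) (use K in auto)
      also have "\<dots> = (E * (nrm h)\<^sup>2) * (nrm h)\<^sup>2" by (simp add: E_def power2_eq_square)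
      also have "\<dots> \<le> c / 8 * (nrm h)\<^sup>2"
      proof (rule mult_right_mono)
        have "nrm h < sqrt (c / (8 * (E + 1)))" using h(2) by (simp add: d_def)
        hence "(nrm h)\<^sup>2 < (sqrt (c / (8 * (E + 1))))\<^sup>2"
          by (rule power_strict_mono) (simp_all add: nrm_nonneg)
        hence "(nrm h)\<^sup>2 < c / (8 * (E + 1))" using c E by simp
        hence "(E + 1) * (nrm h)\<^sup>2 \<le> c / 8" using E by (simp add: field_simps)
        thus "E * (nrm h)\<^sup>2 \<le> c / 8" using zero_le_power2[of "nrm h"] unfolding distrib_right by linarith
      qed simp
      finally have 2: "K2 * ?b\<^sup>2 \<le> c / 8 * (nrm h)\<^sup>2" .
      have 3: "energy (\<lambda>x. \<phi> x + h x) - energy \<phi> \<ge> q h / 2 - c / 8 * (nrm h)\<^sup>2"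
      proof -
        have "nrm h < d1" using h(2) by (simp add: d_def)
        from d1(2)[OF h(1) this] show ?thesis unfolding abs_le_iff by linarith
      qed
      show ?thesis unfolding lyapunov_def Q_fun_add[OF X_L2[OF h(1)]]
        using 1 2 3 coer_X[OF h(1,3)] by linarith
    qed
    fix \<epsilon> :: real assume e: "\<epsilon> > 0"
    define B where "B = l2_norm L Q' * C' + \<bar>\<nu>\<bar> / 2 * C'\<^sup>2"
    have B: "B \<ge> 0" using C' by (simp add: B_def l2_norm_nonneg)
    \<comment> \<open>\<open>Z\<close> collects the bounds of the Hessian, the Taylor error and the
      penalty; for \<open>nrm h \<le> 1\<close> the resulting quadratic bound is at most
      \<open>Z * nrm h\<close>.\<close>
    define Z where "Z = C / 2 + c / 8 + K2 * B\<^sup>2 + 1"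
    have Z: "Z > 0" unfolding Z_def using C c K by (intro add_nonneg_pos add_nonneg_nonneg) auto
    show "\<exists>d>0. \<forall>h\<in>X. nrm h < d \<longrightarrow> lyapunov K2 (\<lambda>x. \<phi> x + h x) < \<epsilon>"
    proof (intro exI[of _ "min 1 (min d1 (\<epsilon> / Z))"] conjI ballI impI)
      show "min 1 (min d1 (\<epsilon> / Z)) > 0" using d1(1) e Z by simp
      fix h assume h: "h \<in> X" "nrm h < min 1 (min d1 (\<epsilon> / Z))"
      have n: "0 \<le> nrm h" "nrm h \<le> 1" "nrm h < \<epsilon> / Z" using h(2) nrm_nonneg by auto
      have n2: "(nrm h)\<^sup>2 \<le> nrm h" using n by (simp add: power2_eq_square mult_left_le)
      have "\<bar>inner2 h Q' + \<nu> / 2 * (l2_norm L h)\<^sup>2\<bar> \<le> \<bar>inner2 h Q'\<bar> + \<bar>\<nu>\<bar> / 2 * (l2_norm L h)\<^sup>2"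
        using abs_triangle_ineq[of "inner2 h Q'" "\<nu> / 2 * (l2_norm L h)\<^sup>2"] by (simp add: abs_mult)
      also have "\<dots> \<le> (C' * nrm h) * l2_norm L Q' + \<bar>\<nu>\<bar> / 2 * (C' * nrm h)\<^sup>2"
        by (intro add_mono mult_left_mono power_mono C' h l2_norm_nonneg
            order_trans[OF l2_Cauchy_Schwarz[OF X_L2[OF h(1)] Q'_L2]] mult_right_mono) auto
      also have "\<dots> \<le> B * nrm h"
      proof -
        have "\<bar>\<nu>\<bar> / 2 * C'\<^sup>2 * (nrm h)\<^sup>2 \<le> \<bar>\<nu>\<bar> / 2 * C'\<^sup>2 * nrm h" by (intro mult_left_mono n2) auto
        thus ?thesis by (simp add: B_def power_mult_distrib algebra_simps)
      qed
      finally have "\<bar>Q_fun (\<lambda>x. \<phi> x + h x) - Q_fun \<phi>\<bar> \<le> B * nrm h" by (simp add: Q_fun_add[OF X_L2[OF h(1)]])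
      hence "\<bar>Q_fun (\<lambda>x. \<phi> x + h x) - Q_fun \<phi>\<bar>\<^sup>2 \<le> (B * nrm h)\<^sup>2" by (intro power_mono) auto
      hence "K2 * (Q_fun (\<lambda>x. \<phi> x + h x) - Q_fun \<phi>)\<^sup>2 \<le> K2 * (B * nrm h)\<^sup>2"
        using K by (intro mult_left_mono) auto
      also have "\<dots> = K2 * B\<^sup>2 * (nrm h)\<^sup>2" by (simp add: power_mult_distrib)
      finally have 1: "K2 * (Q_fun (\<lambda>x. \<phi> x + h x) - Q_fun \<phi>)\<^sup>2 \<le> K2 * B\<^sup>2 * (nrm h)\<^sup>2" .
      have 2: "energy (\<lambda>x. \<phi> x + h x) - energy \<phi> \<le> q h / 2 + c / 8 * (nrm h)\<^sup>2"
      proof -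
        have "nrm h < d1" using h(2) by simp
        from d1(2)[OF h(1) this] show ?thesis unfolding abs_le_iff by linarith
      qed
      have "lyapunov K2 (\<lambda>x. \<phi> x + h x) \<le> C / 2 * (nrm h)\<^sup>2 + c / 8 * (nrm h)\<^sup>2 + K2 * B\<^sup>2 * (nrm h)\<^sup>2"
        unfolding lyapunov_def using 1 2 abs_le_D1[OF q_le[OF h(1)]] by linarith
      also have "\<dots> = (C / 2 + c / 8 + K2 * B\<^sup>2) * (nrm h)\<^sup>2" by (simp add: distrib_right)
      also have "\<dots> \<le> Z * nrm h"
        using n n2 Z C c K by (intro mult_mono) (auto simp: Z_def)
      also have "\<dots> < \<epsilon>" using n(3) Z by (simp add: pos_less_divide_eq mult.commute)
      finally show "lyapunov K2 (\<lambda>x. \<phi> x + h x) < \<epsilon>" .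
    qed
  qed
qed

text \<open>A translation changes only the phases of the Fourier coefficients and leaves integrals
  over a period unchanged. This permits working in the frame in which the chosen translate is \<phi>
  itself.\<close>

lemma lyapunov_shift:
  assumes u: "u \<in> X"
  shows "lyapunov K (\<lambda>x. u (x + r)) = lyapunov K u"
proof -
  note u2 = X_L2[OF u]
  have "cmod (fourier_coeff L (\<lambda>x. u (x + r)) k) = cmod (fourier_coeff L u k)" for k
    by (simp add: fourier_coeff_shift[OF L_pos u2] norm_mult)
  hence 1: "mult_form \<theta> L (\<lambda>x. u (x + r)) = mult_form \<theta> L u" by (simp add: mult_form_def)
  have cW: "continuous_on UNIV W" using W_deriv by (meson DERIV_continuous_on has_field_derivative_at_within)
  have "(LINT x|period_measure L. W (u (x + r))) = (LINT x|period_measure L. W (u x))"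
  proof (rule integral_period_shift(2)[OF L_pos])
    show "W (u (x + L)) = W (u x)" for x using L2_perD(1)[OF u2] by (simp add: periodic_def)
    show "(\<lambda>x. W (u x)) \<in> borel_measurable borel"
      using borel_measurable_continuous_on[OF cW] L2_perD(2)[OF u2] by blast
    show "integrable (period_measure L) (\<lambda>x. W (u x))"
      using functionals u by (simp add: functionals_smooth_def set_integrable_period_iff)
  qed
  hence P: "P_fun \<theta> W L (\<lambda>x. u (x + r)) = P_fun \<theta> W L u"
    by (simp add: P_fun_def set_integral_period_eq 1)
  have F: "F_fun L (\<lambda>x. u (x + r)) = F_fun L u" by (simp add: F_fun_eq l2_inner_shift[OF L_pos u2 u2])
  have M: "M_fun L (\<lambda>x. u (x + r)) = M_fun L u"
    using l2_inner_shift[OF L_pos const_in_L2_per[of 1] u2, of r] by (simp add: M_fun_eq)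
  show ?thesis by (simp add: lyapunov_def energy_def Q_fun_def P F M)
qed

subsection \<open>Orbital stability\<close>

abbreviation "\<phi>\<^sub>r r \<equiv> (\<lambda>x. \<phi> (x + r))"

lemma translate_in_X: "\<phi>\<^sub>r r \<in> X" by (rule H_per_shift[OF L_pos phi_in_X])

lemma translate_L2: "\<phi>\<^sub>r r \<in> L2_per L" by (rule X_L2[OF translate_in_X])

lemma translate_deriv_L2: "(\<lambda>x. deriv \<phi> (x + r)) \<in> L2_per L" by (rule L2_per_shift[OF L_pos dphi_L2])

text \<open>Periodicity bounds the second derivative of \<phi> on the whole line; uniformity in x is
  what allows integration against a merely square integrable function.\<close>

lemma phi_first_order:
  "\<exists>B\<ge>0. \<forall>x h. \<bar>\<phi> (x + h) - \<phi> x - h * deriv \<phi> x\<bar> \<le> B * h\<^sup>2"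
proof -
  note d1 = Cinf_per_deriv[OF phi_Cinf]
  note d2 = Cinf_per_deriv[OF d1]
  obtain B where B: "B > 0" "\<And>x. \<bar>deriv (deriv \<phi>) x\<bar> \<le> B"
    using periodic_bounded[OF L_pos Cinf_perD(1)[OF d2] Cinf_perD(4)[OF d2]] by blast
  show ?thesis
  proof (intro exI[of _ B] conjI allI)
    fix x h :: real
    let ?S = "{- \<bar>h\<bar>..\<bar>h\<bar>}"
    have S: "convex ?S" "0 \<in> ?S" "h \<in> ?S" by auto
    have 1: "\<bar>deriv \<phi> (x + s) - deriv \<phi> x\<bar> \<le> B * \<bar>h\<bar>" if s: "s \<in> ?S" for s
    proof -
      have "norm (deriv \<phi> (x + s) - deriv \<phi> (x + 0)) \<le> B * norm (s - 0)"
      proof (rule field_differentiable_bound[OF S(1) _ _ s S(2), of "\<lambda>s. deriv \<phi> (x + s)"])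
        show "((\<lambda>s. deriv \<phi> (x + s)) has_real_derivative deriv (deriv \<phi>) (x + r)) (at r within ?S)" for r
          by (rule has_field_derivative_at_within)
             (use Cinf_perD(3)[OF d1, of "x + r"] in \<open>simp add: DERIV_shift add.commute\<close>)
      qed (use B in auto)
      also have "\<dots> \<le> B * \<bar>h\<bar>" using s B by (intro mult_left_mono) auto
      finally show ?thesis by simp
    qed
    have "norm ((\<phi> (x + h) - deriv \<phi> x * h) - (\<phi> (x + 0) - deriv \<phi> x * 0)) \<le> B * \<bar>h\<bar> * norm (h - 0)"
    proof (rule field_differentiable_bound[OF S(1) _ _ S(3,2), of "\<lambda>s. \<phi> (x + s) - deriv \<phi> x * s"])
      show "((\<lambda>s. \<phi> (x + s) - deriv \<phi> x * s) has_real_derivative deriv \<phi> (x + r) - deriv \<phi> x) (at r within ?S)" for r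
      proof (rule has_field_derivative_at_within)
        have "((\<lambda>s. \<phi> (x + s)) has_real_derivative deriv \<phi> (x + r)) (at r)"
          using Cinf_perD(3)[OF phi_Cinf, of "x + r"] by (simp add: DERIV_shift add.commute)
        thus "((\<lambda>s. \<phi> (x + s) - deriv \<phi> x * s) has_real_derivative deriv \<phi> (x + r) - deriv \<phi> x) (at r)"
          by (auto intro!: derivative_eq_intros)
      qed
    qed (use 1 in auto)
    thus "\<bar>\<phi> (x + h) - \<phi> x - h * deriv \<phi> x\<bar> \<le> B * h\<^sup>2"
      by (simp add: power2_eq_square algebra_simps flip: abs_mult)
  qed (use B in simp)
qed

text \<open>The shift acts on the smooth wave, so no regularity of \<open>u\<close> is involved: the
  error of the difference is at most B (y - r)^2 |u|, integrable over the period.\<close>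

lemma correlation_has_derivative:
  assumes u: "u \<in> L2_per L"
  shows "((\<lambda>r. inner2 u (\<phi>\<^sub>r r)) has_real_derivative inner2 u (\<lambda>x. deriv \<phi> (x + r))) (at r)"
  unfolding has_field_derivative_def has_derivative_at_alt
proof (intro conjI allI impI)
  obtain B where B: "B \<ge> 0" "\<And>x h. \<bar>\<phi> (x + h) - \<phi> x - h * deriv \<phi> x\<bar> \<le> B * h\<^sup>2"
    using phi_first_order by blast
  let ?I = "LINT x|period_measure L. \<bar>u x\<bar>"
  have I: "?I \<ge> 0" by (rule integral_nonneg_AE) simp
  fix e :: real assume e: "e > 0"
  define Z where "Z = B * ?I + 1"
  have Z: "Z > 0" using B I by (simp add: Z_def add_nonneg_pos)
  show "\<exists>d>0. \<forall>y. norm (y - r) < d \<longrightarrow>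
     norm (inner2 u (\<phi>\<^sub>r y) - inner2 u (\<phi>\<^sub>r r) - inner2 u (\<lambda>x. deriv \<phi> (x + r)) * (y - r)) \<le> e * norm (y - r)"
  proof (intro exI[of _ "e / Z"] conjI allI impI)
    show "e / Z > 0" using e Z by simp
    fix y assume y: "norm (y - r) < e / Z"
    let ?h = "y - r"
    let ?R = "\<lambda>x. u x * (\<phi> (x + y) - \<phi> (x + r) - ?h * deriv \<phi> (x + r))"
    note i = integrable_L2_mult[OF u translate_L2] integrable_L2_mult[OF u translate_deriv_L2]
    have R_eq: "?R x = u x * \<phi> (x + y) - u x * \<phi> (x + r) - ?h * (u x * deriv \<phi> (x + r))" for x
      by (simp add: algebra_simps)
    have iR: "integrable (period_measure L) ?R"
      unfolding R_eq by (intro Bochner_Integration.integrable_diff integrable_mult_right i)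
    have eq: "inner2 u (\<phi>\<^sub>r y) - inner2 u (\<phi>\<^sub>r r) - inner2 u (\<lambda>x. deriv \<phi> (x + r)) * ?h = (LINT x|period_measure L. ?R x)"
      unfolding R_eq l2_inner_eq using i by (simp add: mult.commute)
    have "\<bar>LINT x|period_measure L. ?R x\<bar> \<le> (LINT x|period_measure L. (B * ?h\<^sup>2) * \<bar>u x\<bar>)"
    proof (rule order_trans[OF integral_abs_bound integral_mono])
      show "\<bar>?R x\<bar> \<le> (B * ?h\<^sup>2) * \<bar>u x\<bar>" for x
      proof -
        have "\<bar>\<phi> (x + y) - \<phi> (x + r) - ?h * deriv \<phi> (x + r)\<bar> \<le> B * ?h\<^sup>2"
          using B(2)[of "x + r" ?h] by simp
        from mult_left_mono[OF this abs_ge_zero[of "u x"]]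
        show ?thesis by (simp only: abs_mult mult.commute)
      qed
    qed (use iR integrable_L2[OF u] in auto)
    also have "\<dots> = (B * ?I * \<bar>?h\<bar>) * \<bar>?h\<bar>"
    proof -
      have "?h\<^sup>2 = \<bar>?h\<bar> * \<bar>?h\<bar>" by (simp add: power2_eq_square)
      thus ?thesis by (simp only: integral_mult_right_zero) (simp only: mult_ac)
    qed
    also have "\<dots> \<le> e * \<bar>?h\<bar>"
    proof (rule mult_right_mono)
      have "B * ?I * \<bar>?h\<bar> \<le> Z * \<bar>?h\<bar>" by (intro mult_right_mono) (auto simp: Z_def)
      also have "\<dots> \<le> e" using y Z by (simp add: pos_less_divide_eq mult.commute)
      finally show "B * ?I * \<bar>?h\<bar> \<le> e" .
    qed simp
    finally show "norm (inner2 u (\<phi>\<^sub>r y) - inner2 u (\<phi>\<^sub>r r) - inner2 u (\<lambda>x. deriv \<phi> (x + r)) * ?h) \<le> e * norm ?h"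
      unfolding eq real_norm_def .
  qed
qed (rule bounded_linear_mult_right)

text \<open>By the Cauchy-Schwarz inequality the autocorrelation of \<phi> is largest at shift 0,
  and its derivative there is this inner product. Consequently orthogonality of \<open>u\<close> and
  of its remainder to the derivative of a translate are the same condition.\<close>

lemma phi_orthogonal_deriv: "inner2 \<phi> (deriv \<phi>) = 0"
proof -
  have max: "inner2 \<phi> (\<phi>\<^sub>r r) \<le> inner2 \<phi> (\<phi>\<^sub>r 0)" for r
  proof -
    have "inner2 \<phi> (\<phi>\<^sub>r r) \<le> l2_norm L \<phi> * l2_norm L (\<phi>\<^sub>r r)"
      using l2_Cauchy_Schwarz[OF phi_L2 translate_L2] by (rule abs_le_D1)
    also have "l2_norm L (\<phi>\<^sub>r r) = l2_norm L \<phi>"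
      unfolding l2_norm_def l2_inner_shift[OF L_pos phi_L2 phi_L2] ..
    finally show ?thesis by (simp add: l2_norm_sq flip: power2_eq_square)
  qed
  have "inner2 \<phi> (\<lambda>x. deriv \<phi> (x + 0)) = 0"
    by (rule DERIV_local_max[OF correlation_has_derivative[OF phi_L2], of 1]) (use max in auto)
  thus ?thesis by simp
qed

text \<open>Translates share one norm, so minimizing the distance amounts to maximizing the
  correlation \<open>inner2 u (\<phi>\<^sub>r r)\<close>.\<close>

lemma l2_dist_translate:
  assumes u: "u \<in> L2_per L"
  shows "(l2_norm L (\<lambda>x. u x - \<phi>\<^sub>r r x))\<^sup>2 = inner2 u u + inner2 \<phi> \<phi> - 2 * inner2 u (\<phi>\<^sub>r r)"
  using l2_inner_lincomb_self[OF u translate_L2, of 1 "-1" r]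
  by (simp add: l2_norm_sq l2_inner_shift[OF L_pos phi_L2 phi_L2])

text \<open>The translate closest to \<open>u\<close> in $L^2$ exists by periodicity and satisfies the orthogonality
  condition, so no implicit function theorem is needed.\<close>

lemma modulation:
  assumes u: "u \<in> L2_per L"
  obtains r where "inner2 (\<lambda>x. u x - \<phi>\<^sub>r r x) (\<lambda>x. deriv \<phi> (x + r)) = 0"
    "\<And>r'. l2_norm L (\<lambda>x. u x - \<phi>\<^sub>r r x) \<le> l2_norm L (\<lambda>x. u x - \<phi>\<^sub>r r' x)"
proof -
  let ?c = "\<lambda>r. inner2 u (\<phi>\<^sub>r r)"
  have cont: "continuous_on {0..L} ?c"
    by (rule DERIV_continuous_on[OF has_field_derivative_at_within[OF correlation_has_derivative[OF u]]])
  obtain r where r: "r \<in> {0..L}" "\<And>y. y \<in> {0..L} \<Longrightarrow> ?c y \<le> ?c r"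
    using continuous_attains_sup[OF compact_Icc _ cont] L_pos by auto
  have max: "?c r' \<le> ?c r" for r'
  proof -
    define q where "q = L * frac (r' / L)"
    have q: "q \<in> {0..L}"
      using L_pos frac_ge_0[of "r' / L"] frac_lt_1[of "r' / L"] by (auto simp: q_def mult_le_cancel_left1)
    have "r' = q + of_int \<lfloor>r' / L\<rfloor> * L" using L_pos by (simp add: q_def frac_def field_simps)
    hence "\<phi> (x + r') = \<phi> (x + q)" for x
      using periodic_add_int[of \<phi> L "x + q" "\<lfloor>r' / L\<rfloor>"] Cinf_perD(1)[OF phi_Cinf]
      by (simp add: periodic_def add.assoc)
    thus ?thesis using r(2)[OF q] by simp
  qed
  have d0: "inner2 u (\<lambda>x. deriv \<phi> (x + r)) = 0"
    by (rule DERIV_local_max[OF correlation_has_derivative[OF u], of 1]) (use max in auto)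
  show ?thesis
  proof (rule that[of r])
    show "inner2 (\<lambda>x. u x - \<phi>\<^sub>r r x) (\<lambda>x. deriv \<phi> (x + r)) = 0"
      using l2_inner_lincomb_left[OF u translate_L2 translate_deriv_L2, of 1 "-1" r r]
        l2_inner_shift[OF L_pos phi_L2 dphi_L2, of r] d0 phi_orthogonal_deriv by simp
    show "l2_norm L (\<lambda>x. u x - \<phi>\<^sub>r r x) \<le> l2_norm L (\<lambda>x. u x - \<phi>\<^sub>r r' x)" for r'
      by (rule power2_le_imp_le[OF _ l2_norm_nonneg]) (use max[of r'] in \<open>simp add: l2_dist_translate[OF u]\<close>)
  qed
qed

text \<open>The orbit is bounded in $H^m$, so interpolation between $H^m$ and $L^2$ applies to
  differences of translates. It makes up for \<open>modulation\<close> giving only $L^2$ information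
  about its translate.\<close>

lemma orbit_l2_controls_nrm:
  assumes "\<epsilon> > 0"
  shows "\<exists>\<delta>>0. \<forall>r r'. l2_norm L (\<lambda>x. \<phi>\<^sub>r r x - \<phi>\<^sub>r r' x) \<le> \<delta> \<longrightarrow> nrm (\<lambda>x. \<phi>\<^sub>r r x - \<phi>\<^sub>r r' x) < \<epsilon>"
proof -
  have \<phi>m: "\<phi> \<in> H_per L m" by (rule Cinf_in_H_per[OF L_pos phi_Cinf])
  define C where "C = 2 * H_norm L m \<phi>"
  \<comment> \<open>Chosen for \<eta> C^2 \<le> \<epsilon>^2 / 4; the $L^2$ threshold \<epsilon>
    sqrt \<eta> then bounds the other interpolation term by \<epsilon>^2 / 4 as well.\<close>
  define \<eta> where "\<eta> = \<epsilon>\<^sup>2 / (4 * (C\<^sup>2 + 1))"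
  have \<eta>: "\<eta> > 0" using assms by (simp add: \<eta>_def add_nonneg_pos)
  have \<eta>C: "\<eta> * C\<^sup>2 \<le> \<epsilon>\<^sup>2 / 4"
  proof -
    have "\<eta> * C\<^sup>2 \<le> \<eta> * (C\<^sup>2 + 1)" using \<eta> by simp
    also have "\<dots> = \<epsilon>\<^sup>2 / 4"
    proof -
      have "\<epsilon>\<^sup>2 / (4 * w) * w = \<epsilon>\<^sup>2 / 4" if "w \<noteq> 0" for w using that by simp
      moreover have "C\<^sup>2 + 1 \<noteq> 0" using zero_le_power2[of C] by linarith
      ultimately show ?thesis unfolding \<eta>_def by blast
    qed
    finally show ?thesis .
  qed
  show ?thesis
  proof (intro exI[of _ "\<epsilon> * sqrt \<eta>"] conjI allI impI)
    show "\<epsilon> * sqrt \<eta> > 0" using assms \<eta> by simp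
    fix r r'
    let ?g = "\<lambda>x. \<phi>\<^sub>r r x - \<phi>\<^sub>r r' x"
    assume l2: "l2_norm L ?g \<le> \<epsilon> * sqrt \<eta>"
    have g: "?g \<in> H_per L (2 * (m / 2))"
      using H_per_diff[OF L_pos H_per_shift[OF L_pos \<phi>m] H_per_shift[OF L_pos \<phi>m]] by simp
    have gC: "H_norm L (2 * (m / 2)) ?g \<le> C"
      using H_norm_diff_le[OF L_pos H_per_shift[OF L_pos \<phi>m, of r] H_per_shift[OF L_pos \<phi>m, of r']]
      by (simp add: C_def H_norm_shift[OF L_pos \<phi>m])
    have "(nrm ?g)\<^sup>2 \<le> \<eta> * (H_norm L (2 * (m / 2)) ?g)\<^sup>2 + (l2_norm L ?g)\<^sup>2 / (4 * \<eta>)"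
      by (rule interpolation[OF L_pos g \<eta>]) (use m_pos in simp)
    also have "\<dots> \<le> \<eta> * C\<^sup>2 + (\<epsilon> * sqrt \<eta>)\<^sup>2 / (4 * \<eta>)"
      by (intro add_mono mult_left_mono divide_right_mono power_mono gC l2 H_norm_nonneg l2_norm_nonneg L_pos)
         (use \<eta> in auto)
    also have "\<dots> \<le> \<epsilon>\<^sup>2 / 4 + \<epsilon>\<^sup>2 / 4" using \<eta>C \<eta> by (simp add: power_mult_distrib)
    also have "\<dots> < \<epsilon>\<^sup>2" using assms by simp
    finally show "nrm ?g < \<epsilon>" by (rule power2_less_imp_less) (use assms in simp)
  qed
qed

section \<open>The distance to the orbit and the conclusion\<close>

lemma orbit_dist_le: "orbit_dist L m v \<phi> \<le> nrm (\<lambda>x. v x - \<phi>\<^sub>r r x)"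
  unfolding orbit_dist_def by (rule cINF_lower) (auto intro!: bdd_belowI[of _ 0] nrm_nonneg)

lemma orbit_dist_lessD:
  assumes "orbit_dist L m v \<phi> < \<epsilon>"
  shows "\<exists>r. nrm (\<lambda>x. v x - \<phi>\<^sub>r r x) < \<epsilon>"
proof (rule ccontr)
  assume "\<not> ?thesis"
  hence "\<epsilon> \<le> orbit_dist L m v \<phi>"
    unfolding orbit_dist_def by (intro cINF_greatest) (auto simp: not_less)
  thus False using assms by simp
qed

text \<open>The triangle inequality followed by an infimum over translates; this is the source of
  the continuity in time of the distance along a solution.\<close>

lemma orbit_dist_diff_le:
  assumes "u \<in> X" "v \<in> X"
  shows "orbit_dist L m u \<phi> \<le> orbit_dist L m v \<phi> + nrm (\<lambda>x. u x - v x)"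
proof -
  have "orbit_dist L m u \<phi> - nrm (\<lambda>x. u x - v x) \<le> nrm (\<lambda>x. v x - \<phi>\<^sub>r r x)" for r
    using orbit_dist_le[of u r] H_norm_triangle[OF L_pos H_per_diff[OF L_pos assms]
        H_per_diff[OF L_pos assms(2) translate_in_X], of r] by simp
  hence "orbit_dist L m u \<phi> - nrm (\<lambda>x. u x - v x) \<le> orbit_dist L m v \<phi>"
    unfolding orbit_dist_def[of L m v] by (intro cINF_greatest) auto
  thus ?thesis by simp
qed

text \<open>The translate that nearly attains the distance and the one given by
  \<open>modulation\<close> may differ. Both are close to \<open>u\<close> in $L^2$, hence to each
  other in $L^2$ and, by \<open>orbit_l2_controls_nrm\<close>, in \<open>nrm\<close>. So the
  orthogonal remainder is small in \<open>nrm\<close> and falls under the local bound.\<close>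

lemma lyapunov_controls_orbit_dist:
  obtains K c \<eta> where "c > 0" "\<eta> > 0"
    "\<And>u. u \<in> X \<Longrightarrow> orbit_dist L m u \<phi> < \<eta> \<Longrightarrow> \<exists>r. c * (nrm (\<lambda>x. u x - \<phi>\<^sub>r r x))\<^sup>2 \<le> lyapunov K u"
    "\<And>\<epsilon>. \<epsilon> > 0 \<Longrightarrow> \<exists>d>0. \<forall>u\<in>X. nrm (\<lambda>x. u x - \<phi> x) < d \<longrightarrow> lyapunov K u < \<epsilon>"
proof -
  obtain K c \<delta> where c: "c > 0" and \<delta>: "\<delta> > 0"
    and low: "\<And>h. h \<in> X \<Longrightarrow> nrm h < \<delta> \<Longrightarrow> inner2 h (deriv \<phi>) = 0 \<Longrightarrow> lyapunov K (\<lambda>x. \<phi> x + h x) \<ge> c * (nrm h)\<^sup>2"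
    and up: "\<And>\<epsilon>. \<epsilon> > 0 \<Longrightarrow> \<exists>d>0. \<forall>h\<in>X. nrm h < d \<longrightarrow> lyapunov K (\<lambda>x. \<phi> x + h x) < \<epsilon>"
    by (rule lyapunov_local) blast
  obtain C where C: "C > 0" "\<And>h. h \<in> X \<Longrightarrow> l2_norm L h \<le> C * nrm h" using l2_norm_le_nrm by blast
  obtain \<eta>1 where \<eta>1: "\<eta>1 > 0"
    "\<And>r r'. l2_norm L (\<lambda>x. \<phi>\<^sub>r r x - \<phi>\<^sub>r r' x) \<le> \<eta>1 \<Longrightarrow> nrm (\<lambda>x. \<phi>\<^sub>r r x - \<phi>\<^sub>r r' x) < \<delta> / 2"
    using orbit_l2_controls_nrm[OF half_gt_zero[OF \<delta>]] by blast
  \<comment> \<open>\<open>\<delta> / 2\<close> is one leg of the triangle inequality in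
    \<open>nrm\<close>. The other entry keeps the $L^2$ distance to the first translate below
    \<open>\<eta>1 / 2\<close>, and the closest translate is at least as near.\<close>
  define \<eta> where "\<eta> = min (\<delta> / 2) (\<eta>1 / (2 * C))"
  show ?thesis
  proof (rule that[of c \<eta> K])
    show "\<eta> > 0" using \<delta> \<eta>1(1) C by (simp add: \<eta>_def)
    show "\<exists>r. c * (nrm (\<lambda>x. u x - \<phi>\<^sub>r r x))\<^sup>2 \<le> lyapunov K u"
      if u: "u \<in> X" and d: "orbit_dist L m u \<phi> < \<eta>" for u
    proof -
      obtain r0 where r0: "nrm (\<lambda>x. u x - \<phi>\<^sub>r r0 x) < \<eta>" using orbit_dist_lessD[OF d] by blast
      obtain r where r: "inner2 (\<lambda>x. u x - \<phi>\<^sub>r r x) (\<lambda>x. deriv \<phi> (x + r)) = 0"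
        "\<And>r'. l2_norm L (\<lambda>x. u x - \<phi>\<^sub>r r x) \<le> l2_norm L (\<lambda>x. u x - \<phi>\<^sub>r r' x)"
        by (rule modulation[OF X_L2[OF u]]) blast
      have D: "(\<lambda>x. u x - \<phi>\<^sub>r r' x) \<in> X" for r' by (rule H_per_diff[OF L_pos u translate_in_X])
      have l0: "l2_norm L (\<lambda>x. u x - \<phi>\<^sub>r r0 x) \<le> \<eta>1 / 2"
      proof -
        have "l2_norm L (\<lambda>x. u x - \<phi>\<^sub>r r0 x) \<le> C * \<eta>"
          using C(2)[OF D[of r0]] mult_left_mono[OF less_imp_le[OF r0], of C] C(1) by linarith
        also have "\<dots> \<le> C * (\<eta>1 / (2 * C))" using C(1) by (intro mult_left_mono) (auto simp: \<eta>_def)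
        also have "\<dots> = \<eta>1 / 2" using C(1) by simp
        finally show ?thesis .
      qed
      have "l2_norm L (\<lambda>x. \<phi>\<^sub>r r0 x - \<phi>\<^sub>r r x) \<le> \<bar>1\<bar> * l2_norm L (\<lambda>x. u x - \<phi>\<^sub>r r x) + \<bar>-1\<bar> * l2_norm L (\<lambda>x. u x - \<phi>\<^sub>r r0 x)"
        using l2_norm_lincomb_le[OF X_L2[OF D[of r]] X_L2[OF D[of r0]], of 1 "-1"] by simp
      also have "\<dots> \<le> \<eta>1" using l0 r(2)[of r0] by simp
      finally have "nrm (\<lambda>x. \<phi>\<^sub>r r0 x - \<phi>\<^sub>r r x) < \<delta> / 2" by (rule \<eta>1(2))
      moreover have "nrm (\<lambda>x. u x - \<phi>\<^sub>r r x) \<le> nrm (\<lambda>x. u x - \<phi>\<^sub>r r0 x) + nrm (\<lambda>x. \<phi>\<^sub>r r0 x - \<phi>\<^sub>r r x)"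
        using H_norm_triangle[OF L_pos D[of r0] H_per_diff[OF L_pos translate_in_X translate_in_X], of r0 r] by simp
      ultimately have small: "nrm (\<lambda>x. u x - \<phi>\<^sub>r r x) < \<delta>" using r0 by (simp add: \<eta>_def)
      \<comment> \<open>Shifting by \<open>- r\<close> carries the chosen translate to \<phi>, the
        frame in which \<open>low\<close> is stated.\<close>
      let ?h = "\<lambda>x. u (x + - r) - \<phi> x"
      have h_shift: "?h = (\<lambda>x. (\<lambda>x. u x - \<phi>\<^sub>r r x) (x + - r))" by simp
      have h: "?h \<in> X" unfolding h_shift by (rule H_per_shift[OF L_pos D])
      have nh: "nrm ?h = nrm (\<lambda>x. u x - \<phi>\<^sub>r r x)" unfolding h_shift by (rule H_norm_shift[OF L_pos D])
      have "inner2 ?h (deriv \<phi>) = inner2 (\<lambda>x. u x - \<phi>\<^sub>r r x) (\<lambda>x. deriv \<phi> (x + r))"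
        using l2_inner_shift[OF L_pos X_L2[OF h] dphi_L2, of r] by simp
      hence "inner2 ?h (deriv \<phi>) = 0" using r(1) by (simp only:)
      moreover have "nrm ?h < \<delta>" unfolding nh by (rule small)
      ultimately have "lyapunov K (\<lambda>x. \<phi> x + ?h x) \<ge> c * (nrm ?h)\<^sup>2" by (intro low[OF h])
      moreover have "lyapunov K (\<lambda>x. \<phi> x + ?h x) = lyapunov K u"
        using lyapunov_shift[OF u, of K "- r"] by simp
      ultimately show ?thesis unfolding nh by auto
    qed
    fix \<epsilon> :: real assume "\<epsilon> > 0"
    then obtain d where d: "d > 0" "\<And>h. h \<in> X \<Longrightarrow> nrm h < d \<Longrightarrow> lyapunov K (\<lambda>x. \<phi> x + h x) < \<epsilon>"
      using up by blast
    show "\<exists>d>0. \<forall>u\<in>X. nrm (\<lambda>x. u x - \<phi> x) < d \<longrightarrow> lyapunov K u < \<epsilon>"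
    proof (intro exI[of _ d] conjI ballI impI d(1))
      fix u assume u: "u \<in> X" "nrm (\<lambda>x. u x - \<phi> x) < d"
      show "lyapunov K u < \<epsilon>" using d(2)[OF H_per_diff[OF L_pos u(1) phi_in_X] u(2)] by simp
    qed
  qed (rule c)
qed

text \<open>The conserved quantity stays below c (\<eta> / 2)^2, so a distance below \<eta> is
  automatically below \<eta> / 2. The distance therefore has no values in [\<eta> / 2, \<eta>), and
  being continuous it cannot jump over this gap.\<close>

theorem orbital_stability:
  assumes s: "s \<ge> m / 2" and gwp: "globally_well_posed \<theta> f L s" and cons: "functionals_conserved \<theta> f W L s"
  shows "orbitally_stable \<theta> f L m s \<phi>"
  unfolding orbitally_stable_def
proof (intro allI impI)
  obtain K c \<eta>0 where c: "c > 0" and \<eta>0: "\<eta>0 > 0"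
    and low: "\<And>u. u \<in> X \<Longrightarrow> orbit_dist L m u \<phi> < \<eta>0 \<Longrightarrow> \<exists>r. c * (nrm (\<lambda>x. u x - \<phi>\<^sub>r r x))\<^sup>2 \<le> lyapunov K u"
    and up: "\<And>\<epsilon>. \<epsilon> > 0 \<Longrightarrow> \<exists>d>0. \<forall>u\<in>X. nrm (\<lambda>x. u x - \<phi> x) < d \<longrightarrow> lyapunov K u < \<epsilon>"
    by (rule lyapunov_controls_orbit_dist) blast
  fix \<epsilon> :: real assume \<epsilon>: "\<epsilon> > 0"
  \<comment> \<open>At most \<open>\<eta>0\<close> to stay where \<open>low\<close> holds, at most
    \<epsilon> for the conclusion.\<close>
  define \<eta> where "\<eta> = min \<epsilon> \<eta>0"
  have \<eta>: "\<eta> > 0" "\<eta> \<le> \<epsilon>" "\<eta> \<le> \<eta>0" using \<epsilon> \<eta>0 by (auto simp: \<eta>_def)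
  obtain d where d: "d > 0" "\<And>u. u \<in> X \<Longrightarrow> nrm (\<lambda>x. u x - \<phi> x) < d \<Longrightarrow> lyapunov K u < c * (\<eta> / 2)\<^sup>2"
    using up[of "c * (\<eta> / 2)\<^sup>2"] c \<eta>(1) by (auto intro: that)
  show "\<exists>\<delta>>0. \<forall>u0\<in>H_per L s. nrm (\<lambda>x. u0 x - \<phi> x) < \<delta> \<longrightarrow>
        (\<exists>u. solution \<theta> f L s u0 u) \<and>
        (\<forall>u. solution \<theta> f L s u0 u \<longrightarrow> (\<forall>t\<ge>0. orbit_dist L m (u t) \<phi> < \<epsilon>))"
  \<comment> \<open>\<open>d\<close> limits the initial value of the conserved quantity,
    \<open>\<eta> / 2\<close> the initial distance.\<close>
  proof (intro exI[of _ "min d (\<eta> / 2)"] conjI ballI impI allI)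
    show "min d (\<eta> / 2) > 0" using d(1) \<eta>(1) by simp
    fix u0 assume u0: "u0 \<in> H_per L s" and close: "nrm (\<lambda>x. u0 x - \<phi> x) < min d (\<eta> / 2)"
    show "\<exists>u. solution \<theta> f L s u0 u" using gwp u0 by (simp add: globally_well_posed_def)
    fix u t assume sol: "solution \<theta> f L s u0 u" and t: "0 \<le> (t::real)"
    have u0X: "u0 \<in> X" by (rule H_per_mono[OF L_pos s u0])
    have uH: "u \<tau> \<in> H_per L s" if "\<tau> \<ge> 0" for \<tau> using sol that by (simp add: solution_def)
    have uX: "u \<tau> \<in> X" if "\<tau> \<ge> 0" for \<tau> by (rule H_per_mono[OF L_pos s uH[OF that]])
    let ?\<rho> = "\<lambda>\<tau>. orbit_dist L m (u \<tau>) \<phi>"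
    have lyap: "lyapunov K (u \<tau>) < c * (\<eta> / 2)\<^sup>2" if "\<tau> \<ge> 0" for \<tau>
    proof -
      have "lyapunov K (u \<tau>) = lyapunov K u0"
        using cons u0 sol that by (simp add: functionals_conserved_def lyapunov_def energy_def Q_fun_def)
      thus ?thesis using d(2)[OF u0X] close by simp
    qed
    have gap: "?\<rho> \<tau> < \<eta> / 2" if \<tau>: "\<tau> \<ge> 0" "?\<rho> \<tau> < \<eta>" for \<tau>
    proof -
      obtain r where r: "c * (nrm (\<lambda>x. u \<tau> x - \<phi>\<^sub>r r x))\<^sup>2 \<le> lyapunov K (u \<tau>)"
        using low[OF uX[OF \<tau>(1)]] \<tau>(2) \<eta>(3) by auto
      hence "c * (nrm (\<lambda>x. u \<tau> x - \<phi>\<^sub>r r x))\<^sup>2 < c * (\<eta> / 2)\<^sup>2" using lyap[OF \<tau>(1)] by linarith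
      hence "(nrm (\<lambda>x. u \<tau> x - \<phi>\<^sub>r r x))\<^sup>2 < (\<eta> / 2)\<^sup>2" using c by simp
      hence "nrm (\<lambda>x. u \<tau> x - \<phi>\<^sub>r r x) < \<eta> / 2" by (rule power2_less_imp_less) (use \<eta> in simp)
      thus ?thesis using orbit_dist_le[of "u \<tau>" r] by linarith
    qed
    have cont: "continuous_on {0..} ?\<rho>"
      unfolding continuous_on_def
    proof
      fix \<tau> :: real assume \<tau>: "\<tau> \<in> {0..}"
      have "((\<lambda>t'. H_norm L s (\<lambda>x. u t' x - u \<tau> x)) \<longlongrightarrow> 0) (at \<tau> within {0..})"
        using sol \<tau> by (simp add: solution_def)
      hence "((\<lambda>t'. ?\<rho> t' - ?\<rho> \<tau>) \<longlongrightarrow> 0) (at \<tau> within {0..})"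
      proof (rule Lim_null_comparison[rotated])
        have "norm (?\<rho> t' - ?\<rho> \<tau>) \<le> H_norm L s (\<lambda>x. u t' x - u \<tau> x)" if t': "t' \<in> {0..}" for t'
        proof -
          have X: "u t' \<in> X" "u \<tau> \<in> X" using uX \<tau> t' by auto
          have "nrm (\<lambda>x. u \<tau> x - u t' x) = nrm (\<lambda>x. u t' x - u \<tau> x)"
            using nrm_mult[OF H_per_diff[OF L_pos X], of "-1"] by simp
          moreover have "nrm (\<lambda>x. u t' x - u \<tau> x) \<le> H_norm L s (\<lambda>x. u t' x - u \<tau> x)"
            by (rule H_norm_mono[OF L_pos s H_per_diff[OF L_pos]]) (use uH \<tau> t' in auto)
          ultimately show ?thesis using orbit_dist_diff_le[OF X] orbit_dist_diff_le[OF X(2,1)] by simp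
        qed
        thus "\<forall>\<^sub>F t' in at \<tau> within {0..}. norm (?\<rho> t' - ?\<rho> \<tau>) \<le> H_norm L s (\<lambda>x. u t' x - u \<tau> x)"
          by (auto simp: eventually_at_filter)
      qed
      from tendsto_add[OF this tendsto_const[of "?\<rho> \<tau>"]]
      show "(?\<rho> \<longlongrightarrow> ?\<rho> \<tau>) (at \<tau> within {0..})" by simp
    qed
    have start: "?\<rho> 0 < \<eta> / 2"
    proof -
      \<comment> \<open>The datum is attained only almost everywhere, which the norm does not
        notice.\<close>
      have ae: "AE x in lborel. u 0 x = u0 x" using sol by (simp add: solution_def)
      have "nrm (\<lambda>x. u 0 x - \<phi> x) = nrm (\<lambda>x. u0 x - \<phi> x)"
      proof (rule H_norm_cong_AE)
        show "AE x in lborel. u 0 x - \<phi> x = u0 x - \<phi> x" using ae by auto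
      qed (use L2_perD(2)[OF X_L2[OF H_per_diff[OF L_pos uX[of 0] phi_in_X]]]
             L2_perD(2)[OF X_L2[OF H_per_diff[OF L_pos u0X phi_in_X]]] in simp_all)
      thus ?thesis using orbit_dist_le[of "u 0" 0] close by simp
    qed
    have "?\<rho> t < \<eta>"
    proof (rule ccontr)
      assume "\<not> ?\<rho> t < \<eta>"
      \<comment> \<open>3 \<eta> / 4 is a value inside the gap that a crossing would have to
        attain.\<close>
      hence "\<exists>\<tau>. 0 \<le> \<tau> \<and> \<tau> \<le> t \<and> ?\<rho> \<tau> = 3 / 4 * \<eta>"
        using start \<eta>(1) t by (intro IVT' continuous_on_subset[OF cont]) auto
      thus False using gap \<eta>(1) by fastforce
    qed
    thus "?\<rho> t < \<epsilon>" using \<eta>(2) by simp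
  qed
qed

end

theorem theorem3p6:
  fixes L m s \<omega> A \<mu> \<nu> :: real
    and \<theta> f W \<phi> :: "real \<Rightarrow> real"
  defines "Lop \<equiv> linearized_op \<theta> f \<omega> L \<phi>"
    and "Q' \<equiv> (\<lambda>x. \<mu> + \<nu> * \<phi> x)"
  assumes "L > 0"
    and "smooth f"
    and "\<And>x. (W has_real_derivative f x) (at x)"
    and "admissible_symbol \<theta> m"
    and "functionals_smooth \<theta> W L m"
    and "traveling_wave \<theta> f \<omega> A L \<phi>"
    and "(\<mu>, \<nu>) \<noteq> (0, 0)"
    and "s \<ge> m / 2"
    and "globally_well_posed \<theta> f L s"
    and "functionals_conserved \<theta> f W L s"
    and H0_negative: "\<exists>\<sigma><0. simple_eigenvalue (H_per L m) Lop \<sigma> \<and>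
          (\<forall>\<sigma>'<0. eigenvalue (H_per L m) Lop \<sigma>' \<longrightarrow> \<sigma>' = \<sigma>)"
    and H0_zero: "simple_eigenvalue (H_per L m) Lop 0"
          "eigenfunction (H_per L m) Lop 0 (deriv \<phi>)"
    and H1: "\<exists>c1>0. \<exists>c2>0. \<forall>v\<in>Cinf_per L.
          l2_inner L (Lop v) v \<ge> c1 * (H_norm L (m / 2) v)\<^sup>2 - c2 * (l2_norm L v)\<^sup>2"
    and H2: "\<exists>c3>0. \<forall>v\<in>H_per L m. l2_inner L v (deriv \<phi>) = 0 \<longrightarrow> l2_inner L v Q' = 0 \<longrightarrow>
          l2_inner L (Lop v) v \<ge> c3 * (l2_norm L v)\<^sup>2"
  shows "orbitally_stable \<theta> f L m s \<phi>"
proof -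
  interpret periodic_wave L m \<omega> A \<mu> \<nu> \<theta> f W \<phi>
    by unfold_locales (use assms(3-8) H1 H2 in \<open>auto simp: Lop_def Q'_def\<close>)
  show ?thesis by (rule orbital_stability) (use assms in auto)
qed

end
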